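(* Let $a,b,c\in\mathbb{R}$ with $a,c\neq 0$ and let $(X,J_{a,b,c},\omega_{a,b,c})$ be the compact almost-Kähler manifold described in the context, with Hermitian metric $g_{a,b,c}(u,v)=\omega_{a,b,c}(u,J_{a,b,c}v)$. Then $h^{1,0}_{\bar\delta}=1$, $h^{2,0}_{\bar\delta}=0$, $h^{3,0}_{\bar\delta}=0$.
   Context: General notions. For an almost-complex manifold $(X,J)$, $A^k(X)=\bigoplus_{p+q=k}A^{p,q}(X)$ and $d=\mu+\partial+\overline{\partial}+\bar\mu$ with $\mu:A^{p,q}\to A^{p+2,q-1}$, $\partial:A^{p,q}\to A^{p+1,q}$, $\overline{\partial}:A^{p,q}\to A^{p,q+1}$, $\bar\mu:A^{p,q}\to A^{p-1,q+2}$. Given a $J$-Hermitian metric on compact $X$, with $L^2$-adjoints denoted by ${}^*$, set $\bar\delta:=\overline{\partial}+\mu$, $\Delta_{\bar\delta}:=\bar\delta\bar\delta^*+\bar\delta^*\bar\delta$, and $h^{p,0}_{\bar\delta}:=\dim_{\mathbb{C}}\{\psi\in A^{p,0}(X):\Delta_{\bar\delta}\psi=0\}$. The manifold. Let $G$ be the Lie group $\mathbb{R}^2\ltimes_\Phi\mathbb{R}^4$ with coordinates $(t,x,y_1,y_2,z_1,z_2)$ and product $(t,x,y_1,y_2,z_1,z_2)*(t',x',y_1',y_2',z_1',z_2')=(t+t',x+x',y_1'e^t+xz_1'e^t+y_1,\,y_2'e^{-t}+xz_2'e^{-t}+y_2,\,z_1'e^t+z_1,\,z_2'e^{-t}+z_2)$.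 Let $B\in SL(2,\mathbb{Z})$ have distinct eigenvalues $e^{a_0},e^{-a_0}$ ($a_0>0$) and $P$ real invertible with $PBP^{-1}=\mathrm{diag}(e^{a_0},e^{-a_0})$. Let $\Gamma$ be the lattice of elements with $t\in a_0\mathbb{Z}$, $x\in\mathbb{Z}$, $(y_1,y_2)=(m_1,m_2)P^t$, $(z_1,z_2)=(n_1,n_2)P^t$, $m_i,n_i\in\mathbb{Z}$, and $X=\Gamma\backslash G$. Left-invariant $1$-forms: $e^1=dt$, $e^2=dx$, $e^3=e^{-t}dy_1-xe^{-t}dz_1$, $e^4=e^{t}dy_2-xe^{t}dz_2$, $e^5=e^{-t}dz_1$, $e^6=e^tdz_2$, with $de^1=de^2=0$, $de^3=-e^{13}-e^{25}$, $de^4=e^{14}-e^{26}$, $de^5=-e^{15}$, $de^6=e^{16}$. The structures. For $a,b,c\in\mathbb{R}$, $a,c\neq0$: $\omega_{a,b,c}=ae^{12}+be^{56}+c(e^{36}+e^{45})$, and $J_{a,b,c}$ is the almost-complex structure whose $(1,0)$-forms are spanned by $\varphi^1=ae^1+ie^2$, $\varphi^2=be^5+ce^3+ie^6$, $\varphi^3=ce^4+ie^5$; $(X,J_{a,b,c},\omega_{a,b,c})$ is almost-Kähler. *)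

theory Defs
  imports "HOL-Analysis.Analysis" "HOL-Library.Function_Algebras"
begin

text \<open>Points of G = R^2 semidirect R^4, coordinates (t,x,y1,y2,z1,z2).\<close>
type_synonym pt = "real \<times> real \<times> real \<times> real \<times> real \<times> real"

definition gmul :: "pt \<Rightarrow> pt \<Rightarrow> pt" where
  "gmul p q = (case p of (t,x,y1,y2,z1,z2) \<Rightarrow> case q of (t',x',y1',y2',z1',z2') \<Rightarrow>
     (t + t', x + x', y1' * exp t + x * z1' * exp t + y1, y2' * exp (-t) + x * z2' * exp (-t) + y2,
      z1' * exp t + z1, z2' * exp (-t) + z2))"

definition Gam :: "real \<Rightarrow> real^2^2 \<Rightarrow> pt set" where
  "Gam a0 P = {(t,x,y1,y2,z1,z2). (\<exists>k::int. t = a0 * of_int k) \<and> (\<exists>n::int. x = of_int n) \<and>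
      (\<exists>m1 m2::int. y1 = P$1$1 * of_int m1 + P$1$2 * of_int m2 \<and> y2 = P$2$1 * of_int m1 + P$2$2 * of_int m2) \<and>
      (\<exists>n1 n2::int. z1 = P$1$1 * of_int n1 + P$1$2 * of_int n2 \<and> z2 = P$2$1 * of_int n1 + P$2$2 * of_int n2)}"

fun Ck :: "nat \<Rightarrow> (pt \<Rightarrow> complex) \<Rightarrow> bool" where
  "Ck 0 f = continuous_on UNIV f"
| "Ck (Suc k) f = ((\<forall>p. f differentiable (at p)) \<and>
      (\<forall>v\<in>(Basis :: pt set). Ck k (\<lambda>p. frechet_derivative f (at p) v)))"

definition smooth_fun :: "(pt \<Rightarrow> complex) \<Rightarrow> bool" where
  "smooth_fun f \<longleftrightarrow> (\<forall>k. Ck k f)"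

definition Gam_inv :: "real \<Rightarrow> real^2^2 \<Rightarrow> (pt \<Rightarrow> complex) \<Rightarrow> bool" where
  "Gam_inv a0 P f \<longleftrightarrow> (\<forall>\<gamma>\<in>Gam a0 P. \<forall>p. f (gmul \<gamma> p) = f p)"

text \<open>cof i p v = e^i at the point p applied to the tangent vector v (coordinate components).\<close>
definition cof :: "nat \<Rightarrow> pt \<Rightarrow> pt \<Rightarrow> real" where
  "cof i p v = (case p of (t,x,y1,y2,z1,z2) \<Rightarrow> case v of (vt,vx,vy1,vy2,vz1,vz2) \<Rightarrow>
     (if i = 1 then vt else if i = 2 then vx
      else if i = 3 then exp (-t) * vy1 - x * exp (-t) * vz1
      else if i = 4 then exp t * vy2 - x * exp t * vz2
      else if i = 5 then exp (-t) * vz1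
      else if i = 6 then exp t * vz2 else 0))"

definition frv :: "nat \<Rightarrow> pt \<Rightarrow> pt" where
  "frv i p = (THE v. \<forall>k\<in>{1..6}. cof k p v = (if k = i then 1 else 0))"

definition Eder :: "nat \<Rightarrow> (pt \<Rightarrow> complex) \<Rightarrow> pt \<Rightarrow> complex" where
  "Eder i f p = frechet_derivative f (at p) (frv i p)"

text \<open>A form is given by its coefficient functions: alpha T p is the coefficient of
  e^{t1} wedge ... wedge e^{tk} (t1 < ... < tk the elements of T).\<close>
type_synonym form = "nat set \<Rightarrow> pt \<Rightarrow> complex"

definition wsign :: "nat set \<Rightarrow> nat set \<Rightarrow> complex" where
  "wsign I K = (-1) ^ card {(i,k). i \<in> I \<and> k \<in> K \<and> k < i}"

definition wedge :: "form \<Rightarrow> form \<Rightarrow> form" where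
  "wedge \<alpha> \<beta> S p = (if S \<subseteq> {1..6} then (\<Sum>I\<in>Pow S. wsign I (S - I) * \<alpha> I p * \<beta> (S - I) p) else 0)"

definition eb :: "nat \<Rightarrow> form" where
  "eb i = (\<lambda>S p. if S = {i} then 1 else 0)"

fun ebl :: "nat list \<Rightarrow> form" where
  "ebl [] = (\<lambda>S p. if S = {} then 1 else 0)"
| "ebl (i # is) = wedge (eb i) (ebl is)"

definition deb :: "nat \<Rightarrow> form" where
  "deb i = (if i = 3 then (\<lambda>S p. - wedge (eb 1) (eb 3) S p - wedge (eb 2) (eb 5) S p)
      else if i = 4 then (\<lambda>S p. wedge (eb 1) (eb 4) S p - wedge (eb 2) (eb 6) S p)
      else if i = 5 then (\<lambda>S p. - wedge (eb 1) (eb 5) S p)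
      else if i = 6 then (\<lambda>S p. wedge (eb 1) (eb 6) S p)
      else (\<lambda>S p. 0))"

text \<open>d(e^{i1} wedge ... wedge e^{ik}) by the Leibniz rule.\<close>
fun debl :: "nat list \<Rightarrow> form" where
  "debl [] = (\<lambda>S p. 0)"
| "debl (i # is) = (\<lambda>S p. wedge (deb i) (ebl is) S p - wedge (eb i) (debl is) S p)"

definition dext :: "form \<Rightarrow> form" where
  "dext \<alpha> S p = (\<Sum>T\<in>Pow {1..6}.
      (\<Sum>i\<in>{1..6}. wedge (\<lambda>R q. if R = {i} then Eder i (\<alpha> T) q else 0) (ebl (sorted_list_of_set T)) S p)
      + \<alpha> T p * debl (sorted_list_of_set T) S p)"

definition smooth_forms :: "real \<Rightarrow> real^2^2 \<Rightarrow> form set" where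
  "smooth_forms a0 P = {\<alpha>. (\<forall>T. \<not> T \<subseteq> {1..6} \<longrightarrow> (\<forall>p. \<alpha> T p = 0)) \<and>
      (\<forall>T. smooth_fun (\<alpha> T) \<and> Gam_inv a0 P (\<alpha> T))}"

text \<open>thc a b c k j: coefficient of e^j in theta^k, where theta^1,theta^2,theta^3 = phi^1,phi^2,phi^3
  (spanning the (1,0)-forms) and theta^4,theta^5,theta^6 are their conjugates.\<close>
definition phc :: "real \<Rightarrow> real \<Rightarrow> real \<Rightarrow> nat \<Rightarrow> nat \<Rightarrow> complex" where
  "phc a b c k j =
     (if k = 1 then (if j = 1 then complex_of_real a else if j = 2 then \<i> else 0)
      else if k = 2 then (if j = 5 then complex_of_real b else if j = 3 then complex_of_real c else if j = 6 then \<i> else 0)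
      else if k = 3 then (if j = 4 then complex_of_real c else if j = 5 then \<i> else 0)
      else 0)"

definition thc :: "real \<Rightarrow> real \<Rightarrow> real \<Rightarrow> nat \<Rightarrow> nat \<Rightarrow> complex" where
  "thc a b c k j = (if k \<in> {1,2,3} then phc a b c k j else if k \<in> {4,5,6} then cnj (phc a b c (k - 3) j) else 0)"

definition theta :: "real \<Rightarrow> real \<Rightarrow> real \<Rightarrow> nat \<Rightarrow> form" where
  "theta a b c k = (\<lambda>S p. if \<exists>j\<in>{1..6}. S = {j} then thc a b c k (the_elem S) else 0)"

fun thetal :: "real \<Rightarrow> real \<Rightarrow> real \<Rightarrow> nat list \<Rightarrow> form" where
  "thetal a b c [] = (\<lambda>S p. if S = {} then 1 else 0)"
| "thetal a b c (k # ks) = wedge (theta a b c k) (thetal a b c ks)"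

definition thcoef :: "real \<Rightarrow> real \<Rightarrow> real \<Rightarrow> form \<Rightarrow> pt \<Rightarrow> nat set \<Rightarrow> complex" where
  "thcoef a b c \<alpha> p = (THE co. (\<forall>S. \<not> S \<subseteq> {1..6} \<longrightarrow> co S = 0) \<and>
      (\<forall>T. \<alpha> T p = (\<Sum>S\<in>Pow {1..6}. co S * thetal a b c (sorted_list_of_set S) T p)))"

definition proj :: "real \<Rightarrow> real \<Rightarrow> real \<Rightarrow> nat \<Rightarrow> nat \<Rightarrow> form \<Rightarrow> form" where
  "proj a b c r s \<alpha> T p = (\<Sum>S\<in>{S\<in>Pow {1..6}. card (S \<inter> {1,2,3}) = r \<and> card (S \<inter> {4,5,6}) = s}.
      thcoef a b c \<alpha> p S * thetal a b c (sorted_list_of_set S) T p)"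

text \<open>delta-bar = dbar + mu, with dbar: A^{p,q} -> A^{p,q+1} and mu: A^{p,q} -> A^{p+2,q-1}
  the corresponding components of d.\<close>
definition dbar_mu :: "real \<Rightarrow> real \<Rightarrow> real \<Rightarrow> form \<Rightarrow> form" where
  "dbar_mu a b c \<alpha> T p = (\<Sum>r\<le>3. \<Sum>s\<le>3.
      proj a b c r (s + 1) (dext (proj a b c r s \<alpha>)) T p
      + (if 1 \<le> s then proj a b c (r + 2) (s - 1) (dext (proj a b c r s \<alpha>)) T p else 0))"

text \<open>Tangent vectors in frame components (v i = e^i(v)); omega_{a,b,c}.\<close>
definition omg :: "real \<Rightarrow> real \<Rightarrow> real \<Rightarrow> (nat \<Rightarrow> real) \<Rightarrow> (nat \<Rightarrow> real) \<Rightarrow> real" where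
  "omg a b c u v = a * (u 1 * v 2 - u 2 * v 1) + b * (u 5 * v 6 - u 6 * v 5)
      + c * ((u 3 * v 6 - u 6 * v 3) + (u 4 * v 5 - u 5 * v 4))"

definition Jm :: "real \<Rightarrow> real \<Rightarrow> real \<Rightarrow> nat \<Rightarrow> nat \<Rightarrow> real" where
  "Jm a b c = (THE M. (\<forall>i j. (i \<notin> {1..6} \<or> j \<notin> {1..6}) \<longrightarrow> M i j = 0) \<and>
      (\<forall>k\<in>{1,2,3}. \<forall>v::nat \<Rightarrow> real.
         (\<Sum>j\<in>{1..6}. phc a b c k j * complex_of_real (\<Sum>l\<in>{1..6}. M j l * v l))
         = \<i> * (\<Sum>j\<in>{1..6}. phc a b c k j * complex_of_real (v j))))"

definition Gm :: "real \<Rightarrow> real \<Rightarrow> real \<Rightarrow> nat \<Rightarrow> nat \<Rightarrow> real" where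
  "Gm a b c i j = omg a b c (\<lambda>l. if l = i then 1 else 0) (\<lambda>l. Jm a b c l j)"

definition Ginv :: "real \<Rightarrow> real \<Rightarrow> real \<Rightarrow> nat \<Rightarrow> nat \<Rightarrow> real" where
  "Ginv a b c = (THE H. (\<forall>i j. (i \<notin> {1..6} \<or> j \<notin> {1..6}) \<longrightarrow> H i j = 0) \<and>
      (\<forall>i\<in>{1..6}. \<forall>j\<in>{1..6}. (\<Sum>k\<in>{1..6}. H i k * Gm a b c k j) = (if i = j then 1 else 0)))"

definition mdet :: "(nat \<Rightarrow> nat \<Rightarrow> real) \<Rightarrow> nat list \<Rightarrow> nat list \<Rightarrow> real" where
  "mdet M r s = (\<Sum>\<sigma>\<in>{\<sigma>. \<sigma> permutes {..<length r}}.
      of_int (sign \<sigma>) * (\<Prod>i<length r. M (r ! i) (s ! (\<sigma> i))))"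

definition pip :: "real \<Rightarrow> real \<Rightarrow> real \<Rightarrow> form \<Rightarrow> form \<Rightarrow> pt \<Rightarrow> complex" where
  "pip a b c \<alpha> \<beta> p = (\<Sum>I\<in>Pow {1..6}. \<Sum>K\<in>Pow {1..6}.
      if card I = card K then \<alpha> I p * cnj (\<beta> K p)
        * complex_of_real (mdet (Ginv a b c) (sorted_list_of_set I) (sorted_list_of_set K)) else 0)"

definition fund_dom :: "real \<Rightarrow> real^2^2 \<Rightarrow> pt set" where
  "fund_dom a0 P = (SOME F. F \<in> sets lborel \<and> (\<forall>p. \<exists>!\<gamma>. \<gamma> \<in> Gam a0 P \<and> gmul \<gamma> p \<in> F))"

text \<open>L^2 inner product: integral over X = Gamma\G of the pointwise product against the Riemannian
  volume form sqrt(det g) e^{123456}; e^{123456} = dt dx dy1 dy2 dz1 dz2 (Lebesgue measure).\<close>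
definition L2ip :: "real \<Rightarrow> real \<Rightarrow> real \<Rightarrow> real \<Rightarrow> real^2^2 \<Rightarrow> form \<Rightarrow> form \<Rightarrow> complex" where
  "L2ip a b c a0 P \<alpha> \<beta> = set_lebesgue_integral lborel (fund_dom a0 P)
      (\<lambda>p. pip a b c \<alpha> \<beta> p * complex_of_real (sqrt (mdet (Gm a b c) [1,2,3,4,5,6] [1,2,3,4,5,6])))"

definition dbar_mu_adj :: "real \<Rightarrow> real \<Rightarrow> real \<Rightarrow> real \<Rightarrow> real^2^2 \<Rightarrow> form \<Rightarrow> form" where
  "dbar_mu_adj a b c a0 P \<beta> = (THE \<gamma>. \<gamma> \<in> smooth_forms a0 P \<and>
      (\<forall>\<alpha>\<in>smooth_forms a0 P. L2ip a b c a0 P (dbar_mu a b c \<alpha>) \<beta> = L2ip a b c a0 P \<alpha> \<gamma>))"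

definition Lap :: "real \<Rightarrow> real \<Rightarrow> real \<Rightarrow> real \<Rightarrow> real^2^2 \<Rightarrow> form \<Rightarrow> form" where
  "Lap a b c a0 P \<psi> = dbar_mu a b c (dbar_mu_adj a b c a0 P \<psi>) + dbar_mu_adj a b c a0 P (dbar_mu a b c \<psi>)"

definition Harm :: "real \<Rightarrow> real \<Rightarrow> real \<Rightarrow> real \<Rightarrow> real^2^2 \<Rightarrow> nat \<Rightarrow> form set" where
  "Harm a b c a0 P r = {\<psi>\<in>smooth_forms a0 P. proj a b c r 0 \<psi> = \<psi> \<and> Lap a b c a0 P \<psi> = 0}"

definition fscale :: "complex \<Rightarrow> form \<Rightarrow> form" where
  "fscale z \<alpha> = (\<lambda>T p. z * \<alpha> T p)"

definition hdim :: "real \<Rightarrow> real \<Rightarrow> real \<Rightarrow> real \<Rightarrow> real^2^2 \<Rightarrow> nat \<Rightarrow> nat" where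
  "hdim a b c a0 P r = vector_space.dim fscale (Harm a b c a0 P r)"

definition hfin :: "real \<Rightarrow> real \<Rightarrow> real \<Rightarrow> real \<Rightarrow> real^2^2 \<Rightarrow> nat \<Rightarrow> bool" where
  "hfin a b c a0 P r \<longleftrightarrow> (\<exists>B. finite B \<and> B \<subseteq> Harm a b c a0 P r \<and>
      module.span fscale B = Harm a b c a0 P r)"

end

theory Submission
  imports Defs "Jordan_Normal_Form.Determinant"
begin

text \<open>
  In the complex coframe \<open>\<theta>\<^sup>1, \<dots>, \<theta>\<^sup>6\<close> (the \<open>\<phi>\<^sup>k\<close> and their conjugates) the metric is diagonal, so the pointwise
  inner product is \<open>\<Sum> 2\<^bsup>|S|\<^esup> x\<^sub>S y\<^sub>S\<^sup>*\<close> in the coefficients with respect to \<open>\<theta>\<^sub>S\<close>; this is the Cauchy-Binet formula,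
  i.e. functoriality of the exterior algebra. Right translations preserve the measure and commute with
  \<open>\<Gamma>\<close>, so left-invariant derivatives of functions on \<open>X\<close> integrate to zero. Hence every first order
  operator with constant coefficients has a formal adjoint, and a form is harmonic iff it is killed by
  \<open>\<delta>\<close> (standing for \<open>\<partial>\<close>-bar plus \<open>\<mu>\<close>) and by its adjoint.

  In degree (3,0) and for two of the three coefficients in degree (2,0), testing the adjoint equation
  against multiples of (1,1)- and (0,1)-forms involves only the zeroth order operator \<open>\<mu>\<close> and forces
  the coefficients to vanish; the remaining coefficient in degree (2,0) dies by the equation \<open>\<delta>\<psi> = 0\<close>.
  In degree (1,0) the coefficients \<open>f\<^sub>2, f\<^sub>3\<close> satisfy Cauchy-Riemann equations in commuting fields, hence
  are constant along the fibres. The equations for \<open>f\<^sub>1\<close> equate fibrewise derivatives of \<open>f\<^sub>1\<close> with linear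
  combinations of \<open>f\<^sub>2, f\<^sub>3\<close>; integration by parts makes these combinations, hence \<open>f\<^sub>2\<close> and \<open>f\<^sub>3\<close>, zero, and
  then \<open>f\<^sub>1\<close> is constant.
\<close>

section \<open>Exterior algebra in coordinates\<close>

hide_const (open) Determinant.det Matrix.mat Matrix.vec
no_notation Matrix.vec_index (infixl "$" 100)

text \<open>Most of the objects involved (dual frame, coframe coefficients, J, inverse metric,
  adjoint, fundamental domain) are introduced by \<open>THE\<close> or \<open>SOME\<close>, so each
  must be shown to exist, and all but the last to be unique, before anything can be computed. The
  fundamental domain stays an arbitrary choice, possibly unbounded and without interior; hence every
  fact about integrals is first shown to be independent of the domain, by unfolding over the
  lattice. No elliptic theory enters: all forms are smooth by definition, and the adjoint is
  constructed explicitly by integration by parts. Second derivatives are avoided as well: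
  commutation of two frame fields is used only through commuting right translations. The numbers
  that decide the answer are 1/(2a) and c/4, entries of the structure equations in the complex
  coframe. Degrees (1,0) and (2,0) lead to the same 2x2 system, with determinant -(1/(4a^2) +
  c^2/16), which never vanishes; b drops out of it.\<close>

definition dl :: "nat \<Rightarrow> nat \<Rightarrow> complex" where
  "dl i j = (if j = i then 1 else 0)"

text \<open>The sign of moving e^j to its place among the e^k with k in S. The count is strict, so S
  with and without j give the same value.\<close>

definition sg :: "nat \<Rightarrow> nat set \<Rightarrow> complex" where
  "sg j S = (-1) ^ card {k\<in>S. k < j}"

text \<open>\<open>lw u x\<close> is the product of the one-form with coefficients \<open>u\<close> and the form \<open>x\<close>, in the
  sign convention of \<open>wedge\<close>; \<open>wl M is\<close> is the product of the rows of \<open>M\<close> listed in \<open>is\<close>, and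
  \<open>ext M\<close> the algebra homomorphism that sends the basis one-forms to the rows of \<open>M\<close>.\<close>
definition lw :: "(nat \<Rightarrow> complex) \<Rightarrow> (nat set \<Rightarrow> complex) \<Rightarrow> nat set \<Rightarrow> complex" where
  "lw u x S = (if S \<subseteq> {1..6} then \<Sum>j\<in>S. sg j S * u j * x (S - {j}) else 0)"

fun wl :: "(nat \<Rightarrow> nat \<Rightarrow> complex) \<Rightarrow> nat list \<Rightarrow> nat set \<Rightarrow> complex" where
  "wl M [] = (\<lambda>S. if S = {} then 1 else 0)"
| "wl M (i # is) = lw (M i) (wl M is)"

abbreviation sl :: "nat set \<Rightarrow> nat list" where "sl \<equiv> sorted_list_of_set"

definition ext :: "(nat \<Rightarrow> nat \<Rightarrow> complex) \<Rightarrow> (nat set \<Rightarrow> complex) \<Rightarrow> nat set \<Rightarrow> complex" where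
  "ext M x S = (\<Sum>T\<in>Pow {1..6}. x T * wl M (sl T) S)"

lemma lw_add: "lw u (\<lambda>S. x S + y S) S = lw u x S + lw u y S"
  by (simp add: lw_def algebra_simps sum.distrib)

lemma lw_scale: "lw u (\<lambda>S. z * x S) S = z * lw u x S"
  by (auto simp: lw_def sum_distrib_left intro!: sum.cong)

lemma lw_sum: "lw u (\<lambda>S. \<Sum>i\<in>A. f i S) S = (\<Sum>i\<in>A. lw u (f i) S)"
  by (auto simp: lw_def sum_distrib_left intro: sum.swap)

lemma lw_sum_left: "lw (\<lambda>j. \<Sum>i\<in>A. f i j) x S = (\<Sum>i\<in>A. lw (f i) x S)"
  by (auto simp: lw_def sum_distrib_left sum_distrib_right intro: sum.swap)

lemma lw_scale_left: "lw (\<lambda>j. z * u j) x S = z * lw u x S"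
  by (auto simp: lw_def sum_distrib_left intro!: sum.cong)

lemma lw_cong:
  assumes "\<And>j. j \<in> {1..6} \<Longrightarrow> u j = v j" "\<And>S. S \<subseteq> {1..6} \<Longrightarrow> x S = y S"
  shows "lw u x = lw v y"
proof
  fix S show "lw u x S = lw v y S"
  proof (cases "S \<subseteq> {1..6}")
    case True
    then have "u j = v j \<and> x (S - {j}) = y (S - {j})" if "j \<in> S" for j
      using that assms(1)[of j] assms(2)[of "S - {j}"] by blast
    then show ?thesis by (simp add: lw_def cong: sum.cong)
  qed (simp add: lw_def)
qed

lemma sg_remove_less:
  assumes "finite S" "j \<in> S" "j < k"
  shows "sg k (S - {j}) = - sg k S"
proof -
  have "{i\<in>S. i < k} = insert j {i\<in>S - {j}. i < k}" using assms by auto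
  moreover have "card (insert j {i\<in>S - {j}. i < k}) = Suc (card {i\<in>S - {j}. i < k})"
    using assms by (subst card_insert_disjoint) auto
  ultimately show ?thesis by (simp add: sg_def)
qed

lemma sg_remove_ge: "k \<le> j \<Longrightarrow> sg k (S - {j}) = sg k S"
  unfolding sg_def by (rule arg_cong[where f="\<lambda>A. (-1) ^ card A"]) auto

text \<open>Exactly one of the two removed indices lies below the other, so exactly one of the two
  reduced signs differs from the full one.\<close>

lemma sg_swap:
  assumes "finite S" "j \<in> S" "k \<in> S" "j \<noteq> k"
  shows "sg j S * sg k (S - {j}) = - (sg k S * sg j (S - {k}))"
  using assms sg_remove_less[of S j k] sg_remove_ge[of j k S] sg_remove_less[of S k j] sg_remove_ge[of k j S]
  by (cases "j < k") auto

lemma lw_lw: "S \<subseteq> {1..6} \<Longrightarrow> lw u (lw v x) S =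
  (\<Sum>j\<in>S. \<Sum>k\<in>S - {j}. sg j S * sg k (S - {j}) * u j * v k * x (S - {j} - {k}))"
  by (simp add: lw_def subset_insertI2 Diff_subset[THEN subset_trans] sum_distrib_left mult.assoc mult.left_commute)

text \<open>The double sum runs over ordered pairs of distinct indices of S; exchanging the roles of
  the two costs one sign by \<open>sg_swap\<close>.\<close>

lemma lw_anticomm: "lw u (lw v x) S = - lw v (lw u x) S"
proof (cases "S \<subseteq> {1..6}")
  case True
  then have fin: "finite S" using finite_subset by blast
  have "lw u (lw v x) S = (\<Sum>(j,k)\<in>Sigma S (\<lambda>j. S - {j}). sg j S * sg k (S - {j}) * u j * v k * x (S - {j} - {k}))"
    using fin by (simp add: lw_lw[OF True] sum.Sigma)
  also have "\<dots> = (\<Sum>(k,j)\<in>Sigma S (\<lambda>j. S - {j}). sg j S * sg k (S - {j}) * u j * v k * x (S - {j} - {k}))"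
    by (rule sum.reindex_bij_witness[of _ "\<lambda>(a,b). (b,a)" "\<lambda>(a,b). (b,a)"]) auto
  also have "\<dots> = (\<Sum>(k,j)\<in>Sigma S (\<lambda>j. S - {j}). - (sg k S * sg j (S - {k}) * v k * u j * x (S - {k} - {j})))"
  proof (intro sum.cong refl)
    fix p assume "p \<in> Sigma S (\<lambda>j. S - {j})"
    then obtain k j where p: "p = (k, j)" "k \<in> S" "j \<in> S" "j \<noteq> k" by auto
    moreover have "S - {j} - {k} = S - {k} - {j}" by auto
    ultimately have "sg j S * sg k (S - {j}) * u j * v k * x (S - {j} - {k})
        = - (sg k S * sg j (S - {k}) * v k * u j * x (S - {k} - {j}))"
      using sg_swap[OF fin, of j k] by simp
    then show "(case p of (k, j) \<Rightarrow> sg j S * sg k (S - {j}) * u j * v k * x (S - {j} - {k}))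
      = (case p of (k, j) \<Rightarrow> - (sg k S * sg j (S - {k}) * v k * u j * x (S - {k} - {j})))"
      by (simp only: p(1) case_prod_conv)
  qed
  also have "\<dots> = - lw v (lw u x) S"
    using fin by (simp add: lw_lw[OF True] sum.Sigma sum_negf case_prod_unfold)
  finally show ?thesis .
qed (simp add: lw_def)

lemma lw_lw_same: "lw u (lw u x) S = 0"
  using lw_anticomm[of u u x S] by simp

lemma wl_outside: "\<not> S \<subseteq> {1..6} \<Longrightarrow> wl M is S = 0"
  by (cases "is") (auto simp: lw_def)

lemma ext_outside: "\<not> S \<subseteq> {1..6} \<Longrightarrow> ext M x S = 0"
  by (simp add: ext_def wl_outside)

lemma wl_card: "card S \<noteq> length is \<Longrightarrow> wl M is S = 0"
proof (induction "is" arbitrary: S)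
  case (Cons i "is")
  show ?case
  proof (cases "S \<subseteq> {1..6}")
    case True
    then have "finite S" using finite_subset by blast
    then have "card (S - {j}) \<noteq> length is" if "j \<in> S" for j
      using Cons.prems that card_Suc_Diff1[of S j] by auto
    then show ?thesis using Cons.IH by (simp add: lw_def)
  qed (simp add: lw_def)
qed auto

lemma wl_cong:
  assumes "\<And>i j. i \<in> set is \<Longrightarrow> j \<in> {1..6} \<Longrightarrow> M i j = M' i j"
  shows "wl M is = wl M' is"
  using assms by (induction "is") (auto intro!: lw_cong)

text \<open>The new factor is carried past smaller factors by anticommutation until it reaches its
  sorted place or meets its own copy, which gives zero. The accumulated sign is
  \<open>sg\<close>.\<close>

lemma lw_wl_insort:
  assumes "sorted xs" "distinct xs"
  shows "lw (M j) (wl M xs) S = (if j \<in> set xs then 0 else sg j (set xs) * wl M (insort j xs) S)"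
  using assms
proof (induction xs arbitrary: S)
  case Nil
  then show ?case by (simp add: sg_def)
next
  case (Cons x xs)
  consider "j < x" | "j = x" | "x < j" by linarith
  then show ?case
  proof cases
    case 1
    then have "{k \<in> set (x # xs). k < j} = {}" using Cons.prems by auto
    then have "sg j (set (x # xs)) = 1" unfolding sg_def by (simp only: card.empty) simp
    moreover have "j \<notin> set (x # xs)" using 1 Cons.prems by auto
    ultimately show ?thesis using 1 by (simp del: set_simps)
  next
    case 2
    then show ?thesis by (simp add: lw_lw_same)
  next
    case 3
    have "lw (M j) (wl M (x # xs)) S = - lw (M x) (lw (M j) (wl M xs)) S"
      by (simp add: lw_anticomm[of "M j"])
    also have "lw (M j) (wl M xs) = (\<lambda>S. (if j \<in> set xs then 0 else sg j (set xs)) * wl M (insort j xs) S)"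
      using Cons by auto
    also have "- lw (M x) \<dots> S = - (if j \<in> set xs then 0 else sg j (set xs)) * lw (M x) (wl M (insort j xs)) S"
      by (simp only: lw_scale) simp
    finally have *: "lw (M j) (wl M (x # xs)) S = - (if j \<in> set xs then 0 else sg j (set xs)) * lw (M x) (wl M (insort j xs)) S" .
    \<comment> \<open>Passing \<open>x\<close> has cost one sign, and \<open>x\<close> is one more
      element below \<open>j\<close>: the two effects agree.\<close>
    have "set xs = set (x # xs) - {x}" using Cons.prems by auto
    then have "sg j (set xs) = - sg j (set (x # xs))"
      using sg_remove_less[of "set (x # xs)" x j] 3 by (metis List.finite_set list.set_intros(1))
    then show ?thesis using * 3 by auto
  qed
qed

lemma lw_wl_insert:
  assumes "finite T"
  shows "lw (M j) (wl M (sl T)) S = (if j \<in> T then 0 else sg j T * wl M (sl (insert j T)) S)"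
  using lw_wl_insort[of "sl T" M j S] assms by (auto simp: sorted_list_of_set_insert)

section \<open>Substitution homomorphisms and functoriality\<close>

lemma lw_dl: "j \<in> {1..6} \<Longrightarrow> lw (dl j) x S = (if j \<in> S \<and> S \<subseteq> {1..6} then sg j S * x (S - {j}) else 0)"
proof (cases "S \<subseteq> {1..6}")
  case True
  then have "finite S" using finite_subset by blast
  then have "(\<Sum>k\<in>S. sg k S * (if k = j then 1 else 0) * x (S - {k})) = (if j \<in> S then sg j S * x (S - {j}) else 0)"
    by (subst sum.cong[OF refl, where h="\<lambda>k. if k = j then sg j S * x (S - {j}) else 0"]) auto
  then show ?thesis using True by (simp add: lw_def dl_def)
qed (simp add: lw_def)

lemma lw_expand: "lw u x S = (\<Sum>j\<in>{1..6}. u j * lw (dl j) x S)"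
proof -
  have "lw u x = lw (\<lambda>l. \<Sum>j\<in>{1..6}. u j * dl j l) x"
    by (rule lw_cong) (auto simp: dl_def if_distrib sum.delta' cong: if_cong)
  then show ?thesis by (simp only: lw_sum_left lw_scale_left)
qed

text \<open>Multiplicativity of \<open>ext\<close> on generators: sets containing j correspond to
  sets avoiding j, and \<open>lw_wl_insert\<close> restores the missing factor with the same
  sign.\<close>

lemma ext_lw_dl:
  assumes j: "j \<in> {1..6}"
  shows "ext M (lw (dl j) x) S = lw (M j) (ext M x) S"
proof -
  have "ext M (lw (dl j) x) S = (\<Sum>T\<in>{T\<in>Pow {1..6}. j \<in> T}. sg j T * x (T - {j}) * wl M (sl T) S)"
    unfolding ext_def by (rule sum.mono_neutral_cong_right) (use j in \<open>auto simp: lw_dl\<close>)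
  also have "\<dots> = (\<Sum>T\<in>{T\<in>Pow {1..6}. j \<notin> T}. x T * (sg j T * wl M (sl (insert j T)) S))"
    by (rule sum.reindex_bij_witness[of _ "\<lambda>T. insert j T" "\<lambda>T. T - {j}"])
      (use j in \<open>auto simp: insert_absorb sg_remove_ge mult_ac\<close>)
  also have "\<dots> = (\<Sum>T\<in>Pow {1..6}. x T * lw (M j) (wl M (sl T)) S)"
    by (rule sum.mono_neutral_cong_left)
      (auto simp: lw_wl_insert[OF finite_subset[OF _ finite_atLeastAtMost]])
  also have "\<dots> = lw (M j) (ext M x) S"
    by (simp add: ext_def[abs_def] lw_sum lw_scale)
  finally show ?thesis .
qed

definition mm :: "(nat \<Rightarrow> nat \<Rightarrow> complex) \<Rightarrow> (nat \<Rightarrow> nat \<Rightarrow> complex) \<Rightarrow> nat \<Rightarrow> nat \<Rightarrow> complex" where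
  "mm A M i l = (\<Sum>j\<in>{1..6}. A i j * M j l)"

lemma ext_sum: "ext M (\<lambda>S. \<Sum>i\<in>A. f i S) S = (\<Sum>i\<in>A. ext M (f i) S)"
  by (simp add: ext_def sum_distrib_right) (rule sum.swap)

lemma ext_scale: "ext M (\<lambda>S. z * x S) S = z * ext M x S"
  by (simp add: ext_def sum_distrib_left mult_ac)

lemma ext_add: "ext M (\<lambda>S. x S + y S) S = ext M x S + ext M y S"
  by (simp add: ext_def algebra_simps sum.distrib)

lemma ext_lw: "ext M (lw u x) S = lw (\<lambda>l. \<Sum>j\<in>{1..6}. u j * M j l) (ext M x) S"
proof -
  have "lw u x = (\<lambda>S. \<Sum>j\<in>{1..6}. u j * lw (dl j) x S)" using lw_expand by blast
  then have "ext M (lw u x) S = (\<Sum>j\<in>{1..6}. u j * ext M (lw (dl j) x) S)" by (simp only: ext_sum ext_scale)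
  then show ?thesis by (simp add: ext_lw_dl lw_sum_left lw_scale_left)
qed

text \<open>Functoriality of the exterior algebra. Read through \<open>det_eq_wl\<close>, comparison
  of coefficients is the Cauchy-Binet formula for the minors of a product.\<close>

lemma ext_wl: "ext M (wl A is) = wl (mm A M) is"
proof (induction "is")
  case Nil
  have "(\<Sum>T\<in>Pow {1..6}. (if T = {} then 1 else 0) * wl M (sl T) S) = (if S = {} then 1 else 0)" for S
    by (subst sum.cong[OF refl, where h="\<lambda>T. if T = {} then wl M [] S else 0"]) auto
  then show ?case by (auto simp: ext_def)
next
  case (Cons i "is")
  then show ?case by (auto simp: ext_lw mm_def)
qed

lemma ext_ext: "ext M (ext A x) S = ext (mm A M) x S"
proof -
  have "ext A x = (\<lambda>S. \<Sum>T\<in>Pow {1..6}. x T * wl A (sl T) S)" by (auto simp: ext_def)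
  then have "ext M (ext A x) S = (\<Sum>T\<in>Pow {1..6}. x T * ext M (wl A (sl T)) S)" by (simp only: ext_sum ext_scale)
  then show ?thesis by (simp add: ext_wl) (simp add: ext_def)
qed

text \<open>The induction adds a new smallest element, so the new factor already stands first and
  its sign is 1.\<close>

lemma wl_dl: "T \<subseteq> {1..6} \<Longrightarrow> wl dl (sl T) S = (if S = T then 1 else 0)"
proof -
  assume "T \<subseteq> {1..6}"
  then have "finite T" using finite_subset by blast
  then show ?thesis using \<open>T \<subseteq> {1..6}\<close>
  proof (induction T arbitrary: S rule: finite_linorder_min_induct)
    case empty
    then show ?case by simp
  next
    case (insert b A)
    have "{k\<in>A. k < b} = {}" using insert by auto
    then have sg: "sg b A = 1" "b \<notin> A" using insert by (auto simp: sg_def simp del: Collect_empty_eq)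
    then have "wl dl (sl (insert b A)) S = lw (dl b) (wl dl (sl A)) S"
      using lw_wl_insert[OF insert(1), of dl b S] by simp
    also have "wl dl (sl A) = (\<lambda>S. if S = A then 1 else 0)" using insert by auto
    also have "lw (dl b) \<dots> S = (if S = insert b A then 1 else 0)"
    proof -
      have "sg b (insert b A) = 1" using sg sg_remove_ge[of b b "insert b A"] by simp
      then show ?thesis using insert sg by (subst lw_dl) auto
    qed
    finally show ?case .
  qed
qed

lemma ext_id:
  assumes "\<And>i j. i \<in> {1..6} \<Longrightarrow> j \<in> {1..6} \<Longrightarrow> M i j = dl i j" "\<And>S. \<not> S \<subseteq> {1..6} \<Longrightarrow> x S = 0"
  shows "ext M x = x"
proof
  fix S
  have "wl M (sl T) = wl dl (sl T)" if "T \<subseteq> {1..6}" for T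
    using that finite_subset[OF that] by (intro wl_cong assms(1)) auto
  then have "ext M x S = (\<Sum>T\<in>Pow {1..6}. if T = S then x S else 0)"
    unfolding ext_def by (intro sum.cong) (auto simp: wl_dl)
  also have "\<dots> = x S" using assms(2) by auto
  finally show "ext M x S = x S" .
qed


section \<open>Minors as coefficients of products of one-forms\<close>

lemma sorted_list_remove_nth:
  assumes "finite S" "j < card S"
  shows "sl (S - {sl S ! j}) = take j (sl S) @ drop (Suc j) (sl S)"
proof (rule sorted_distinct_set_unique)
  let ?s = "sl S"
  have j: "j < length ?s" using assms by simp
  have s: "?s = take j ?s @ ?s ! j # drop (Suc j) ?s" using j by (rule id_take_nth_drop)
  have st: "sorted (take j ?s @ ?s ! j # drop (Suc j) ?s)" "distinct (take j ?s @ ?s ! j # drop (Suc j) ?s)"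
    using s assms by (metis sorted_sorted_list_of_set, metis distinct_sorted_list_of_set)
  show "sorted (take j ?s @ drop (Suc j) ?s)" "distinct (take j ?s @ drop (Suc j) ?s)"
    using st by (auto simp: sorted_append)
  have "S = set (take j ?s @ ?s ! j # drop (Suc j) ?s)" using s assms by (metis set_sorted_list_of_set)
  then show "set (sl (S - {?s ! j})) = set (take j ?s @ drop (Suc j) ?s)" using st(2) assms by auto
qed auto

lemma sg_nth:
  assumes "finite S" "j < card S"
  shows "sg (sl S ! j) S = (-1) ^ j"
proof -
  let ?s = "sl S"
  have sd: "sorted_wrt (<) ?s" using assms by (simp add: strict_sorted_iff)
  have less: "?s ! i < ?s ! j \<longleftrightarrow> i < j" if "i < card S" for i
    using sorted_wrt_nth_less[OF sd] that assms
    by (metis length_sorted_list_of_set less_asym linorder_neqE_nat less_irrefl)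
  have "{k\<in>S. k < ?s ! j} = (!) ?s ` {..<j}"
  proof (intro equalityI subsetI)
    fix k assume k: "k \<in> {k\<in>S. k < ?s ! j}"
    then have "k \<in> set ?s" using assms(1) by simp
    then obtain i where "i < card S" "k = ?s ! i" by (auto simp: in_set_conv_nth)
    then show "k \<in> (!) ?s ` {..<j}" using k less by auto
  next
    fix k assume "k \<in> (!) ?s ` {..<j}"
    then obtain i where i: "i < j" "k = ?s ! i" by auto
    then have "i < card S" using assms by simp
    moreover have "?s ! i \<in> S" using nth_mem[of i ?s] calculation assms(1) by simp
    ultimately show "k \<in> {k\<in>S. k < ?s ! j}" using i less by auto
  qed
  moreover have "inj_on ((!) ?s) {..<j}"
    using assms by (intro inj_on_nth) auto
  ultimately show ?thesis by (simp add: sg_def card_image)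
qed

text \<open>Laplace expansion along the first row obeys the recursion of \<open>lw\<close>: by
  \<open>sg_nth\<close> the cofactor sign at position j is the sign of the j-th element of
  S.\<close>

lemma det_eq_wl:
  assumes "S \<subseteq> {1..6}" "card S = length r"
  shows "Determinant.det (Matrix.mat (length r) (length r) (\<lambda>(i,j). M (r ! i) (sl S ! j))) = wl M r S"
  using assms
proof (induction r arbitrary: S)
  case Nil
  then have "S = {}" using finite_subset by fastforce
  then show ?case by (simp add: Determinant.det_dim_zero)
next
  case (Cons i r)
  have fin: "finite S" using Cons.prems finite_subset by blast
  let ?n = "length r" and ?s = "sl S"
  let ?A = "Matrix.mat (Suc ?n) (Suc ?n) (\<lambda>(k,j). M ((i # r) ! k) (?s ! j))"
  have cS: "card S = Suc ?n" using Cons.prems by simp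
  have cof: "cofactor ?A 0 j = (-1) ^ j * wl M r (S - {?s ! j})" if j: "j < Suc ?n" for j
  proof -
    have "?s ! j \<in> S" using nth_mem[of j ?s] j fin cS by simp
    then have c: "card (S - {?s ! j}) = length r" using cS fin by simp
    have len: "length ?s = Suc ?n" using cS fin by simp
    have "mat_delete ?A 0 j = Matrix.mat ?n ?n (\<lambda>(k,l). M (r ! k) (sl (S - {?s ! j}) ! l))"
    proof (rule eq_matI)
      fix k l assume "k < dim_row (Matrix.mat ?n ?n (\<lambda>(k,l). M (r ! k) (sl (S - {?s ! j}) ! l)))"
        "l < dim_col (Matrix.mat ?n ?n (\<lambda>(k,l). M (r ! k) (sl (S - {?s ! j}) ! l)))"
      then have kl: "k < ?n" "l < ?n" by auto
      have "(take j ?s @ drop (Suc j) ?s) ! l = ?s ! (if l < j then l else Suc l)"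
        using kl j len by (auto simp: nth_append min_def)
      then show "mat_delete ?A 0 j $$ (k, l) = Matrix.mat ?n ?n (\<lambda>(k,l). M (r ! k) (sl (S - {?s ! j}) ! l)) $$ (k, l)"
        using kl j cS by (simp add: mat_delete_def sorted_list_remove_nth[OF fin])
    qed (auto simp: mat_delete_def)
    moreover have "S - {?s ! j} \<subseteq> {1..6}" using Cons.prems by auto
    ultimately show ?thesis using Cons.IH[of "S - {?s ! j}"] c by (simp add: cofactor_def)
  qed
  have "Determinant.det ?A = (\<Sum>j<Suc ?n. ?A $$ (0, j) * cofactor ?A 0 j)"
    by (rule laplace_expansion_row) auto
  also have "\<dots> = (\<Sum>j<Suc ?n. sg (?s ! j) S * M i (?s ! j) * wl M r (S - {?s ! j}))"
    using cof cS by (intro sum.cong) (auto simp: sg_nth[OF fin])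
  also have "\<dots> = (\<Sum>k\<in>S. sg k S * M i k * wl M r (S - {k}))"
  proof (rule sum.reindex_bij_betw)
    show "bij_betw ((!) ?s) {..<Suc ?n} S"
      using fin cS by (intro bij_betw_nth) auto
  qed
  finally show ?case using Cons.prems by (simp add: lw_def)
qed

text \<open>Connects the minors in the pointwise inner product and in the volume factor with the
  exterior algebra.\<close>

lemma mdet_eq_wl:
  assumes "S \<subseteq> {1..6}" "card S = length r"
  shows "complex_of_real (mdet M r (sl S)) = wl (\<lambda>i j. complex_of_real (M i j)) r S"
proof -
  have "Determinant.det (Matrix.mat (length r) (length r) (\<lambda>(i,j). complex_of_real (M (r ! i) (sl S ! j))))
     = complex_of_real (mdet M r (sl S))"
    unfolding Determinant.det_def mdet_def
    by (auto simp: atLeast0LessThan sign_def dest: permutes_in_image intro!: sum.cong prod.cong)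
  then show ?thesis using det_eq_wl[OF assms, of "\<lambda>i j. complex_of_real (M i j)"] by simp
qed

lemma wl_transpose:
  assumes "I \<subseteq> {1..6}" "J \<subseteq> {1..6}"
  shows "wl (\<lambda>i j. M j i) (sl I) J = wl M (sl J) I"
proof (cases "card I = card J")
  case True
  let ?n = "card J"
  have "Matrix.transpose_mat (Matrix.mat ?n ?n (\<lambda>(i,j). M (sl J ! i) (sl I ! j)))
     = Matrix.mat ?n ?n (\<lambda>(i,j). M (sl J ! j) (sl I ! i))" by (rule eq_matI) auto
  moreover have "Determinant.det (Matrix.transpose_mat (Matrix.mat ?n ?n (\<lambda>(i,j). M (sl J ! i) (sl I ! j))))
    = Determinant.det (Matrix.mat ?n ?n (\<lambda>(i,j). M (sl J ! i) (sl I ! j)))"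
    by (rule Determinant.det_transpose[of _ ?n]) auto
  ultimately show ?thesis
    using det_eq_wl[of J "sl I" "\<lambda>i j. M j i"] det_eq_wl[of I "sl J" M] assms True
      finite_subset[OF assms(1)] finite_subset[OF assms(2)] by simp
next
  case False
  then show ?thesis using assms finite_subset[OF assms(1)] finite_subset[OF assms(2)]
    by (simp add: wl_card)
qed

lemma cnj_wl: "cnj (wl M is S) = wl (\<lambda>i j. cnj (M i j)) is S"
  by (induction "is" arbitrary: S) (auto simp: lw_def sg_def)

text \<open>The later source of the weight \<open>2 ^ card S\<close>, since the inverse metric is
  twice the product of \<open>Nc\<close> with its conjugate transpose.\<close>

lemma wl_scale: "wl (\<lambda>i j. z * M i j) is S = z ^ length is * wl M is S"
proof (induction "is" arbitrary: S)
  case (Cons i "is")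
  have "wl (\<lambda>i j. z * M i j) is = (\<lambda>S. z ^ length is * wl M is S)" using Cons by auto
  then show ?case by (simp add: lw_scale lw_scale_left)
qed auto

section \<open>The complex coframe and the metric\<close>

lemma sum6: "(\<Sum>j\<in>{1..6::nat}. f j) = f 1 + f 2 + f 3 + f 4 + f 5 + (f 6 :: 'a :: comm_monoid_add)"
proof -
  have "{1..6::nat} = {1,2,3,4,5,6}" by auto
  then show ?thesis by (simp add: add_ac)
qed

lemma in6: "(i \<in> {1..6::nat}) \<longleftrightarrow> i = 1 \<or> i = 2 \<or> i = 3 \<or> i = 4 \<or> i = 5 \<or> i = 6"
proof -
  have "{1..6::nat} = {1,2,3,4,5,6}" by auto
  then show ?thesis by simp
qed

section \<open>Wedge products and d in terms of products with one-forms\<close>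

lemma wsign_single: "wsign {j} (S - {j}) = sg j S"
proof -
  have "{(i,k). i \<in> {j} \<and> k \<in> S - {j} \<and> k < i} = (\<lambda>k. (j,k)) ` {k\<in>S. k < j}" by auto
  moreover have "card ((\<lambda>k. (j,k)) ` {k\<in>S. k < j}) = card {k\<in>S. k < j}"
    by (intro card_image inj_onI) auto
  ultimately show ?thesis unfolding wsign_def sg_def by simp
qed

lemma wedge_one_form:
  assumes "\<And>I. (\<nexists>j. I = {j}) \<Longrightarrow> \<alpha> I p = 0"
  shows "wedge \<alpha> \<beta> S p = lw (\<lambda>j. \<alpha> {j} p) (\<lambda>T. \<beta> T p) S"
proof (cases "S \<subseteq> {1..6}")
  case True
  then have "finite S" using finite_subset by blast
  then have "(\<Sum>I\<in>Pow S. wsign I (S - I) * \<alpha> I p * \<beta> (S - I) p)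
      = (\<Sum>I\<in>(\<lambda>j. {j}) ` S. wsign I (S - I) * \<alpha> I p * \<beta> (S - I) p)"
    by (intro sum.mono_neutral_right) (use assms in auto)
  also have "\<dots> = (\<Sum>j\<in>S. sg j S * \<alpha> {j} p * \<beta> (S - {j}) p)"
    by (subst sum.reindex) (auto simp: wsign_single)
  finally show ?thesis using True by (simp add: wedge_def lw_def)
qed (simp add: wedge_def lw_def)

lemma wedge_eb: "wedge (eb i) \<beta> S p = lw (dl i) (\<lambda>T. \<beta> T p) S"
proof -
  have "(\<lambda>j. eb i {j} p) = dl i" by (auto simp: eb_def dl_def)
  then show ?thesis by (subst wedge_one_form) (auto simp: eb_def)
qed

lemma ebl_eq: "ebl is S p = wl dl is S"
  by (induction "is" arbitrary: S) (auto simp: wedge_eb intro!: arg_cong2[where f="lw (dl _)"])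

lemma thetal_eq: "thetal a b c ks S p = wl (thc a b c) ks S"
proof (induction ks arbitrary: S)
  case (Cons k ks)
  have "wedge (theta a b c k) (thetal a b c ks) S p = lw (\<lambda>j. theta a b c k {j} p) (\<lambda>T. thetal a b c ks T p) S"
    by (rule wedge_one_form) (auto simp: theta_def)
  also have "\<dots> = lw (thc a b c k) (wl (thc a b c) ks) S"
    by (rule arg_cong[where f="\<lambda>f. f S"], rule lw_cong) (auto simp: theta_def Cons)
  finally show ?case by simp
qed auto

text \<open>Takes the place of associativity of \<open>wedge\<close> in the only case that occurs:
  the structure equations contain products of two basis forms in increasing order.\<close>

lemma wedge_two_form:
  assumes "j < k" "j \<in> {1..6}" "k \<in> {1..6}"
  shows "wedge (wedge (eb j) (eb k)) \<beta> S p = lw (dl j) (lw (dl k) (\<lambda>T. \<beta> T p)) S"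
proof (cases "S \<subseteq> {1..6}")
  case True
  then have fin: "finite S" using finite_subset by blast
  have s1: "sg j {j,k} = 1"
  proof -
    have "{i\<in>{j,k}. i < j} = {}" using assms by auto
    then show ?thesis unfolding sg_def by (simp only: card.empty) simp
  qed
  have w: "wedge (eb j) (eb k) I p = (if I = {j,k} then 1 else 0)" for I
  proof -
    have "wedge (eb j) (eb k) I p = (if j \<in> I \<and> I \<subseteq> {1..6} \<and> I - {j} = {k} then sg j I else 0)"
      unfolding wedge_eb lw_dl[OF assms(2)] by (simp add: eb_def)
    moreover have "j \<in> I \<and> I \<subseteq> {1..6} \<and> I - {j} = {k} \<longleftrightarrow> I = {j,k}" using assms by auto
    ultimately show ?thesis using s1 by auto
  qed
  have "(\<Sum>I\<in>Pow S. wsign I (S - I) * wedge (eb j) (eb k) I p * \<beta> (S - I) p)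
      = (\<Sum>I\<in>Pow S. if I = {j,k} then wsign {j,k} (S - {j,k}) * \<beta> (S - {j,k}) p else 0)"
    by (intro sum.cong) (auto simp: w)
  also have "\<dots> = (if {j,k} \<subseteq> S then wsign {j,k} (S - {j,k}) * \<beta> (S - {j,k}) p else 0)"
    using fin by simp
  also have "\<dots> = lw (dl j) (lw (dl k) (\<lambda>T. \<beta> T p)) S"
  proof (cases "{j,k} \<subseteq> S")
    case jk: True
    let ?R = "S - {j,k}"
    \<comment> \<open>Sorting the inversions by their first component splits the sign into a factor
      for \<open>j\<close> and a factor for \<open>k\<close>.\<close>
    have "{(i,l). i \<in> {j,k} \<and> l \<in> ?R \<and> l < i} = (\<lambda>l. (j,l)) ` {l\<in>?R. l < j} \<union> (\<lambda>l. (k,l)) ` {l\<in>?R. l < k}"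
      by auto
    moreover have "card ((\<lambda>l. (j,l)) ` {l\<in>?R. l < j} \<union> (\<lambda>l. (k,l)) ` {l\<in>?R. l < k})
        = card {l\<in>?R. l < j} + card {l\<in>?R. l < k}"
      using fin assms by (subst card_Un_disjoint) (auto simp: card_image inj_on_def)
    ultimately have "wsign {j,k} ?R = sg j ?R * sg k ?R"
      unfolding wsign_def sg_def by (simp only: power_add)
    moreover have "?R = S - {j} - {k}" by auto
    moreover have "sg j (S - {j} - {k}) = sg j S" "sg k (S - {j} - {k}) = sg k (S - {j})"
      using assms by (simp_all add: sg_remove_ge)
    ultimately show ?thesis using jk True assms by (auto simp: lw_dl)
  next
    case False
    then show ?thesis using assms by (auto simp: lw_dl)
  qed
  finally show ?thesis using True by (simp add: wedge_def)
qed (simp add: wedge_def lw_def)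

text \<open>\<open>dq M i x\<close> is the product of \<open>d e\<^sup>i\<close> with \<open>x\<close>, after substituting the rows of \<open>M\<close> for the \<open>e\<^sup>j\<close>.\<close>
definition dq :: "(nat \<Rightarrow> nat \<Rightarrow> complex) \<Rightarrow> nat \<Rightarrow> (nat set \<Rightarrow> complex) \<Rightarrow> nat set \<Rightarrow> complex" where
  "dq M i x S = (if i = 3 then - lw (M 1) (lw (M 3) x) S - lw (M 2) (lw (M 5) x) S
      else if i = 4 then lw (M 1) (lw (M 4) x) S - lw (M 2) (lw (M 6) x) S
      else if i = 5 then - lw (M 1) (lw (M 5) x) S
      else if i = 6 then lw (M 1) (lw (M 6) x) S
      else 0)"

lemma wedge_linear_left:
  "wedge (\<lambda>S p. - \<alpha> S p) \<beta> S p = - wedge \<alpha> \<beta> S p"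
  "wedge (\<lambda>S p. \<alpha> S p - \<alpha>' S p) \<beta> S p = wedge \<alpha> \<beta> S p - wedge \<alpha>' \<beta> S p"
  "wedge (\<lambda>S p. 0) \<beta> S p = 0"
  by (simp_all add: wedge_def sum_negf sum_subtractf algebra_simps)

lemma wedge_deb: "wedge (deb i) \<beta> S p = dq dl i (\<lambda>T. \<beta> T p) S"
  unfolding deb_def dq_def by (auto simp: wedge_linear_left wedge_two_form)

fun dcl :: "nat list \<Rightarrow> nat set \<Rightarrow> complex" where
  "dcl [] = (\<lambda>S. 0)"
| "dcl (i # is) = (\<lambda>S. dq dl i (wl dl is) S - lw (dl i) (dcl is) S)"

lemma debl_eq: "debl is S p = dcl is S"
proof (induction "is" arbitrary: S)
  case (Cons i "is")
  then show ?case by (simp add: wedge_deb wedge_eb ebl_eq)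
qed auto

text \<open>The zeroth order part of d: its value on left-invariant forms, which are those with
  constant coefficients.\<close>

definition dc :: "(nat set \<Rightarrow> complex) \<Rightarrow> nat set \<Rightarrow> complex" where
  "dc x S = (\<Sum>T\<in>Pow {1..6}. x T * dcl (sl T) S)"

lemma wl_dl_expand: "lw u x S = (\<Sum>T\<in>Pow {1..6}. x T * lw u (wl dl (sl T)) S)"
proof -
  have "lw u x = lw u (\<lambda>S. \<Sum>T\<in>Pow {1..6}. x T * wl dl (sl T) S)"
  proof (rule lw_cong[OF refl])
    fix S :: "nat set" assume "S \<subseteq> {1..6}"
    then show "x S = (\<Sum>T\<in>Pow {1..6}. x T * wl dl (sl T) S)"
    proof -
      have "(\<Sum>T\<in>Pow {1..6}. x T * wl dl (sl T) S) = (\<Sum>T\<in>Pow {1..6}. if T = S then x S else 0)"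
        by (intro sum.cong) (auto simp: wl_dl)
      then show ?thesis using \<open>S \<subseteq> {1..6}\<close> by simp
    qed
  qed
  then show ?thesis by (simp only: lw_sum lw_scale)
qed

lemma dext_eq:
  "dext \<alpha> S p = (\<Sum>i\<in>{1..6}. lw (dl i) (\<lambda>T. Eder i (\<alpha> T) p) S) + dc (\<lambda>T. \<alpha> T p) S"
proof -
  have w: "wedge (\<lambda>R q. if R = {i} then Eder i (\<alpha> T) q else 0) (ebl (sl T)) S p
      = Eder i (\<alpha> T) p * lw (dl i) (wl dl (sl T)) S" for i T
  proof -
    have "wedge (\<lambda>R q. if R = {i} then Eder i (\<alpha> T) q else 0) (ebl (sl T)) S p
      = lw (\<lambda>j. if {j} = {i} then Eder i (\<alpha> T) p else 0) (\<lambda>R. ebl (sl T) R p) S"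
      by (rule wedge_one_form) auto
    also have "(\<lambda>j. if {j} = {i} then Eder i (\<alpha> T) p else 0) = (\<lambda>j. Eder i (\<alpha> T) p * dl i j)"
      by (auto simp: dl_def)
    also have "lw \<dots> (\<lambda>R. ebl (sl T) R p) S = Eder i (\<alpha> T) p * lw (dl i) (wl dl (sl T)) S"
      by (simp only: lw_scale_left ebl_eq)
    finally show ?thesis .
  qed
  show ?thesis unfolding dext_def dc_def
    by (simp only: sum.distrib w debl_eq wl_dl_expand[of _ "\<lambda>T. Eder _ (\<alpha> T) p"]) (simp, rule sum.swap)
qed

lemma dext_outside: "\<not> S \<subseteq> {1..6} \<Longrightarrow> dext \<alpha> S p = 0"
proof -
  assume S: "\<not> S \<subseteq> {1..6}"
  have "dcl is S = 0" for "is" by (cases "is") (use S in \<open>auto simp: dq_def lw_def\<close>)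
  then show ?thesis using S by (simp add: dext_eq dc_def lw_def)
qed

section \<open>Coefficients in the complex coframe and bidegrees\<close>

text \<open>The inverse of the matrix \<open>thc\<close>: \<open>e\<^sup>j = \<Sum>\<^sub>k Nc j k \<theta>\<^sup>k\<close>.\<close>
definition Nc :: "real \<Rightarrow> real \<Rightarrow> real \<Rightarrow> nat \<Rightarrow> nat \<Rightarrow> complex" where
  "Nc a b c j k =
    (if j = 1 then (if k = 1 \<or> k = 4 then 1 / (2 * complex_of_real a) else 0)
     else if j = 2 then (if k = 1 then - \<i> / 2 else if k = 4 then \<i> / 2 else 0)
     else if j = 3 then (if k = 2 \<or> k = 5 then 1 / (2 * complex_of_real c)
        else if k = 3 then \<i> * complex_of_real b / (2 * complex_of_real c)
        else if k = 6 then - \<i> * complex_of_real b / (2 * complex_of_real c) else 0)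
     else if j = 4 then (if k = 3 \<or> k = 6 then 1 / (2 * complex_of_real c) else 0)
     else if j = 5 then (if k = 3 then - \<i> / 2 else if k = 6 then \<i> / 2 else 0)
     else if j = 6 then (if k = 2 then - \<i> / 2 else if k = 5 then \<i> / 2 else 0)
     else 0)"

lemma mm_thc_Nc:
  assumes "a \<noteq> 0" "c \<noteq> 0" "i \<in> {1..6}" "j \<in> {1..6}"
  shows "mm (thc a b c) (Nc a b c) i j = dl i j"
  using assms(3,4) unfolding in6 mm_def sum6
  by (elim disjE) (use assms(1,2) in \<open>simp_all add: thc_def phc_def Nc_def dl_def field_simps\<close>)

lemma mm_Nc_thc:
  assumes "a \<noteq> 0" "c \<noteq> 0" "i \<in> {1..6}" "j \<in> {1..6}"
  shows "mm (Nc a b c) (thc a b c) i j = dl i j"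
  using assms(3,4) unfolding in6 mm_def sum6
  by (elim disjE) (use assms(1,2) in \<open>simp_all add: thc_def phc_def Nc_def dl_def field_simps\<close>)

text \<open>Forms are indexed by all sets of naturals, while the exterior algebra lives on subsets
  of {1..6}; the two substitutions are inverse to each other only on families supported
  there.\<close>

definition supp6 :: "(nat set \<Rightarrow> complex) \<Rightarrow> bool" where
  "supp6 x \<longleftrightarrow> (\<forall>S. \<not> S \<subseteq> {1..6} \<longrightarrow> x S = 0)"

lemma ext_thc_Nc: "a \<noteq> 0 \<Longrightarrow> c \<noteq> 0 \<Longrightarrow> supp6 x \<Longrightarrow> ext (thc a b c) (ext (Nc a b c) x) = x"
proof -
  assume *: "a \<noteq> 0" "c \<noteq> 0" "supp6 x"
  then have "ext (mm (Nc a b c) (thc a b c)) x = x" by (intro ext_id) (auto simp: mm_Nc_thc supp6_def)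
  then show ?thesis by (simp add: ext_ext fun_eq_iff)
qed

lemma ext_Nc_thc: "a \<noteq> 0 \<Longrightarrow> c \<noteq> 0 \<Longrightarrow> supp6 x \<Longrightarrow> ext (Nc a b c) (ext (thc a b c) x) = x"
proof -
  assume *: "a \<noteq> 0" "c \<noteq> 0" "supp6 x"
  then have "ext (mm (thc a b c) (Nc a b c)) x = x" by (intro ext_id) (auto simp: mm_thc_Nc supp6_def)
  then show ?thesis by (simp add: ext_ext fun_eq_iff)
qed

lemma thcoef_eq:
  assumes "a \<noteq> 0" "c \<noteq> 0" "supp6 (\<lambda>T. \<alpha> T p)"
  shows "thcoef a b c \<alpha> p = ext (Nc a b c) (\<lambda>T. \<alpha> T p)"
  unfolding thcoef_def
proof (rule the_equality)
  have "ext (thc a b c) (ext (Nc a b c) (\<lambda>T. \<alpha> T p)) = (\<lambda>T. \<alpha> T p)" using ext_thc_Nc assms by blast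
  then have "(\<Sum>S\<in>Pow {1..6}. ext (Nc a b c) (\<lambda>T. \<alpha> T p) S * wl (thc a b c) (sl S) T) = \<alpha> T p" for T
    unfolding ext_def[of "thc a b c"] by metis
  then show "(\<forall>S. \<not> S \<subseteq> {1..6} \<longrightarrow> ext (Nc a b c) (\<lambda>T. \<alpha> T p) S = 0) \<and>
    (\<forall>T. \<alpha> T p = (\<Sum>S\<in>Pow {1..6}. ext (Nc a b c) (\<lambda>T. \<alpha> T p) S * thetal a b c (sl S) T p))"
    by (simp add: ext_outside thetal_eq)
next
  fix co assume co: "(\<forall>S. \<not> S \<subseteq> {1..6} \<longrightarrow> co S = 0) \<and>
    (\<forall>T. \<alpha> T p = (\<Sum>S\<in>Pow {1..6}. co S * thetal a b c (sl S) T p))"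
  \<comment> \<open>Any other coefficient family is recovered by substituting back with
    \<open>Nc\<close>, whence uniqueness.\<close>
  then have "(\<lambda>T. \<alpha> T p) = ext (thc a b c) co" unfolding ext_def thetal_eq by blast
  then show "co = ext (Nc a b c) (\<lambda>T. \<alpha> T p)" using ext_Nc_thc[of a c co] assms co by (simp add: supp6_def)
qed

text \<open>The bidegree of theta_S: indices 1, 2, 3 belong to the phi^k, indices 4, 5, 6 to their
  conjugates.\<close>

definition ty :: "nat \<Rightarrow> nat \<Rightarrow> nat set \<Rightarrow> bool" where
  "ty r s S \<longleftrightarrow> S \<subseteq> {1..6} \<and> card (S \<inter> {1,2,3}) = r \<and> card (S \<inter> {4,5,6}) = s"

lemma proj_eq:
  "proj a b c r s \<alpha> T p = ext (thc a b c) (\<lambda>S. if ty r s S then thcoef a b c \<alpha> p S else 0) T"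
  unfolding proj_def ext_def thetal_eq
proof (rule sum.mono_neutral_cong_left)
  show "\<forall>S\<in>Pow {1..6} - {S \<in> Pow {1..6}. card (S \<inter> {1, 2, 3}) = r \<and> card (S \<inter> {4, 5, 6}) = s}.
       (if ty r s S then thcoef a b c \<alpha> p S else 0) * wl (thc a b c) (sl S) T = 0"
    by (auto simp: ty_def)
qed (auto simp: ty_def)

lemma thcoef_proj:
  assumes "a \<noteq> 0" "c \<noteq> 0"
  shows "thcoef a b c (proj a b c r s \<alpha>) p S = (if ty r s S then thcoef a b c \<alpha> p S else 0)"
  using assms
  by (subst thcoef_eq) (auto simp: proj_eq[abs_def] supp6_def ext_outside ty_def ext_Nc_thc)

section \<open>Almost complex structure, metric and induced inner product on forms\<close>

definition Hx :: "real \<Rightarrow> real \<Rightarrow> real \<Rightarrow> nat \<Rightarrow> nat \<Rightarrow> real" where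
  "Hx a b c i j =
    (if i = 1 \<and> j = 1 then 1 / a\<^sup>2 else if i = 2 \<and> j = 2 then 1
     else if i = 3 \<and> j = 3 then (1 + b\<^sup>2) / c\<^sup>2 else if i = 3 \<and> j = 5 \<or> i = 5 \<and> j = 3 then - b / c
     else if i = 4 \<and> j = 4 then 1 / c\<^sup>2 else if i = 5 \<and> j = 5 then 1 else if i = 6 \<and> j = 6 then 1 else 0)"

text \<open>Solution of phi^k(Jv) = i phi^k(v) by real and imaginary parts. Row 5 is the imaginary
  part for phi^3; it has to be subtracted, with factor b, from the real part for phi^2 to isolate
  row 3.\<close>

definition Jx :: "real \<Rightarrow> real \<Rightarrow> real \<Rightarrow> nat \<Rightarrow> nat \<Rightarrow> real" where
  "Jx a b c i l = (if l \<notin> {1..6} then 0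
     else if i = 1 then Re (\<i> * phc a b c 1 l) / a
     else if i = 2 then Im (\<i> * phc a b c 1 l)
     else if i = 3 then (Re (\<i> * phc a b c 2 l) - b * Im (\<i> * phc a b c 3 l)) / c
     else if i = 4 then Re (\<i> * phc a b c 3 l) / c
     else if i = 5 then Im (\<i> * phc a b c 3 l)
     else if i = 6 then Im (\<i> * phc a b c 2 l) else 0)"

text \<open>Testing the defining condition on unit vectors gives three complex equations for each
  column; their real and imaginary parts are six real equations for the six entries.\<close>

lemma Jm_eq:
  assumes "a \<noteq> 0" "c \<noteq> 0"
  shows "Jm a b c = Jx a b c"
  unfolding Jm_def
proof (rule the_equality)
  have J: "(\<Sum>j\<in>{1..6}. phc a b c k j * complex_of_real (Jx a b c j l)) = \<i> * phc a b c k l"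
    if "k \<in> {1,2,3}" "l \<in> {1..6}" for k l
    using that assms unfolding sum6
    by (auto simp: phc_def Jx_def complex_eq_iff simp del: One_nat_def)
  have "(\<Sum>j\<in>{1..6}. phc a b c k j * complex_of_real (\<Sum>l\<in>{1..6}. Jx a b c j l * v l))
       = \<i> * (\<Sum>j\<in>{1..6}. phc a b c k j * complex_of_real (v j))" if k: "k \<in> {1,2,3}" for k v
  proof -
    have "(\<Sum>j\<in>{1..6}. phc a b c k j * complex_of_real (\<Sum>l\<in>{1..6}. Jx a b c j l * v l))
      = (\<Sum>j\<in>{1..6}. \<Sum>l\<in>{1..6}. phc a b c k j * complex_of_real (Jx a b c j l) * complex_of_real (v l))"
      by (simp add: sum_distrib_left mult_ac)
    also have "\<dots> = (\<Sum>l\<in>{1..6}. (\<Sum>j\<in>{1..6}. phc a b c k j * complex_of_real (Jx a b c j l)) * complex_of_real (v l))"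
      by (subst sum.swap) (simp add: sum_distrib_right)
    also have "\<dots> = (\<Sum>l\<in>{1..6}. \<i> * phc a b c k l * complex_of_real (v l))"
      by (intro sum.cong refl) (simp only: J[OF k])
    finally show ?thesis by (simp add: sum_distrib_left mult_ac)
  qed
  moreover have "Jx a b c i j = 0" if "i \<notin> {1..6} \<or> j \<notin> {1..6}" for i j
    using that by (auto simp: Jx_def)
  ultimately show "(\<forall>i j. i \<notin> {1..6} \<or> j \<notin> {1..6} \<longrightarrow> Jx a b c i j = 0) \<and>
    (\<forall>k\<in>{1, 2, 3}. \<forall>v. (\<Sum>j\<in>{1..6}. phc a b c k j * complex_of_real (\<Sum>l\<in>{1..6}. Jx a b c j l * v l))
       = \<i> * (\<Sum>j\<in>{1..6}. phc a b c k j * complex_of_real (v j)))" by blast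
next
  fix M assume M: "(\<forall>i j. i \<notin> {1..6} \<or> j \<notin> {1..6} \<longrightarrow> M i j = 0) \<and>
    (\<forall>k\<in>{1, 2, 3}. \<forall>v. (\<Sum>j\<in>{1..6}. phc a b c k j * complex_of_real (\<Sum>l\<in>{1..6}. M j l * v l))
       = \<i> * (\<Sum>j\<in>{1..6}. phc a b c k j * complex_of_real (v j)))"
  have K: "(\<Sum>j\<in>{1..6}. phc a b c k j * complex_of_real (M j m)) = \<i> * phc a b c k m"
    if k: "k \<in> {1,2,3}" and m: "m \<in> {1..6}" for k m
  proof -
    have 1: "(\<Sum>l\<in>{1..6}. M j l * (if l = m then 1 else 0)) = M j m" for j
      using m by (simp add: if_distrib cong: if_cong)
    have 2: "(\<Sum>j\<in>{1..6}. phc a b c k j * complex_of_real (if j = m then 1 else 0)) = phc a b c k m"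
      using m by (simp add: if_distrib cong: if_cong)
    have "(\<Sum>j\<in>{1..6}. phc a b c k j * complex_of_real (\<Sum>l\<in>{1..6}. M j l * (if l = m then 1 else 0)))
       = \<i> * (\<Sum>j\<in>{1..6}. phc a b c k j * complex_of_real (if j = m then 1 else 0))"
      using M[THEN conjunct2, rule_format, OF k, of "\<lambda>l. if l = m then 1 else 0"] .
    then show ?thesis by (simp only: 1 2)
  qed
  show "M = Jx a b c"
  proof (intro HOL.ext)
    fix i m
    show "M i m = Jx a b c i m"
    proof (cases "i \<in> {1..6} \<and> m \<in> {1..6}")
      case False
      then show ?thesis using M by (auto simp: Jx_def)
    next
      case True
      have e1: "complex_of_real a * complex_of_real (M 1 m) + \<i> * complex_of_real (M 2 m) = \<i> * phc a b c 1 m"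
        using K[of 1 m] True unfolding sum6 by (simp add: phc_def del: One_nat_def)
      have e2: "complex_of_real c * complex_of_real (M 3 m) + complex_of_real b * complex_of_real (M 5 m)
          + \<i> * complex_of_real (M 6 m) = \<i> * phc a b c 2 m"
        using K[of 2 m] True unfolding sum6 by (simp add: phc_def[of _ _ _ 2] add_ac)
      have e3: "complex_of_real c * complex_of_real (M 4 m) + \<i> * complex_of_real (M 5 m) = \<i> * phc a b c 3 m"
        using K[of 3 m] True unfolding sum6 by (simp add: phc_def[of _ _ _ 3])
      show ?thesis using True assms arg_cong[OF e1, of Re] arg_cong[OF e1, of Im]
        arg_cong[OF e2, of Re] arg_cong[OF e2, of Im] arg_cong[OF e3, of Re] arg_cong[OF e3, of Im]
        unfolding in6[of i] by (elim conjE disjE) (auto simp: Jx_def field_simps simp del: One_nat_def)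
    qed
  qed
qed

text \<open>This is the Gram matrix of |phi^1|^2 + |phi^2|^2 + |phi^3|^2; b enters only through
  phi^2, which mixes e^3 and e^5.\<close>

lemma Gm_values:
  assumes "a \<noteq> 0" "c \<noteq> 0" "i \<in> {1..6}" "j \<in> {1..6}"
  shows "Gm a b c i j = (if i = 1 \<and> j = 1 then a\<^sup>2 else if i = 2 \<and> j = 2 then 1
     else if i = 3 \<and> j = 3 then c\<^sup>2 else if i = 3 \<and> j = 5 \<or> i = 5 \<and> j = 3 then b * c
     else if i = 4 \<and> j = 4 then c\<^sup>2 else if i = 5 \<and> j = 5 then 1 + b\<^sup>2 else if i = 6 \<and> j = 6 then 1 else 0)"
  using assms(3,4) unfolding in6 Gm_def Jm_eq[OF assms(1,2)]
  by (elim disjE) (use assms(1,2) in \<open>simp_all add: omg_def Jx_def phc_def power2_eq_square field_simps\<close>)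

lemma Hx_Gm:
  assumes "a \<noteq> 0" "c \<noteq> 0" "i \<in> {1..6}" "j \<in> {1..6}"
  shows "(\<Sum>k\<in>{1..6}. Hx a b c i k * Gm a b c k j) = (if i = j then 1 else 0)"
    and "(\<Sum>k\<in>{1..6}. Gm a b c i k * Hx a b c k j) = (if i = j then 1 else 0)"
  using assms(3,4) unfolding in6 sum6
  by (elim disjE; use assms(1,2) in \<open>simp add: Hx_def Gm_values power2_eq_square field_simps\<close>)+

lemma Ginv_eq:
  assumes "a \<noteq> 0" "c \<noteq> 0"
  shows "Ginv a b c = Hx a b c"
  unfolding Ginv_def
proof (rule the_equality)
  show "(\<forall>i j. i \<notin> {1..6} \<or> j \<notin> {1..6} \<longrightarrow> Hx a b c i j = 0) \<and>
    (\<forall>i\<in>{1..6}. \<forall>j\<in>{1..6}. (\<Sum>k\<in>{1..6}. Hx a b c i k * Gm a b c k j) = (if i = j then 1 else 0))"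
  proof (intro conjI)
    show "\<forall>i j. i \<notin> {1..6} \<or> j \<notin> {1..6} \<longrightarrow> Hx a b c i j = 0" by (auto simp: Hx_def)
  qed (use Hx_Gm(1)[OF assms] in blast)
next
  fix H assume H: "(\<forall>i j. i \<notin> {1..6} \<or> j \<notin> {1..6} \<longrightarrow> H i j = 0) \<and>
    (\<forall>i\<in>{1..6}. \<forall>j\<in>{1..6}. (\<Sum>k\<in>{1..6}. H i k * Gm a b c k j) = (if i = j then 1 else 0))"
  show "H = Hx a b c"
  proof (intro HOL.ext)
    fix i j
    show "H i j = Hx a b c i j"
    proof (cases "i \<in> {1..6} \<and> j \<in> {1..6}")
      case False
      then have "Hx a b c i j = 0" by (auto simp: Hx_def)
      moreover have "H i j = 0" using H[THEN conjunct1, rule_format, of i j] False by blast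
      ultimately show ?thesis by simp
    next
      case True
      have "H i j = (\<Sum>k\<in>{1..6}. H i k * (if k = j then 1 else 0))" using True by (simp add: if_distrib cong: if_cong)
      also have "\<dots> = (\<Sum>k\<in>{1..6}. H i k * (\<Sum>l\<in>{1..6}. Gm a b c k l * Hx a b c l j))"
        using True by (intro sum.cong refl) (simp only: Hx_Gm(2)[OF assms])
      also have "\<dots> = (\<Sum>l\<in>{1..6}. (\<Sum>k\<in>{1..6}. H i k * Gm a b c k l) * Hx a b c l j)"
        unfolding sum_distrib_left sum_distrib_right by (subst sum.swap) (simp add: mult_ac)
      also have "\<dots> = (\<Sum>l\<in>{1..6}. (if i = l then 1 else 0) * Hx a b c l j)"
        using True by (intro sum.cong refl) (simp only: H[THEN conjunct2, rule_format])
      also have "\<dots> = Hx a b c i j" using True by (simp add: if_distrib[of "\<lambda>x. x * _"] cong: if_cong)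
      finally show ?thesis .
    qed
  qed
qed

text \<open>The theta^k are pairwise orthogonal with squared length 2. In matrix form: H is twice N
  times its conjugate transpose.\<close>

lemma Hx_Nc:
  assumes "a \<noteq> 0" "c \<noteq> 0" "i \<in> {1..6}" "j \<in> {1..6}"
  shows "complex_of_real (Hx a b c i j) = mm (\<lambda>i j. 2 * Nc a b c i j) (\<lambda>i j. cnj (Nc a b c j i)) i j"
  using assms(3,4) unfolding in6 mm_def sum6
  by (elim disjE) (use assms(1,2) in \<open>simp_all add: Hx_def Nc_def power2_eq_square field_simps\<close>)

abbreviation cG :: "real \<Rightarrow> real \<Rightarrow> real \<Rightarrow> nat \<Rightarrow> nat \<Rightarrow> complex" where
  "cG a b c \<equiv> \<lambda>i j. complex_of_real (Gm a b c i j)"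
abbreviation cH :: "real \<Rightarrow> real \<Rightarrow> real \<Rightarrow> nat \<Rightarrow> nat \<Rightarrow> complex" where
  "cH a b c \<equiv> \<lambda>i j. complex_of_real (Hx a b c i j)"

lemma pip_eq_wl:
  assumes "a \<noteq> 0" "c \<noteq> 0"
  shows "pip a b c \<alpha> \<beta> p = (\<Sum>I\<in>Pow {1..6}. \<Sum>K\<in>Pow {1..6}. \<alpha> I p * cnj (\<beta> K p) * wl (cH a b c) (sl I) K)"
  unfolding pip_def Ginv_eq[OF assms]
proof (intro sum.cong refl)
  fix I K :: "nat set" assume I: "I \<in> Pow {1..6}" and K: "K \<in> Pow {1..6}"
  then have fin: "finite I" "finite K" using finite_subset by auto
  then show "(if card I = card K then \<alpha> I p * cnj (\<beta> K p) * complex_of_real (mdet (Hx a b c) (sl I) (sl K)) else 0)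
     = \<alpha> I p * cnj (\<beta> K p) * wl (cH a b c) (sl I) K"
    using K by (auto simp: mdet_eq_wl wl_card)
qed

text \<open>Cauchy-Binet for the factorization \<open>Hx_Nc\<close>. The second factor is a
  conjugate transpose, so its minors are conjugate minors of \<open>Nc\<close> by
  \<open>wl_transpose\<close>.\<close>

lemma wl_cH:
  assumes "a \<noteq> 0" "c \<noteq> 0" "I \<subseteq> {1..6}" "K \<subseteq> {1..6}"
  shows "wl (cH a b c) (sl I) K = (\<Sum>S\<in>Pow {1..6}. 2 ^ card S * wl (Nc a b c) (sl I) S * cnj (wl (Nc a b c) (sl K) S))"
proof -
  have fin: "finite I" "finite K" using assms(3,4) finite_subset by auto
  have "wl (cH a b c) (sl I) = wl (mm (\<lambda>i j. 2 * Nc a b c i j) (\<lambda>i j. cnj (Nc a b c j i))) (sl I)"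
    by (rule wl_cong) (use assms fin in \<open>auto simp: Hx_Nc\<close>)
  also have "\<dots> = ext (\<lambda>i j. cnj (Nc a b c j i)) (wl (\<lambda>i j. 2 * Nc a b c i j) (sl I))"
    by (simp add: ext_wl)
  finally have "wl (cH a b c) (sl I) K = (\<Sum>S\<in>Pow {1..6}. 2 ^ length (sl I) * wl (Nc a b c) (sl I) S * wl (\<lambda>i j. cnj (Nc a b c j i)) (sl S) K)"
    by (simp add: ext_def wl_scale)
  also have "\<dots> = (\<Sum>S\<in>Pow {1..6}. 2 ^ card S * wl (Nc a b c) (sl I) S * cnj (wl (Nc a b c) (sl K) S))"
  proof (intro sum.cong refl)
    fix S :: "nat set" assume "S \<in> Pow {1..6}"
    then have "wl (\<lambda>i j. cnj (Nc a b c j i)) (sl S) K = cnj (wl (Nc a b c) (sl K) S)"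
      using assms wl_transpose[of S K "\<lambda>i j. cnj (Nc a b c i j)"] by (simp add: cnj_wl)
    then show "2 ^ length (sl I) * wl (Nc a b c) (sl I) S * wl (\<lambda>i j. cnj (Nc a b c j i)) (sl S) K
       = 2 ^ card S * wl (Nc a b c) (sl I) S * cnj (wl (Nc a b c) (sl K) S)"
      by (cases "card S = length (sl I)") (auto simp: wl_card)
  qed
  finally show ?thesis .
qed

lemma pip_eq:
  assumes "a \<noteq> 0" "c \<noteq> 0"
  shows "pip a b c \<alpha> \<beta> p = (\<Sum>S\<in>Pow {1..6}. 2 ^ card S * ext (Nc a b c) (\<lambda>T. \<alpha> T p) S
      * cnj (ext (Nc a b c) (\<lambda>T. \<beta> T p) S))"
proof -
  let ?w = "\<lambda>I S. wl (Nc a b c) (sl I) S"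
  have "pip a b c \<alpha> \<beta> p = (\<Sum>I\<in>Pow {1..6}. \<Sum>K\<in>Pow {1..6}. \<Sum>S\<in>Pow {1..6}.
      2 ^ card S * (\<alpha> I p * ?w I S) * (cnj (\<beta> K p) * cnj (?w K S)))"
    unfolding pip_eq_wl[OF assms]
    by (intro sum.cong refl) (simp add: wl_cH[OF assms] sum_distrib_left mult_ac)
  also have "\<dots> = (\<Sum>I\<in>Pow {1..6}. \<Sum>S\<in>Pow {1..6}. \<Sum>K\<in>Pow {1..6}.
      2 ^ card S * (\<alpha> I p * ?w I S) * (cnj (\<beta> K p) * cnj (?w K S)))"
    by (rule sum.cong[OF refl], rule sum.swap)
  also have "\<dots> = (\<Sum>S\<in>Pow {1..6}. \<Sum>I\<in>Pow {1..6}. \<Sum>K\<in>Pow {1..6}.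
      2 ^ card S * (\<alpha> I p * ?w I S) * (cnj (\<beta> K p) * cnj (?w K S)))"
    by (rule sum.swap)
  also have "\<dots> = (\<Sum>S\<in>Pow {1..6}. 2 ^ card S * ext (Nc a b c) (\<lambda>T. \<alpha> T p) S
      * cnj (ext (Nc a b c) (\<lambda>T. \<beta> T p) S))"
    by (simp add: ext_def sum_distrib_left sum_distrib_right mult_ac)
  finally show ?thesis .
qed

lemma mm_cH_cG:
  assumes "a \<noteq> 0" "c \<noteq> 0" "i \<in> {1..6}" "j \<in> {1..6}"
  shows "mm (cH a b c) (cG a b c) i j = dl i j" "mm (cG a b c) (cH a b c) i j = dl i j"
proof -
  have "mm (cH a b c) (cG a b c) i j = complex_of_real (\<Sum>k\<in>{1..6}. Hx a b c i k * Gm a b c k j)"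
    by (simp add: mm_def)
  then show "mm (cH a b c) (cG a b c) i j = dl i j" by (simp only: Hx_Gm[OF assms] dl_def) auto
  have "mm (cG a b c) (cH a b c) i j = complex_of_real (\<Sum>k\<in>{1..6}. Gm a b c i k * Hx a b c k j)"
    by (simp add: mm_def)
  then show "mm (cG a b c) (cH a b c) i j = dl i j" by (simp only: Hx_Gm[OF assms] dl_def) auto
qed

text \<open>The inner products that H and G induce on forms are inverse to each other, again by
  functoriality. This is what allows one to solve for the coefficients of the adjoint.\<close>

lemma wl_cH_cG:
  assumes "a \<noteq> 0" "c \<noteq> 0" "I \<subseteq> {1..6}"
  shows "(\<Sum>K\<in>Pow {1..6}. wl (cH a b c) (sl I) K * wl (cG a b c) (sl K) J) = (if J = I then 1 else 0)"
proof -
  have fin: "finite I" using assms(3) finite_subset by auto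
  have "wl (mm (cH a b c) (cG a b c)) (sl I) = wl dl (sl I)"
    by (rule wl_cong) (use assms fin in \<open>auto simp: mm_cH_cG\<close>)
  then have "ext (cG a b c) (wl (cH a b c) (sl I)) J = wl dl (sl I) J" by (simp add: ext_wl)
  then show ?thesis using assms(3) unfolding ext_def by (simp only: wl_dl)
qed

text \<open>In top degree the only minor is the determinant, so a vanishing determinant would turn
  \<open>wl_cH_cG\<close> into 0 = 1. Nonvanishing lets the volume factor be cancelled from L^2
  identities.\<close>

lemma mdet_Gm_nonzero:
  assumes "a \<noteq> 0" "c \<noteq> 0"
  shows "mdet (Gm a b c) [1,2,3,4,5,6] [1,2,3,4,5,6] \<noteq> 0"
proof
  let ?I = "{1..6::nat}"
  have "sorted_list_of_set {1..6::nat} = [1,2,3,4,5,6]"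
  proof -
    have "{1..6::nat} = set [1,2,3,4,5,6]" by auto
    then show ?thesis by (simp only: sorted_list_of_set_sort_remdups) simp
  qed
  moreover assume "mdet (Gm a b c) [1,2,3,4,5,6] [1,2,3,4,5,6] = 0"
  ultimately have z: "wl (cG a b c) (sl ?I) ?I = 0" using mdet_eq_wl[of ?I "sl ?I" "Gm a b c"] by simp
  \<comment> \<open>A proper subset has too few elements, so its term vanishes for reasons of
    degree.\<close>
  have "wl (cH a b c) (sl ?I) K * wl (cG a b c) (sl K) ?I = 0" if "K \<in> Pow {1..6}" for K
  proof (cases "K = ?I")
    case False
    then have "card K < card ?I" using that by (intro psubset_card_mono) auto
    then show ?thesis using that finite_subset[of K ?I] by (simp add: wl_card)
  qed (simp only: z mult_zero_right)
  then have "(\<Sum>K\<in>Pow {1..6}. wl (cH a b c) (sl ?I) K * wl (cG a b c) (sl K) ?I) = 0"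
    by (intro sum.neutral) auto
  then show False using wl_cH_cG[OF assms, of ?I b ?I] by simp
qed

section \<open>Smooth functions and left-invariant derivatives\<close>

declare split_paired_All [simp del] split_paired_Ex [simp del]

lemma frechet_eqI: "(f has_derivative D) (at p) \<Longrightarrow> frechet_derivative f (at p) = D"
  using frechet_derivative_at by metis

lemma frechet_has: "f differentiable (at p) \<Longrightarrow> (f has_derivative frechet_derivative f (at p)) (at p)"
  using frechet_derivative_works by blast

lemma Ck_differentiable: "Ck (Suc k) f \<Longrightarrow> f differentiable (at p)"
  by simp

text \<open>The recursion for \<open>Ck\<close> mentions continuity only at level 0; at the bottom
  of the induction it comes from differentiability.\<close>

lemma Ck_SucD: "Ck (Suc k) f \<Longrightarrow> Ck k f"
proof (induction k arbitrary: f)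
  case 0
  then show ?case by (auto intro!: differentiable_imp_continuous_on simp: differentiable_on_def)
next
  case (Suc k)
  then show ?case by (metis Ck.simps(2))
qed

lemma Ck_continuous: "Ck k f \<Longrightarrow> continuous_on UNIV f"
  by (induction k) (auto dest!: Ck_SucD simp del: Ck.simps(2))

lemma Ck_const: "Ck k (\<lambda>p. z)"
proof (induction k arbitrary: z)
  case (Suc k)
  have "frechet_derivative (\<lambda>p::pt. z) (at p) = (\<lambda>v. 0)" for p by (intro frechet_eqI derivative_intros)
  then show ?case using Suc by simp
qed auto

lemma Ck_add: "Ck k f \<Longrightarrow> Ck k g \<Longrightarrow> Ck k (\<lambda>p. f p + g p)"
proof (induction k arbitrary: f g)
  case (Suc k)
  have "frechet_derivative (\<lambda>p. f p + g p) (at p) = (\<lambda>v. frechet_derivative f (at p) v + frechet_derivative g (at p) v)" for p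
    using Suc.prems by (intro frechet_eqI has_derivative_add frechet_has) auto
  then show ?case using Suc by simp
qed (auto intro: continuous_intros)

lemma Ck_mult: "Ck k f \<Longrightarrow> Ck k g \<Longrightarrow> Ck k (\<lambda>p. f p * g p)"
proof (induction k arbitrary: f g)
  case (Suc k)
  have "frechet_derivative (\<lambda>p. f p * g p) (at p)
      = (\<lambda>v. f p * frechet_derivative g (at p) v + frechet_derivative f (at p) v * g p)" for p
    using Suc.prems by (intro frechet_eqI has_derivative_mult frechet_has) auto
  then show ?case using Suc Suc.prems[THEN Ck_SucD] by (auto intro!: Ck_add)
qed (auto intro: continuous_intros)

lemma Ck_exp_fst: "Ck k (\<lambda>p. complex_of_real (exp (r * fst p)))"
proof (induction k)
  case (Suc k)
  have d: "((\<lambda>p::pt. complex_of_real (exp (r * fst p))) has_derivative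
      (\<lambda>v. complex_of_real (r * fst v) * complex_of_real (exp (r * fst p)))) (at p)" for p
    by (auto intro!: derivative_eq_intros simp: mult_ac)
  then have "frechet_derivative (\<lambda>p::pt. complex_of_real (exp (r * fst p))) (at p) =
      (\<lambda>v. complex_of_real (r * fst v) * complex_of_real (exp (r * fst p)))" for p
    by (rule frechet_eqI)
  moreover have "(\<lambda>p::pt. complex_of_real (exp (r * fst p))) differentiable (at p)" for p
    using d differentiable_def by blast
  ultimately show ?case using Suc by (simp add: Ck_mult Ck_const del: of_real_mult)
qed (auto intro!: continuous_intros)

lemma Ck_x: "Ck k (\<lambda>p. complex_of_real (fst (snd p)))"
proof (cases k)
  case (Suc k)
  have d: "((\<lambda>p::pt. complex_of_real (fst (snd p))) has_derivative
      (\<lambda>v. complex_of_real (fst (snd v)))) (at p)" for p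
    by (auto intro!: derivative_eq_intros)
  then have "frechet_derivative (\<lambda>p::pt. complex_of_real (fst (snd p))) (at p) =
      (\<lambda>v. complex_of_real (fst (snd v)))" for p
    by (rule frechet_eqI)
  moreover have "(\<lambda>p::pt. complex_of_real (fst (snd p))) differentiable (at p)" for p
    using d differentiable_def by blast
  ultimately show ?thesis using Suc by (simp add: Ck_const)
qed (auto intro!: continuous_intros)

lemma smooth_differentiable: "smooth_fun f \<Longrightarrow> f differentiable (at p)"
  unfolding smooth_fun_def using Ck_differentiable by blast

lemma smooth_continuous: "smooth_fun f \<Longrightarrow> continuous_on UNIV f"
  unfolding smooth_fun_def using Ck_continuous by blast

lemma smooth_const: "smooth_fun (\<lambda>p. z)"
  by (simp add: smooth_fun_def Ck_const)

lemma smooth_add: "smooth_fun f \<Longrightarrow> smooth_fun g \<Longrightarrow> smooth_fun (\<lambda>p. f p + g p)"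
  by (simp add: smooth_fun_def Ck_add)

lemma smooth_mult: "smooth_fun f \<Longrightarrow> smooth_fun g \<Longrightarrow> smooth_fun (\<lambda>p. f p * g p)"
  by (simp add: smooth_fun_def Ck_mult)

lemma smooth_partial: "smooth_fun f \<Longrightarrow> v \<in> Basis \<Longrightarrow> smooth_fun (\<lambda>p. frechet_derivative f (at p) v)"
  unfolding smooth_fun_def by (metis Ck.simps(2))

section \<open>The left-invariant frame in coordinates\<close>

definition bs :: "nat \<Rightarrow> pt" where
  "bs i = (if i = 1 then (1,0,0,0,0,0) else if i = 2 then (0,1,0,0,0,0) else if i = 3 then (0,0,1,0,0,0)
    else if i = 4 then (0,0,0,1,0,0) else if i = 5 then (0,0,0,0,1,0) else (0,0,0,0,0,1))"

lemma bs_Basis: "bs i \<in> Basis"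
  by (auto simp: bs_def Basis_prod_def zero_prod_def)

text \<open>The coframe is triangular over the coordinate differentials, so its six values determine
  a vector.\<close>

lemma frv_eqI:
  assumes "i \<in> {1..6}" "\<And>k. k \<in> {1..6} \<Longrightarrow> cof k p v = (if k = i then 1 else 0)"
  shows "frv i p = v"
  unfolding frv_def
proof (rule the_equality)
  show "\<forall>k\<in>{1..6}. cof k p v = (if k = i then 1 else 0)" using assms by blast
next
  fix w assume "\<forall>k\<in>{1..6}. cof k p w = (if k = i then 1 else 0)"
  then have e: "cof k p w = cof k p v" if "k \<in> {1..6}" for k using that assms by simp
  obtain t x y1 y2 z1 z2 where p: "p = (t,x,y1,y2,z1,z2)" by (metis prod_cases6)
  obtain w1 w2 w3 w4 w5 w6 where w: "w = (w1,w2,w3,w4,w5,w6)" by (metis prod_cases6)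
  obtain v1 v2 v3 v4 v5 v6 where v: "v = (v1,v2,v3,v4,v5,v6)" by (metis prod_cases6)
  have "w1 = v1" "w2 = v2" using e[of 1] e[of 2] by (auto simp: cof_def p w v)
  moreover have "w5 = v5" "w6 = v6" using e[of 5] e[of 6] by (auto simp: cof_def p w v)
  \<comment> \<open>e^3 and e^4 also involve dz1 and dz2, so these components can be compared only
    now.\<close>
  moreover have "w3 = v3" "w4 = v4" using e[of 3] e[of 4] \<open>w5 = v5\<close> \<open>w6 = v6\<close> by (auto simp: cof_def p w v)
  ultimately show "w = v" by (simp add: v w)
qed

lemma frv_values:
  "frv 1 p = bs 1" "frv 2 p = bs 2"
  "frv 3 p = exp (fst p) *\<^sub>R bs 3"
  "frv 4 p = exp (- fst p) *\<^sub>R bs 4"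
  "frv 5 p = (fst (snd p) * exp (fst p)) *\<^sub>R bs 3 + exp (fst p) *\<^sub>R bs 5"
  "frv 6 p = (fst (snd p) * exp (- fst p)) *\<^sub>R bs 4 + exp (- fst p) *\<^sub>R bs 6"
  by (cases p, (rule frv_eqI, simp, auto simp: cof_def bs_def in6 simp flip: exp_add)[1])+

lemma Eder_values:
  assumes "f differentiable (at p)"
  shows "Eder 1 f p = frechet_derivative f (at p) (bs 1)"
   "Eder 2 f p = frechet_derivative f (at p) (bs 2)"
   "Eder 3 f p = complex_of_real (exp (fst p)) * frechet_derivative f (at p) (bs 3)"
   "Eder 4 f p = complex_of_real (exp (- fst p)) * frechet_derivative f (at p) (bs 4)"
   "Eder 5 f p = complex_of_real (exp (fst p)) * (complex_of_real (fst (snd p)) * frechet_derivative f (at p) (bs 3)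
      + frechet_derivative f (at p) (bs 5))"
   "Eder 6 f p = complex_of_real (exp (- fst p)) * (complex_of_real (fst (snd p)) * frechet_derivative f (at p) (bs 4)
      + frechet_derivative f (at p) (bs 6))"
proof -
  interpret linear "frechet_derivative f (at p)" using assms linear_frechet_derivative by blast
  show "Eder 1 f p = frechet_derivative f (at p) (bs 1)"
   "Eder 2 f p = frechet_derivative f (at p) (bs 2)"
   "Eder 3 f p = complex_of_real (exp (fst p)) * frechet_derivative f (at p) (bs 3)"
   "Eder 4 f p = complex_of_real (exp (- fst p)) * frechet_derivative f (at p) (bs 4)"
   "Eder 5 f p = complex_of_real (exp (fst p)) * (complex_of_real (fst (snd p)) * frechet_derivative f (at p) (bs 3)
      + frechet_derivative f (at p) (bs 5))"
   "Eder 6 f p = complex_of_real (exp (- fst p)) * (complex_of_real (fst (snd p)) * frechet_derivative f (at p) (bs 4)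
      + frechet_derivative f (at p) (bs 6))"
    unfolding Eder_def frv_values by (simp_all add: add scaleR scaleR_conv_of_real algebra_simps)
qed

lemma smooth_Eder:
  assumes f: "smooth_fun f" and i: "i \<in> {1..6}"
  shows "smooth_fun (Eder i f)"
proof -
  have e: "smooth_fun (\<lambda>p. complex_of_real (exp (fst p)))" "smooth_fun (\<lambda>p. complex_of_real (exp (- fst p)))"
    using Ck_exp_fst[of _ 1] Ck_exp_fst[of _ "-1"] by (auto simp: smooth_fun_def)
  have x: "smooth_fun (\<lambda>p. complex_of_real (fst (snd p)))"
    using Ck_x by (auto simp: smooth_fun_def)
  note d = Eder_values[OF smooth_differentiable[OF f]]
  note p = smooth_partial[OF f bs_Basis]
  from i show ?thesis unfolding in6
    by (elim disjE; simp only:; subst d[abs_def]) (intro smooth_add smooth_mult e x p)+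
qed

lemma Eder_add:
  "f differentiable (at p) \<Longrightarrow> g differentiable (at p) \<Longrightarrow> Eder i (\<lambda>p. f p + g p) p = Eder i f p + Eder i g p"
  unfolding Eder_def by (subst frechet_eqI[OF has_derivative_add[OF frechet_has frechet_has]]) auto

lemma Eder_scale:
  "f differentiable (at p) \<Longrightarrow> Eder i (\<lambda>p. z * f p) p = z * Eder i f p"
  unfolding Eder_def by (subst frechet_eqI[OF has_derivative_mult_right[OF frechet_has]]) auto

lemma Eder_const: "Eder i (\<lambda>p. z) p = 0"
  unfolding Eder_def by (subst frechet_eqI[OF has_derivative_const]) auto

lemma Eder_sum:
  assumes "finite A" "\<And>a. a \<in> A \<Longrightarrow> f a differentiable (at p)"
  shows "Eder i (\<lambda>p. \<Sum>a\<in>A. f a p) p = (\<Sum>a\<in>A. Eder i (f a) p)"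
  using assms
proof (induction A rule: finite_induct)
  case (insert x F)
  then have "(\<lambda>p. \<Sum>a\<in>F. f a p) differentiable (at p)" by (intro differentiable_sum) auto
  then show ?case using insert by (simp add: Eder_add)
qed (simp add: Eder_const)

lemma has_derivative_mult_cnj:
  assumes "f differentiable (at p)" "g differentiable (at p)"
  shows "((\<lambda>p. f p * cnj (g p)) has_derivative
    (\<lambda>v. f p * cnj (frechet_derivative g (at p) v) + frechet_derivative f (at p) v * cnj (g p))) (at p)"
  by (intro has_derivative_mult frechet_has assms has_derivative_cnj)

lemma Eder_mult_cnj:
  assumes "f differentiable (at p)" "g differentiable (at p)"
  shows "Eder i (\<lambda>p. f p * cnj (g p)) p = f p * cnj (Eder i g p) + Eder i f p * cnj (g p)"
  unfolding Eder_def by (subst frechet_eqI[OF has_derivative_mult_cnj[OF assms]]) auto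

section \<open>Flows of the frame fields as right translations\<close>

lemma gmul_assoc: "gmul (gmul p q) r = gmul p (gmul q r)"
  by (cases p, cases q, cases r) (simp add: gmul_def algebra_simps exp_add exp_diff exp_minus)

abbreviation one_par :: "nat \<Rightarrow> real \<Rightarrow> pt" where
  "one_par i s \<equiv> s *\<^sub>R bs i"

text \<open>The flow of a left-invariant field is right translation by a one-parameter group; in
  these coordinates its orbits are straight lines.\<close>

lemma gmul_one_par: "i \<in> {1..6} \<Longrightarrow> gmul p (one_par i s) = p + s *\<^sub>R frv i p"
  unfolding in6 by (cases p) (auto simp: frv_values gmul_def bs_def simp del: One_nat_def)

lemma frv_gmul_one_par: "i \<in> {1..6} \<Longrightarrow> frv i (gmul p (one_par i s)) = frv i p"
  unfolding in6 by (cases p) (auto simp: frv_values gmul_def bs_def simp del: One_nat_def)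

lemma flow_vector_derivative:
  assumes "f differentiable (at (gmul p (one_par i s)))" "i \<in> {1..6}"
  shows "((\<lambda>s. f (gmul p (one_par i s))) has_vector_derivative Eder i f (gmul p (one_par i s))) (at s)"
proof -
  have "((\<lambda>s. gmul p (one_par i s)) has_vector_derivative frv i p) (at s)"
    unfolding gmul_one_par[OF assms(2)] by (auto intro!: derivative_eq_intros)
  then have "((f \<circ> (\<lambda>s. gmul p (one_par i s))) has_vector_derivative
      frechet_derivative f (at (gmul p (one_par i s))) (frv i p)) (at s)"
    by (rule vector_derivative_diff_chain_within[where S=UNIV, simplified])
      (use frechet_has[OF assms(1)] in \<open>simp add: has_derivative_at_withinI\<close>)
  then show ?thesis unfolding Eder_def frv_gmul_one_par[OF assms(2)] by (simp add: o_def)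
qed

lemma gmul_0: "gmul p 0 = p"
  by (cases p) (simp add: gmul_def zero_prod_def)

text \<open>Left translation by the lattice commutes with the right translations generating E_i, so
  both sides are the derivative of the same function of s.\<close>

lemma Gam_inv_Eder:
  assumes inv: "Gam_inv a0 P f" and f: "\<And>p. f differentiable (at p)" and i: "i \<in> {1..6}"
  shows "Gam_inv a0 P (Eder i f)"
  unfolding Gam_inv_def
proof (intro ballI allI)
  fix \<gamma> p assume g: "\<gamma> \<in> Gam a0 P"
  have "((\<lambda>s. f (gmul (gmul \<gamma> p) (one_par i s))) has_vector_derivative Eder i f (gmul \<gamma> p)) (at 0)"
    using flow_vector_derivative[OF f i, of "gmul \<gamma> p" 0] by (simp add: gmul_0)
  moreover have "f (gmul (gmul \<gamma> p) (one_par i s)) = f (gmul p (one_par i s))" for s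
    using inv g by (simp add: gmul_assoc Gam_inv_def)
  moreover have "((\<lambda>s. f (gmul p (one_par i s))) has_vector_derivative Eder i f p) (at 0)"
    using flow_vector_derivative[OF f i, of p 0] by (simp add: gmul_0)
  ultimately show "Eder i f (gmul \<gamma> p) = Eder i f p"
    by (auto dest: vector_derivative_unique_at)
qed

text \<open>The frame is triangular over the coordinate fields: E_1 to E_4 yield the first four
  partial derivatives, after which E_5 and E_6 yield the other two.\<close>

lemma constant_if_Eder_zero:
  assumes f: "\<And>p. f differentiable (at p)" and z: "\<And>i p. i \<in> {1..6} \<Longrightarrow> Eder i f p = 0"
  shows "\<exists>z. \<forall>p. f p = z"
proof -
  have "frechet_derivative f (at p) = (\<lambda>v. 0)" for p
  proof -
    interpret linear "frechet_derivative f (at p)" using f linear_frechet_derivative by blast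
    note d = Eder_values[OF f, of p]
    have b: "frechet_derivative f (at p) (bs 1) = 0" "frechet_derivative f (at p) (bs 2) = 0"
      "frechet_derivative f (at p) (bs 3) = 0" "frechet_derivative f (at p) (bs 4) = 0"
      using d(1-4) z[of 1 p] z[of 2 p] z[of 3 p] z[of 4 p] by auto
    then have b': "frechet_derivative f (at p) (bs 5) = 0" "frechet_derivative f (at p) (bs 6) = 0"
      using d(5-6) z[of 5 p] z[of 6 p] by auto
    show ?thesis
    proof
      fix v :: pt
      obtain v1 v2 v3 v4 v5 v6 where v: "v = (v1,v2,v3,v4,v5,v6)" by (metis prod_cases6)
      have "v = v1 *\<^sub>R bs 1 + v2 *\<^sub>R bs 2 + v3 *\<^sub>R bs 3 + v4 *\<^sub>R bs 4 + v5 *\<^sub>R bs 5 + v6 *\<^sub>R bs 6"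
        by (simp add: v bs_def)
      then show "frechet_derivative f (at p) v = 0" by (simp only: add scaleR b b') simp
    qed
  qed
  then have "\<And>p. (f has_derivative (\<lambda>v. 0)) (at p)" using frechet_has[OF f] by metis
  then show ?thesis using has_derivative_zero_constant[of UNIV f] by auto
qed

text \<open>Smooth functions on X, viewed on G.\<close>

definition SI :: "real \<Rightarrow> real^2^2 \<Rightarrow> (pt \<Rightarrow> complex) \<Rightarrow> bool" where
  "SI a0 P f \<longleftrightarrow> smooth_fun f \<and> Gam_inv a0 P f"

lemma SI_const: "SI a0 P (\<lambda>p. z)"
  by (simp add: SI_def smooth_const Gam_inv_def)

lemma SI_add: "SI a0 P f \<Longrightarrow> SI a0 P g \<Longrightarrow> SI a0 P (\<lambda>p. f p + g p)"
  by (simp add: SI_def smooth_add Gam_inv_def)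

lemma SI_mult: "SI a0 P f \<Longrightarrow> SI a0 P g \<Longrightarrow> SI a0 P (\<lambda>p. f p * g p)"
  by (simp add: SI_def smooth_mult Gam_inv_def)

lemma SI_scale: "SI a0 P f \<Longrightarrow> SI a0 P (\<lambda>p. z * f p)"
  by (intro SI_mult SI_const)

lemma SI_sum: "(\<And>a. a \<in> A \<Longrightarrow> SI a0 P (f a)) \<Longrightarrow> SI a0 P (\<lambda>p. \<Sum>a\<in>A. f a p)"
  by (induction A rule: infinite_finite_induct) (auto intro: SI_const SI_add)

lemma SI_differentiable: "SI a0 P f \<Longrightarrow> f differentiable (at p)"
  by (simp add: SI_def smooth_differentiable)

lemma SI_Eder: "SI a0 P f \<Longrightarrow> i \<in> {1..6} \<Longrightarrow> SI a0 P (Eder i f)"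
  by (simp add: SI_def smooth_Eder Gam_inv_Eder smooth_differentiable)

section \<open>Invariant measure and fundamental domains\<close>

text \<open>Change of variables with constant Jacobian, put as a substitution rule so that it can be
  iterated over the coordinates by Fubini. The constant is the reciprocal of the absolute
  Jacobian.\<close>

definition mfac :: "('a::euclidean_space \<Rightarrow> 'a) \<Rightarrow> ennreal \<Rightarrow> bool" where
  "mfac T c \<longleftrightarrow> continuous_on UNIV T \<and>
    (\<forall>f\<in>borel_measurable borel. (\<integral>\<^sup>+p. f (T p) \<partial>lborel) = c * (\<integral>\<^sup>+p. f p \<partial>lborel))"

lemma mfac_measurable: "mfac T c \<Longrightarrow> T \<in> borel_measurable borel"
  unfolding mfac_def by (blast intro: borel_measurable_continuous_onI)

lemma mfac_nn_integral:
  "mfac T c \<Longrightarrow> f \<in> borel_measurable borel \<Longrightarrow> (\<integral>\<^sup>+p. f (T p) \<partial>lborel) = c * (\<integral>\<^sup>+p. f p \<partial>lborel)"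
  by (simp add: mfac_def)

lemma mfac_affine:
  assumes "\<alpha> \<noteq> (0::real)"
  shows "mfac (\<lambda>y. \<alpha> * y + h) (ennreal (1 / \<bar>\<alpha>\<bar>))"
  unfolding mfac_def
proof (intro conjI ballI continuous_intros)
  fix f :: "real \<Rightarrow> ennreal" assume f: "f \<in> borel_measurable borel"
  have "ennreal (1 / \<bar>\<alpha>\<bar>) * (\<integral>\<^sup>+p. f p \<partial>lborel)
      = ennreal (1 / \<bar>\<alpha>\<bar>) * ennreal \<bar>\<alpha>\<bar> * (\<integral>\<^sup>+p. f (h + \<alpha> * p) \<partial>lborel)"
    using nn_integral_real_affine[OF f assms, of h] by (simp add: mult.assoc)
  also have "ennreal (1 / \<bar>\<alpha>\<bar>) * ennreal \<bar>\<alpha>\<bar> = 1"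
    using assms by (simp flip: ennreal_mult)
  finally show "(\<integral>\<^sup>+p. f (\<alpha> * p + h) \<partial>lborel) = ennreal (1 / \<bar>\<alpha>\<bar>) * (\<integral>\<^sup>+p. f p \<partial>lborel)"
    by (simp add: add.commute)
qed

lemma mfac_translation: "mfac (\<lambda>w. w + h) 1"
  unfolding mfac_def
proof (intro conjI ballI continuous_intros)
  fix f :: "'a \<Rightarrow> ennreal" assume f: "f \<in> borel_measurable borel"
  have "(\<integral>\<^sup>+p. f p \<partial>distr lborel borel ((+) h)) = (\<integral>\<^sup>+p. f (h + p) \<partial>lborel)"
    by (rule nn_integral_distr) (use f in auto)
  then show "(\<integral>\<^sup>+p. f (p + h) \<partial>lborel) = 1 * (\<integral>\<^sup>+p. f p \<partial>lborel)"
    by (simp add: lborel_distr_plus add.commute)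
qed

text \<open>For a triangular map the inner integral over the first coordinate contributes the same
  factor c at every value of the second, and the outer integral contributes d.\<close>

lemma mfac_fst_dependent:
  fixes S :: "'b::euclidean_space \<Rightarrow> 'b" and g :: "'b \<Rightarrow> 'a::euclidean_space \<Rightarrow> 'a"
  assumes S: "mfac S d" and g: "\<And>y. mfac (g y) c"
    and cont: "continuous_on UNIV (\<lambda>p. (g (snd p) (fst p), S (snd p)))"
  shows "mfac (\<lambda>p. (g (snd p) (fst p), S (snd p))) (c * d)"
  unfolding mfac_def
proof (intro conjI ballI cont)
  fix f :: "'a \<times> 'b \<Rightarrow> ennreal" assume f: "f \<in> borel_measurable borel"
  let ?T = "\<lambda>p. (g (snd p) (fst p), S (snd p))"
  have "?T \<in> borel_measurable borel" using cont by (rule borel_measurable_continuous_onI)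
  then have T: "(\<lambda>p. f (?T p)) \<in> borel_measurable (lborel \<Otimes>\<^sub>M lborel)"
    using f measurable_compose by (simp add: lborel_prod)
  have fl: "f \<in> borel_measurable (lborel \<Otimes>\<^sub>M lborel)" using f by (simp add: lborel_prod)
  have sec: "(\<lambda>x. f (x, y)) \<in> borel_measurable borel" for y
    using measurable_compose[OF measurable_Pair2' fl, of y] by simp
  have meas: "(\<lambda>y. \<integral>\<^sup>+x. f (x, y) \<partial>lborel) \<in> borel_measurable borel"
    using lborel.borel_measurable_nn_integral_fst[OF measurable_pair_swap[OF fl]] by simp
  have "(\<integral>\<^sup>+p. f (?T p) \<partial>lborel) = (\<integral>\<^sup>+y. \<integral>\<^sup>+x. f (g y x, S y) \<partial>lborel \<partial>lborel)"
    using lborel_pair.nn_integral_snd[OF T] by (simp add: lborel_prod)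
  also have "\<dots> = (\<integral>\<^sup>+y. c * \<integral>\<^sup>+x. f (x, S y) \<partial>lborel \<partial>lborel)"
    by (intro nn_integral_cong mfac_nn_integral[OF g sec])
  also have "\<dots> = c * (\<integral>\<^sup>+y. \<integral>\<^sup>+x. f (x, S y) \<partial>lborel \<partial>lborel)"
    using measurable_compose[OF mfac_measurable[OF S] meas] by (intro nn_integral_cmult) simp
  also have "(\<integral>\<^sup>+y. \<integral>\<^sup>+x. f (x, S y) \<partial>lborel \<partial>lborel) = d * (\<integral>\<^sup>+y. \<integral>\<^sup>+x. f (x, y) \<partial>lborel \<partial>lborel)"
    by (rule mfac_nn_integral[OF S meas])
  also have "(\<integral>\<^sup>+y. \<integral>\<^sup>+x. f (x, y) \<partial>lborel \<partial>lborel) = (\<integral>\<^sup>+p. f p \<partial>lborel)"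
    using lborel_pair.nn_integral_snd[OF fl] by (simp add: lborel_prod)
  finally show "(\<integral>\<^sup>+p. f (?T p) \<partial>lborel) = c * d * (\<integral>\<^sup>+p. f p \<partial>lborel)" by (simp add: mult.assoc)
qed

lemma mfac_snd_dependent:
  fixes S :: "'a::euclidean_space \<Rightarrow> 'a" and g :: "'a \<Rightarrow> 'b::euclidean_space \<Rightarrow> 'b"
  assumes S: "mfac S d" and g: "\<And>y. mfac (g y) c"
    and cont: "continuous_on UNIV (\<lambda>p. (S (fst p), g (fst p) (snd p)))"
  shows "mfac (\<lambda>p. (S (fst p), g (fst p) (snd p))) (c * d)"
  unfolding mfac_def
proof (intro conjI ballI cont)
  fix f :: "'a \<times> 'b \<Rightarrow> ennreal" assume f: "f \<in> borel_measurable borel"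
  let ?T = "\<lambda>p. (S (fst p), g (fst p) (snd p))"
  have "?T \<in> borel_measurable borel" using cont by (rule borel_measurable_continuous_onI)
  then have T: "(\<lambda>p. f (?T p)) \<in> borel_measurable (lborel \<Otimes>\<^sub>M lborel)"
    using f measurable_compose by (simp add: lborel_prod)
  have fl: "f \<in> borel_measurable (lborel \<Otimes>\<^sub>M lborel)" using f by (simp add: lborel_prod)
  have sec: "(\<lambda>y. f (x, y)) \<in> borel_measurable borel" for x
    using measurable_compose[OF measurable_Pair1' fl, of x] by simp
  have meas: "(\<lambda>x. \<integral>\<^sup>+y. f (x, y) \<partial>lborel) \<in> borel_measurable borel"
    using lborel.borel_measurable_nn_integral_fst[OF fl] by simp
  have "(\<integral>\<^sup>+p. f (?T p) \<partial>lborel) = (\<integral>\<^sup>+x. \<integral>\<^sup>+y. f (S x, g x y) \<partial>lborel \<partial>lborel)"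
    using lborel.nn_integral_fst[OF T] by (simp add: lborel_prod)
  also have "\<dots> = (\<integral>\<^sup>+x. c * \<integral>\<^sup>+y. f (S x, y) \<partial>lborel \<partial>lborel)"
    by (intro nn_integral_cong mfac_nn_integral[OF g sec])
  also have "\<dots> = c * (\<integral>\<^sup>+x. \<integral>\<^sup>+y. f (S x, y) \<partial>lborel \<partial>lborel)"
    using measurable_compose[OF mfac_measurable[OF S] meas] by (intro nn_integral_cmult) simp
  also have "(\<integral>\<^sup>+x. \<integral>\<^sup>+y. f (S x, y) \<partial>lborel \<partial>lborel) = d * (\<integral>\<^sup>+x. \<integral>\<^sup>+y. f (x, y) \<partial>lborel \<partial>lborel)"
    by (rule mfac_nn_integral[OF S meas])
  also have "(\<integral>\<^sup>+x. \<integral>\<^sup>+y. f (x, y) \<partial>lborel \<partial>lborel) = (\<integral>\<^sup>+p. f p \<partial>lborel)"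
    using lborel.nn_integral_fst[OF fl] by (simp add: lborel_prod)
  finally show "(\<integral>\<^sup>+p. f (?T p) \<partial>lborel) = c * d * (\<integral>\<^sup>+p. f p \<partial>lborel)" by (simp add: mult.assoc)
qed

text \<open>Left translation is triangular when the coordinates are read from last to first: z1, z2
  are transformed affinely, and y1, y2 are in addition sheared by them. The factors exp(tau) and
  exp(-tau) cancel in pairs.\<close>

lemma mfac_gmul_left: "mfac (gmul \<gamma>) 1"
proof -
  obtain \<tau> \<xi> \<eta>1 \<eta>2 \<zeta>1 \<zeta>2 where \<gamma>: "\<gamma> = (\<tau>,\<xi>,\<eta>1,\<eta>2,\<zeta>1,\<zeta>2)" by (metis prod_cases6)
  let ?e = "ennreal (1 / \<bar>exp \<tau>\<bar>)" and ?f = "ennreal (1 / \<bar>exp (- \<tau>)\<bar>)" and ?o = "ennreal (1 / \<bar>1\<bar>)"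
  have m5: "mfac (\<lambda>p. (exp \<tau> * fst p + \<zeta>1, exp (-\<tau>) * snd p + \<zeta>2)) (?e * ?f)"
    by (rule mfac_fst_dependent[where g="\<lambda>_ y. exp \<tau> * y + \<zeta>1"]) (intro mfac_affine continuous_intros; simp)+
  have m4: "mfac (\<lambda>p. (exp (-\<tau>) * fst p + (\<xi> * snd (snd p) * exp (-\<tau>) + \<eta>2),
      (exp \<tau> * fst (snd p) + \<zeta>1, exp (-\<tau>) * snd (snd p) + \<zeta>2))) (?f * (?e * ?f))"
    by (rule mfac_fst_dependent[where g="\<lambda>r y. exp (-\<tau>) * y + (\<xi> * snd r * exp (-\<tau>) + \<eta>2)", OF m5])
      (intro mfac_affine continuous_intros; simp)+
  have m3: "mfac (\<lambda>p. (exp \<tau> * fst p + (\<xi> * fst (snd (snd p)) * exp \<tau> + \<eta>1),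
     (exp (-\<tau>) * fst (snd p) + (\<xi> * snd (snd (snd p)) * exp (-\<tau>) + \<eta>2),
      (exp \<tau> * fst (snd (snd p)) + \<zeta>1, exp (-\<tau>) * snd (snd (snd p)) + \<zeta>2)))) (?e * (?f * (?e * ?f)))"
    by (rule mfac_fst_dependent[where g="\<lambda>r y. exp \<tau> * y + (\<xi> * fst (snd r) * exp \<tau> + \<eta>1)", OF m4])
      (intro mfac_affine continuous_intros; simp)+
  have m2: "mfac (\<lambda>p. (1 * fst p + \<xi>, (exp \<tau> * fst (snd p) + (\<xi> * fst (snd (snd (snd p))) * exp \<tau> + \<eta>1),
     (exp (-\<tau>) * fst (snd (snd p)) + (\<xi> * snd (snd (snd (snd p))) * exp (-\<tau>) + \<eta>2),
      (exp \<tau> * fst (snd (snd (snd p))) + \<zeta>1, exp (-\<tau>) * snd (snd (snd (snd p))) + \<zeta>2))))) (?o * (?e * (?f * (?e * ?f))))"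
    by (rule mfac_fst_dependent[where g="\<lambda>_ y. 1 * y + \<xi>", OF m3])
      (intro mfac_affine continuous_intros; simp)+
  have m1: "mfac (\<lambda>p. (1 * fst p + \<tau>, (1 * fst (snd p) + \<xi>, (exp \<tau> * fst (snd (snd p)) + (\<xi> * fst (snd (snd (snd (snd p)))) * exp \<tau> + \<eta>1),
     (exp (-\<tau>) * fst (snd (snd (snd p))) + (\<xi> * snd (snd (snd (snd (snd p)))) * exp (-\<tau>) + \<eta>2),
      (exp \<tau> * fst (snd (snd (snd (snd p)))) + \<zeta>1, exp (-\<tau>) * snd (snd (snd (snd (snd p)))) + \<zeta>2))))))
       (?o * (?o * (?e * (?f * (?e * ?f)))))"
    by (rule mfac_fst_dependent[where g="\<lambda>_ y. 1 * y + \<tau>", OF m2])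
      (intro mfac_affine continuous_intros; simp)+
  have "?o * (?o * (?e * (?f * (?e * ?f)))) = 1"
    by (simp add: exp_minus flip: ennreal_mult)
  moreover have "gmul \<gamma> = (\<lambda>p. (1 * fst p + \<tau>, (1 * fst (snd p) + \<xi>, (exp \<tau> * fst (snd (snd p)) + (\<xi> * fst (snd (snd (snd (snd p)))) * exp \<tau> + \<eta>1),
     (exp (-\<tau>) * fst (snd (snd (snd p))) + (\<xi> * snd (snd (snd (snd (snd p)))) * exp (-\<tau>) + \<eta>2),
      (exp \<tau> * fst (snd (snd (snd (snd p)))) + \<zeta>1, exp (-\<tau>) * snd (snd (snd (snd (snd p)))) + \<zeta>2))))))"
    by (rule HOL.ext) (simp add: gmul_def \<gamma> case_prod_unfold mult_ac)
  ultimately show ?thesis using m1 by simp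
qed

text \<open>Here the dependence runs the other way: for given t and x the last four coordinates are
  merely translated, so no Jacobian arises. Together with left-invariance this makes G
  unimodular.\<close>

lemma mfac_gmul_right: "mfac (\<lambda>p. gmul p g) 1"
proof -
  obtain \<tau> \<xi> \<eta>1 \<eta>2 \<zeta>1 \<zeta>2 where g: "g = (\<tau>,\<xi>,\<eta>1,\<eta>2,\<zeta>1,\<zeta>2)" by (metis prod_cases6)
  let ?h = "\<lambda>t x. (\<eta>1 * exp t + x * \<zeta>1 * exp t, \<eta>2 * exp (-t) + x * \<zeta>2 * exp (-t), \<zeta>1 * exp t, \<zeta>2 * exp (-t))"
  have m: "mfac (\<lambda>p::real \<times> real \<times> real \<times> real \<times> real. (fst p + \<xi>, snd p + ?h t (fst p))) (1 * 1)" for t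
    by (rule mfac_snd_dependent[where g="\<lambda>x w. w + ?h t x"]) (intro mfac_translation continuous_intros)+
  have "mfac (\<lambda>p::pt. (fst p + \<tau>, (fst (snd p) + \<xi>, snd (snd p) + ?h (fst p) (fst (snd p))))) (1 * 1 * 1)"
    by (rule mfac_snd_dependent[where g="\<lambda>t r. (fst r + \<xi>, snd r + ?h t (fst r))"])
      (intro mfac_translation continuous_intros m)+
  moreover have "(\<lambda>p. gmul p g) = (\<lambda>p::pt. (fst p + \<tau>, (fst (snd p) + \<xi>, snd (snd p) + ?h (fst p) (fst (snd p)))))"
    by (rule HOL.ext) (simp add: gmul_def g case_prod_unfold prod_eq_iff)
  ultimately show ?thesis by simp
qed

lemma gmul_right_continuous: "continuous_on UNIV (\<lambda>p. gmul p g)"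
  using mfac_gmul_right[of g] by (simp add: mfac_def)

definition gin :: "pt \<Rightarrow> pt" where
  "gin p = (case p of (t,x,y1,y2,z1,z2) \<Rightarrow>
     (-t, -x, exp (-t) * (x * z1 - y1), exp t * (x * z2 - y2), - exp (-t) * z1, - exp t * z2))"

lemma gmul_gin: "gmul (gin g) g = 0" "gmul g (gin g) = 0"
  by (cases g; simp add: gmul_def gin_def zero_prod_def algebra_simps flip: exp_add)+

lemma zero_gmul: "gmul 0 p = p"
  by (cases p) (simp add: gmul_def zero_prod_def)

lemma gmul_cancel: "gmul (gin g) (gmul g p) = p" "gmul g (gmul (gin g) p) = p"
  "gmul (gmul p g) (gin g) = p" "gmul (gmul p (gin g)) g = p"
  by (simp_all add: gmul_gin zero_gmul gmul_0 flip: gmul_assoc) (simp_all add: gmul_assoc gmul_gin gmul_0)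

lemma gin_gin: "gin (gin g) = g"
  using gmul_cancel(1)[of "gin g" g] by (simp add: gmul_gin gmul_0)

lemma countable_Gam: "countable (Gam a0 P)"
proof -
  have "Gam a0 P \<subseteq> range (\<lambda>(k::int,n::int,m1::int,m2::int,n1::int,n2::int).
     (a0 * of_int k, of_int n, P$1$1 * of_int m1 + P$1$2 * of_int m2, P$2$1 * of_int m1 + P$2$2 * of_int m2,
      P$1$1 * of_int n1 + P$1$2 * of_int n2, P$2$1 * of_int n1 + P$2$2 * of_int n2))"
  proof
    fix p assume p: "p \<in> Gam a0 P"
    obtain t x y1 y2 z1 z2 where pe: "p = (t,x,y1,y2,z1,z2)" by (metis prod_cases6)
    obtain k n m1 m2 n1 n2 :: int where
      "t = a0 * of_int k" "x = of_int n" "y1 = P$1$1 * of_int m1 + P$1$2 * of_int m2" "y2 = P$2$1 * of_int m1 + P$2$2 * of_int m2"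
      "z1 = P$1$1 * of_int n1 + P$1$2 * of_int n2" "z2 = P$2$1 * of_int n1 + P$2$2 * of_int n2"
      using p unfolding pe Gam_def mem_Collect_eq prod.case by blast
    then show "p \<in> range (\<lambda>(k::int,n::int,m1::int,m2::int,n1::int,n2::int).
     (a0 * of_int k, of_int n, P$1$1 * of_int m1 + P$1$2 * of_int m2, P$2$1 * of_int m1 + P$2$2 * of_int m2,
      P$1$1 * of_int n1 + P$1$2 * of_int n2, P$2$1 * of_int n1 + P$2$2 * of_int n2))"
      unfolding pe by (intro rev_image_eqI[of "(k,n,m1,m2,n1,n2)"]) auto
  qed
  then show ?thesis by (rule countable_subset) auto
qed

section \<open>The lattice\<close>

lemma matrix_inv_left':
  assumes "invertible (A :: real^'n^'n)"
  shows "matrix_inv A ** A = Finite_Cartesian_Product.mat 1"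
  using assms unfolding invertible_def matrix_inv_def by (rule someI2_ex) auto

locale lattice_data =
  fixes a0 :: real and P :: "real^2^2" and B :: "int^2^2"
  assumes a0: "a0 > 0" and detB: "det B = 1" and invP: "invertible P"
    and conj_eq: "P ** (\<chi> i j. real_of_int (B$i$j)) ** matrix_inv P
           = (\<chi> i j. if i = j then (if i = 1 then exp a0 else exp (- a0)) else 0)"
begin

definition Lat :: "real \<Rightarrow> real \<Rightarrow> bool" where
  "Lat y1 y2 \<longleftrightarrow> (\<exists>m1 m2::int. y1 = P$1$1 * of_int m1 + P$1$2 * of_int m2 \<and> y2 = P$2$1 * of_int m1 + P$2$2 * of_int m2)"

lemma Gam_iff: "(t,x,y1,y2,z1,z2) \<in> Gam a0 P \<longleftrightarrow>
  (\<exists>k::int. t = a0 * of_int k) \<and> (\<exists>n::int. x = of_int n) \<and> Lat y1 y2 \<and> Lat z1 z2"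
  by (simp add: Gam_def Lat_def)

text \<open>The conjugacy hypothesis as P B = D P, entry by entry, where D = diag(exp a0, exp
  (-a0)).\<close>

lemma PB:
  "P$1$1 * of_int (B$1$1) + P$1$2 * of_int (B$2$1) = exp a0 * P$1$1"
  "P$1$1 * of_int (B$1$2) + P$1$2 * of_int (B$2$2) = exp a0 * P$1$2"
  "P$2$1 * of_int (B$1$1) + P$2$2 * of_int (B$2$1) = exp (-a0) * P$2$1"
  "P$2$1 * of_int (B$1$2) + P$2$2 * of_int (B$2$2) = exp (-a0) * P$2$2"
proof -
  let ?B = "(\<chi> i j. real_of_int (B$i$j)) :: real^2^2"
  let ?D = "(\<chi> i j. if i = j then (if i = 1 then exp a0 else exp (- a0)) else 0) :: real^2^2"
  have "P ** ?B = P ** ?B ** matrix_inv P ** P"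
    using matrix_inv_left'[OF invP] by (metis matrix_mul_assoc matrix_mul_rid)
  then have "(P ** ?B) $ i $ j = (?D ** P) $ i $ j" for i j using conj_eq by simp
  from this[of 1 1] this[of 1 2] this[of 2 1] this[of 2 2]
  show
  "P$1$1 * of_int (B$1$1) + P$1$2 * of_int (B$2$1) = exp a0 * P$1$1"
  "P$1$1 * of_int (B$1$2) + P$1$2 * of_int (B$2$2) = exp a0 * P$1$2"
  "P$2$1 * of_int (B$1$1) + P$2$2 * of_int (B$2$1) = exp (-a0) * P$2$1"
  "P$2$1 * of_int (B$1$2) + P$2$2 * of_int (B$2$2) = exp (-a0) * P$2$2"
    by (simp_all add: matrix_matrix_mult_def sum_2)
qed

lemma detB': "B$1$1 * B$2$2 - B$1$2 * B$2$1 = 1"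
  using detB by (simp add: det_2)

lemma Lat_comb: "Lat y1 y2 \<Longrightarrow> Lat z1 z2 \<Longrightarrow> Lat (of_int n * y1 + of_int m * z1) (of_int n * y2 + of_int m * z2)"
proof -
  assume "Lat y1 y2" "Lat z1 z2"
  then obtain m1 m2 n1 n2 where
    e: "y1 = P$1$1 * of_int m1 + P$1$2 * of_int m2" "y2 = P$2$1 * of_int m1 + P$2$2 * of_int m2"
    "z1 = P$1$1 * of_int n1 + P$1$2 * of_int n2" "z2 = P$2$1 * of_int n1 + P$2$2 * of_int n2"
    unfolding Lat_def by auto
  show ?thesis unfolding Lat_def
    by (rule exI[of _ "n * m1 + m * n1"], rule exI[of _ "n * m2 + m * n2"]) (simp add: e algebra_simps)
qed

text \<open>D P m = P (B m), and B m is again integral.\<close>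

lemma Lat_exp: "Lat y1 y2 \<Longrightarrow> Lat (exp a0 * y1) (exp (-a0) * y2)"
proof -
  assume "Lat y1 y2"
  then obtain m1 m2 where
    e: "y1 = P$1$1 * of_int m1 + P$1$2 * of_int m2" "y2 = P$2$1 * of_int m1 + P$2$2 * of_int m2"
    unfolding Lat_def by auto
  have "exp a0 * y1 = (exp a0 * P$1$1) * of_int m1 + (exp a0 * P$1$2) * of_int m2"
    "exp (-a0) * y2 = (exp (-a0) * P$2$1) * of_int m1 + (exp (-a0) * P$2$2) * of_int m2"
    by (simp_all add: e algebra_simps)
  then show ?thesis unfolding Lat_def PB[symmetric]
    by (intro exI[of _ "B$1$1 * m1 + B$1$2 * m2"] exI[of _ "B$2$1 * m1 + B$2$2 * m2"]) (simp add: algebra_simps)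
qed

lemma Lat_exp_inv: "Lat y1 y2 \<Longrightarrow> Lat (exp (-a0) * y1) (exp a0 * y2)"
proof -
  assume "Lat y1 y2"
  then obtain m1 m2 where
    e: "y1 = P$1$1 * of_int m1 + P$1$2 * of_int m2" "y2 = P$2$1 * of_int m1 + P$2$2 * of_int m2"
    unfolding Lat_def by auto
  \<comment> \<open>The adjugate of \<open>B\<close>, which is its inverse because its determinant
    is 1, applied to (m1, m2).\<close>
  define n1 n2 where n: "n1 = B$2$2 * m1 - B$1$2 * m2" "n2 = - B$2$1 * m1 + B$1$1 * m2"
  have i: "B$1$1 * n1 + B$1$2 * n2 = (B$1$1 * B$2$2 - B$1$2 * B$2$1) * m1"
    "B$2$1 * n1 + B$2$2 * n2 = (B$1$1 * B$2$2 - B$1$2 * B$2$1) * m2"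
    unfolding n by (simp_all add: algebra_simps)
  then have m: "m1 = B$1$1 * n1 + B$1$2 * n2" "m2 = B$2$1 * n1 + B$2$2 * n2" by (simp_all add: detB')
  have "y1 = exp a0 * (P$1$1 * of_int n1 + P$1$2 * of_int n2)"
  proof -
    have "exp a0 * (P$1$1 * of_int n1 + P$1$2 * of_int n2) = (exp a0 * P$1$1) * of_int n1 + (exp a0 * P$1$2) * of_int n2"
      by (simp add: algebra_simps)
    then show ?thesis unfolding PB[symmetric] by (simp add: e m algebra_simps)
  qed
  moreover have "y2 = exp (-a0) * (P$2$1 * of_int n1 + P$2$2 * of_int n2)"
  proof -
    have "exp (-a0) * (P$2$1 * of_int n1 + P$2$2 * of_int n2) = (exp (-a0) * P$2$1) * of_int n1 + (exp (-a0) * P$2$2) * of_int n2"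
      by (simp add: algebra_simps)
    then show ?thesis unfolding PB[symmetric] by (simp add: e m algebra_simps)
  qed
  ultimately show ?thesis unfolding Lat_def
    by (intro exI[of _ n1] exI[of _ n2]) (simp flip: exp_add mult.assoc)
qed

lemma Lat_exp_int: "Lat y1 y2 \<Longrightarrow> Lat (exp (a0 * of_int k) * y1) (exp (- (a0 * of_int k)) * y2)"
proof (induction k rule: int_induct[where k=0])
  case base
  then show ?case by simp
next
  case (step1 i)
  have "Lat (exp a0 * (exp (a0 * of_int i) * y1)) (exp (-a0) * (exp (- (a0 * of_int i)) * y2))"
    using step1 by (intro Lat_exp) auto
  then show ?case by (simp add: algebra_simps flip: exp_add mult.assoc)
next
  case (step2 i)
  have "Lat (exp (-a0) * (exp (a0 * of_int i) * y1)) (exp a0 * (exp (- (a0 * of_int i)) * y2))"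
    using step2 by (intro Lat_exp_inv) auto
  then show ?case by (simp add: algebra_simps flip: exp_add mult.assoc)
qed

text \<open>Closure under inverses permits relabelling the sum over the lattice when two fundamental
  domains are compared. Each component of the inverse is an integral combination of lattice vectors
  followed by a power of the dilation.\<close>

lemma gin_Gam: "\<gamma> \<in> Gam a0 P \<Longrightarrow> gin \<gamma> \<in> Gam a0 P"
proof -
  assume g: "\<gamma> \<in> Gam a0 P"
  obtain t x y1 y2 z1 z2 where \<gamma>: "\<gamma> = (t,x,y1,y2,z1,z2)" by (metis prod_cases6)
  obtain k n where t: "t = a0 * of_int k" and x: "x = of_int n" and L: "Lat y1 y2" "Lat z1 z2"
    using g unfolding \<gamma> Gam_iff by auto
  have "Lat (exp (a0 * of_int (-k)) * (of_int n * z1 + of_int (-1) * y1)) (exp (- (a0 * of_int (-k))) * (of_int n * z2 + of_int (-1) * y2))"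
    by (intro Lat_exp_int Lat_comb L)
  then have 1: "Lat (exp (-t) * (x * z1 - y1)) (exp t * (x * z2 - y2))" by (simp add: t x)
  have "Lat (exp (a0 * of_int (-k)) * (of_int (-1) * z1 + of_int 0 * y1)) (exp (- (a0 * of_int (-k))) * (of_int (-1) * z2 + of_int 0 * y2))"
    by (intro Lat_exp_int Lat_comb L)
  then have 2: "Lat (- exp (-t) * z1) (- exp t * z2)" by (simp add: t)
  show ?thesis unfolding \<gamma> gin_def prod.case Gam_iff using 1 2
    by (auto simp: t x intro: exI[of _ "-k"] exI[of _ "-n"])
qed

text \<open>The inverse of P spelled out as two linear coordinate functions, in which lattice
  vectors have integral coordinates.\<close>

lemma Lat_fundamental:
  obtains Q11 Q12 Q21 Q22 where
    "\<And>u1 u2. Q11 * (P$1$1 * u1 + P$1$2 * u2) + Q12 * (P$2$1 * u1 + P$2$2 * u2) = u1"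
    "\<And>u1 u2. Q21 * (P$1$1 * u1 + P$1$2 * u2) + Q22 * (P$2$1 * u1 + P$2$2 * u2) = u2"
    "\<And>y1 y2. P$1$1 * (Q11 * y1 + Q12 * y2) + P$1$2 * (Q21 * y1 + Q22 * y2) = y1"
    "\<And>y1 y2. P$2$1 * (Q11 * y1 + Q12 * y2) + P$2$2 * (Q21 * y1 + Q22 * y2) = y2"
proof -
  obtain Q where Q: "P ** Q = mat 1" "Q ** P = mat 1" using invP unfolding invertible_def by auto
  have q: "(P ** Q) $ i $ j = (if i = j then 1 else 0)" "(Q ** P) $ i $ j = (if i = j then 1 else 0)" for i j
    using Q by (simp_all add: Finite_Cartesian_Product.mat_def)
  have e: "Q$1$1 * P$1$1 + Q$1$2 * P$2$1 = 1" "Q$1$1 * P$1$2 + Q$1$2 * P$2$2 = 0"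
    "Q$2$1 * P$1$1 + Q$2$2 * P$2$1 = 0" "Q$2$1 * P$1$2 + Q$2$2 * P$2$2 = 1"
    "P$1$1 * Q$1$1 + P$1$2 * Q$2$1 = 1" "P$1$1 * Q$1$2 + P$1$2 * Q$2$2 = 0"
    "P$2$1 * Q$1$1 + P$2$2 * Q$2$1 = 0" "P$2$1 * Q$1$2 + P$2$2 * Q$2$2 = 1"
    using q[of 1 1] q[of 1 2] q[of 2 1] q[of 2 2] by (simp_all add: matrix_matrix_mult_def sum_2)
  show ?thesis
  proof (rule that[of "Q$1$1" "Q$1$2" "Q$2$1" "Q$2$2"])
    fix u1 u2
    have "Q$1$1 * (P$1$1 * u1 + P$1$2 * u2) + Q$1$2 * (P$2$1 * u1 + P$2$2 * u2)
      = (Q$1$1 * P$1$1 + Q$1$2 * P$2$1) * u1 + (Q$1$1 * P$1$2 + Q$1$2 * P$2$2) * u2" by (simp add: algebra_simps)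
    then show "Q$1$1 * (P$1$1 * u1 + P$1$2 * u2) + Q$1$2 * (P$2$1 * u1 + P$2$2 * u2) = u1" by (simp add: e)
    have "Q$2$1 * (P$1$1 * u1 + P$1$2 * u2) + Q$2$2 * (P$2$1 * u1 + P$2$2 * u2)
      = (Q$2$1 * P$1$1 + Q$2$2 * P$2$1) * u1 + (Q$2$1 * P$1$2 + Q$2$2 * P$2$2) * u2" by (simp add: algebra_simps)
    then show "Q$2$1 * (P$1$1 * u1 + P$1$2 * u2) + Q$2$2 * (P$2$1 * u1 + P$2$2 * u2) = u2" by (simp add: e)
    have "P$1$1 * (Q$1$1 * u1 + Q$1$2 * u2) + P$1$2 * (Q$2$1 * u1 + Q$2$2 * u2)
      = (P$1$1 * Q$1$1 + P$1$2 * Q$2$1) * u1 + (P$1$1 * Q$1$2 + P$1$2 * Q$2$2) * u2" by (simp add: algebra_simps)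
    then show "P$1$1 * (Q$1$1 * u1 + Q$1$2 * u2) + P$1$2 * (Q$2$1 * u1 + Q$2$2 * u2) = u1" by (simp add: e)
    have "P$2$1 * (Q$1$1 * u1 + Q$1$2 * u2) + P$2$2 * (Q$2$1 * u1 + Q$2$2 * u2)
      = (P$2$1 * Q$1$1 + P$2$2 * Q$2$1) * u1 + (P$2$1 * Q$1$2 + P$2$2 * Q$2$2) * u2" by (simp add: algebra_simps)
    then show "P$2$1 * (Q$1$1 * u1 + Q$1$2 * u2) + P$2$2 * (Q$2$1 * u1 + Q$2$2 * u2) = u2" by (simp add: e)
  qed
qed

section \<open>Fundamental domains\<close>

definition FD :: "pt set \<Rightarrow> bool" where
  "FD F \<longleftrightarrow> F \<in> sets lborel \<and> (\<forall>p. \<exists>!\<gamma>. \<gamma> \<in> Gam a0 P \<and> gmul \<gamma> p \<in> F)"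

lemma unique_int_shift: "\<exists>!k::int. 0 \<le> u + of_int k \<and> u + of_int k < (1::real)"
proof (rule ex1I[of _ "- \<lfloor>u\<rfloor>"])
  show "0 \<le> u + of_int (- \<lfloor>u\<rfloor>) \<and> u + of_int (- \<lfloor>u\<rfloor>) < 1" by simp linarith
  fix k :: int assume "0 \<le> u + of_int k \<and> u + of_int k < 1"
  then have "\<lfloor>u\<rfloor> = - k" by (intro floor_unique) auto
  then show "k = - \<lfloor>u\<rfloor>" by simp
qed

text \<open>The components of gamma are determined in turn: k brings t into [0, a0) and n brings x
  into [0, 1). These fix the dilation and the shear, and then the translations in z and in y are
  each determined modulo a planar lattice.\<close>

lemma exists_bounded_FD: "\<exists>F. FD F \<and> bounded F"
proof -
  obtain Q11 Q12 Q21 Q22 where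
    Q1: "\<And>u1 u2. Q11 * (P$1$1 * u1 + P$1$2 * u2) + Q12 * (P$2$1 * u1 + P$2$2 * u2) = u1" and
    Q2: "\<And>u1 u2. Q21 * (P$1$1 * u1 + P$1$2 * u2) + Q22 * (P$2$1 * u1 + P$2$2 * u2) = u2" and
    Q3: "\<And>y1 y2. P$1$1 * (Q11 * y1 + Q12 * y2) + P$1$2 * (Q21 * y1 + Q22 * y2) = y1" and
    Q4: "\<And>y1 y2. P$2$1 * (Q11 * y1 + Q12 * y2) + P$2$2 * (Q21 * y1 + Q22 * y2) = y2"
    using Lat_fundamental by metis
  \<comment> \<open>The image under \<open>P\<close> of the half-open unit square.\<close>
  define cell where "cell y1 y2 \<longleftrightarrow> 0 \<le> Q11 * y1 + Q12 * y2 \<and> Q11 * y1 + Q12 * y2 < 1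
     \<and> 0 \<le> Q21 * y1 + Q22 * y2 \<and> Q21 * y1 + Q22 * y2 < 1" for y1 y2 :: real
  define F where "F = {p :: pt. 0 \<le> fst p \<and> fst p < a0 \<and> 0 \<le> fst (snd p) \<and> fst (snd p) < 1 \<and>
     cell (fst (snd (snd p))) (fst (snd (snd (snd p)))) \<and> cell (fst (snd (snd (snd (snd p))))) (snd (snd (snd (snd (snd p)))))}"
  have "F \<in> sets borel" unfolding F_def cell_def
    unfolding Collect_conj_eq
    by (intro sets.Int borel_closed[OF closed_Collect_le] borel_open[OF open_Collect_less] continuous_intros)
  have uniq: "\<exists>\<eta>1 \<eta>2. Lat \<eta>1 \<eta>2 \<and> cell (y1 + \<eta>1) (y2 + \<eta>2) \<and>
      (\<forall>u1 u2. Lat u1 u2 \<longrightarrow> cell (y1 + u1) (y2 + u2) \<longrightarrow> u1 = \<eta>1 \<and> u2 = \<eta>2)" for y1 y2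
  proof -
    obtain m1 where m1: "0 \<le> Q11 * y1 + Q12 * y2 + of_int m1" "Q11 * y1 + Q12 * y2 + of_int m1 < 1"
      and m1u: "\<And>m. 0 \<le> Q11 * y1 + Q12 * y2 + of_int m \<Longrightarrow> Q11 * y1 + Q12 * y2 + of_int m < 1 \<Longrightarrow> m = m1"
      using unique_int_shift[of "Q11 * y1 + Q12 * y2"] by auto
    obtain m2 where m2: "0 \<le> Q21 * y1 + Q22 * y2 + of_int m2" "Q21 * y1 + Q22 * y2 + of_int m2 < 1"
      and m2u: "\<And>m. 0 \<le> Q21 * y1 + Q22 * y2 + of_int m \<Longrightarrow> Q21 * y1 + Q22 * y2 + of_int m < 1 \<Longrightarrow> m = m2"
      using unique_int_shift[of "Q21 * y1 + Q22 * y2"] by auto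
    have q: "Q11 * (y1 + (P$1$1 * u1 + P$1$2 * u2)) + Q12 * (y2 + (P$2$1 * u1 + P$2$2 * u2)) = Q11 * y1 + Q12 * y2 + u1"
      "Q21 * (y1 + (P$1$1 * u1 + P$1$2 * u2)) + Q22 * (y2 + (P$2$1 * u1 + P$2$2 * u2)) = Q21 * y1 + Q22 * y2 + u2" for u1 u2
      using Q1[of u1 u2] Q2[of u1 u2] by (simp_all add: algebra_simps)
    let ?e1 = "P$1$1 * of_int m1 + P$1$2 * of_int m2" and ?e2 = "P$2$1 * of_int m1 + P$2$2 * of_int m2"
    show ?thesis
    proof (intro exI conjI allI impI)
      show "Lat ?e1 ?e2" by (auto simp: Lat_def)
      show "cell (y1 + ?e1) (y2 + ?e2)" unfolding cell_def q using m1 m2 by auto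
      fix u1 u2 assume L: "Lat u1 u2" and c: "cell (y1 + u1) (y2 + u2)"
      obtain n1 n2 :: int where
        n: "u1 = P$1$1 * of_int n1 + P$1$2 * of_int n2" "u2 = P$2$1 * of_int n1 + P$2$2 * of_int n2"
        using L unfolding Lat_def by blast
      have "n1 = m1" "n2 = m2" using c unfolding n cell_def q by (auto intro: m1u m2u)
      then show "u1 = ?e1" "u2 = ?e2" using n by simp_all
    qed
  qed
  have "FD F" unfolding FD_def
  proof (intro conjI allI)
    show "F \<in> sets lborel" using \<open>F \<in> sets borel\<close> by simp
    fix p :: pt
    obtain t x y1 y2 z1 z2 where p: "p = (t,x,y1,y2,z1,z2)" by (metis prod_cases6)
    have tt: "0 \<le> a0 * of_int k + t \<and> a0 * of_int k + t < a0 \<longleftrightarrow> 0 \<le> t / a0 + of_int k \<and> t / a0 + of_int k < 1" for k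
      using a0 by (simp add: field_simps)
    obtain k where k: "0 \<le> a0 * of_int k + t" "a0 * of_int k + t < a0"
      and ku: "\<And>m. 0 \<le> a0 * of_int m + t \<Longrightarrow> a0 * of_int m + t < a0 \<Longrightarrow> m = k"
      using unique_int_shift[of "t / a0"] unfolding tt[symmetric] by auto
    obtain n where n: "0 \<le> x + of_int n" "x + of_int n < 1"
      and nu: "\<And>m. 0 \<le> x + of_int m \<Longrightarrow> x + of_int m < 1 \<Longrightarrow> m = n"
      using unique_int_shift[of x] by auto
    let ?\<tau> = "a0 * of_int k" and ?\<xi> = "of_int n :: real"
    obtain \<zeta>1 \<zeta>2 where \<zeta>: "Lat \<zeta>1 \<zeta>2" "cell (z1 * exp ?\<tau> + \<zeta>1) (z2 * exp (- ?\<tau>) + \<zeta>2)"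
      and \<zeta>u: "\<And>u1 u2. Lat u1 u2 \<Longrightarrow> cell (z1 * exp ?\<tau> + u1) (z2 * exp (- ?\<tau>) + u2) \<Longrightarrow> u1 = \<zeta>1 \<and> u2 = \<zeta>2"
      using uniq[of "z1 * exp ?\<tau>" "z2 * exp (- ?\<tau>)"] by blast
    \<comment> \<open>The y-part of gamma p before translation by eta; gamma enters it only through
      \<open>k\<close> and \<open>n\<close>.\<close>
    let ?u1 = "y1 * exp ?\<tau> + ?\<xi> * z1 * exp ?\<tau>" and ?u2 = "y2 * exp (- ?\<tau>) + ?\<xi> * z2 * exp (- ?\<tau>)"
    obtain \<eta>1 \<eta>2 where \<eta>: "Lat \<eta>1 \<eta>2" "cell (?u1 + \<eta>1) (?u2 + \<eta>2)"
      and \<eta>u: "\<And>u1 u2. Lat u1 u2 \<Longrightarrow> cell (?u1 + u1) (?u2 + u2) \<Longrightarrow> u1 = \<eta>1 \<and> u2 = \<eta>2"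
      using uniq[of ?u1 ?u2] by blast
    show "\<exists>!\<gamma>. \<gamma> \<in> Gam a0 P \<and> gmul \<gamma> p \<in> F"
    proof (rule ex1I[of _ "(?\<tau>, ?\<xi>, \<eta>1, \<eta>2, \<zeta>1, \<zeta>2)"])
      show "(?\<tau>, ?\<xi>, \<eta>1, \<eta>2, \<zeta>1, \<zeta>2) \<in> Gam a0 P \<and> gmul (?\<tau>, ?\<xi>, \<eta>1, \<eta>2, \<zeta>1, \<zeta>2) p \<in> F"
        unfolding Gam_iff using k n \<zeta> \<eta> by (auto simp: F_def p gmul_def add_ac)
    next
      fix \<gamma> assume g: "\<gamma> \<in> Gam a0 P \<and> gmul \<gamma> p \<in> F"
      obtain \<tau>' \<xi>' \<eta>1' \<eta>2' \<zeta>1' \<zeta>2' where \<gamma>: "\<gamma> = (\<tau>',\<xi>',\<eta>1',\<eta>2',\<zeta>1',\<zeta>2')" by (metis prod_cases6)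
      obtain k' n' :: int where k': "\<tau>' = a0 * of_int k'" "\<xi>' = of_int n'" and L: "Lat \<eta>1' \<eta>2'" "Lat \<zeta>1' \<zeta>2'"
        using g unfolding \<gamma> Gam_iff by auto
      have gF: "0 \<le> \<tau>' + t" "\<tau>' + t < a0" "0 \<le> \<xi>' + x" "\<xi>' + x < 1"
        "cell (y1 * exp \<tau>' + \<xi>' * z1 * exp \<tau>' + \<eta>1') (y2 * exp (- \<tau>') + \<xi>' * z2 * exp (- \<tau>') + \<eta>2')"
        "cell (z1 * exp \<tau>' + \<zeta>1') (z2 * exp (- \<tau>') + \<zeta>2')"
        using g by (auto simp: \<gamma> p gmul_def F_def)
      have "k' = k" "n' = n" using gF k' by (auto intro!: ku nu simp: add.commute)
      then have e: "\<tau>' = ?\<tau>" "\<xi>' = ?\<xi>" using k' by auto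
      show "\<gamma> = (?\<tau>, ?\<xi>, \<eta>1, \<eta>2, \<zeta>1, \<zeta>2)"
        using \<zeta>u[OF L(2)] \<eta>u[OF L(1)] gF unfolding \<gamma> e by auto
    qed
  qed
  moreover have "bounded F"
  proof -
    define K where "K = max a0 1 + \<bar>P$1$1\<bar> + \<bar>P$1$2\<bar> + \<bar>P$2$1\<bar> + \<bar>P$2$2\<bar>"
    have cell_bound: "\<bar>y1\<bar> \<le> K \<and> \<bar>y2\<bar> \<le> K" if "cell y1 y2" for y1 y2
    proof -
      let ?u1 = "Q11 * y1 + Q12 * y2" and ?u2 = "Q21 * y1 + Q22 * y2"
      have u: "\<bar>?u1\<bar> \<le> 1" "\<bar>?u2\<bar> \<le> 1" using that by (auto simp: cell_def)
      have m: "\<bar>r * u\<bar> \<le> \<bar>r\<bar>" if "\<bar>u\<bar> \<le> 1" for r u :: real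
        using mult_left_mono[OF that, of "\<bar>r\<bar>"] by (simp add: abs_mult)
      have "\<bar>y1\<bar> \<le> \<bar>P$1$1\<bar> + \<bar>P$1$2\<bar>" using Q3[of y1 y2] m[OF u(1), of "P$1$1"] m[OF u(2), of "P$1$2"] by linarith
      moreover have "\<bar>y2\<bar> \<le> \<bar>P$2$1\<bar> + \<bar>P$2$2\<bar>" using Q4[of y1 y2] m[OF u(1), of "P$2$1"] m[OF u(2), of "P$2$2"] by linarith
      ultimately show ?thesis unfolding K_def by linarith
    qed
    have K1: "a0 \<le> K" "1 \<le> K" unfolding K_def by linarith+
    have "F \<subseteq> cball 0 K \<times> cball 0 K \<times> cball 0 K \<times> cball 0 K \<times> cball 0 K \<times> cball 0 K"
    proof
      fix p assume p: "p \<in> F"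
      obtain t x y1 y2 z1 z2 where pe: "p = (t,x,y1,y2,z1,z2)" by (metis prod_cases6)
      show "p \<in> cball 0 K \<times> cball 0 K \<times> cball 0 K \<times> cball 0 K \<times> cball 0 K \<times> cball 0 K"
        using p cell_bound[of y1 y2] cell_bound[of z1 z2] K1 by (auto simp: pe F_def)
    qed
    moreover have "bounded (cball (0::real) K \<times> cball (0::real) K \<times> cball (0::real) K \<times> cball (0::real) K \<times> cball (0::real) K \<times> cball (0::real) K)"
      by (intro bounded_Times bounded_cball)
    ultimately show ?thesis using bounded_subset by blast
  qed
  ultimately show ?thesis by blast
qed

text \<open>Existence is what gives meaning to the choice in \<open>fund_dom\<close>. Nothing beyond
  \<open>FD\<close> is known about the chosen set; it may well be unbounded.\<close>

lemma FD_fund_dom: "FD (fund_dom a0 P)"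
proof -
  obtain F where "FD F" using exists_bounded_FD by blast
  then have "\<exists>F. F \<in> sets lborel \<and> (\<forall>p. \<exists>!\<gamma>. \<gamma> \<in> Gam a0 P \<and> gmul \<gamma> p \<in> F)" unfolding FD_def by blast
  from someI_ex[OF this] show ?thesis unfolding FD_def fund_dom_def .
qed

lemma FD_count:
  assumes "FD F"
  shows "(\<integral>\<^sup>+\<gamma>. indicator F (gmul \<gamma> p) \<partial>count_space (Gam a0 P)) = 1"
proof -
  obtain g where g: "g \<in> Gam a0 P" "gmul g p \<in> F" and u: "\<And>\<gamma>. \<gamma> \<in> Gam a0 P \<Longrightarrow> gmul \<gamma> p \<in> F \<Longrightarrow> \<gamma> = g"
    using assms unfolding FD_def by metis
  have "(\<integral>\<^sup>+\<gamma>. indicator F (gmul \<gamma> p) \<partial>count_space (Gam a0 P)) = (\<integral>\<^sup>+\<gamma>. indicator {g} \<gamma> \<partial>count_space (Gam a0 P))"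
    by (intro nn_integral_cong) (auto simp: indicator_def g dest: u)
  then show ?thesis using g by simp
qed

lemma bij_gin: "bij_betw gin (Gam a0 P) (Gam a0 P)"
  by (rule bij_betw_byWitness[of _ gin]) (auto simp: gin_gin gin_Gam)

text \<open>Unfolding: write 1 as the sum over gamma of the indicator of F' at gamma p, exchange sum
  and integral, translate each term by gamma, and replace gamma by its inverse. The outcome is the
  same expression with F and F' exchanged.\<close>

lemma nn_integral_FD_eq:
  assumes F: "FD F" "FD F'" and f: "f \<in> borel_measurable borel"
    and inv: "\<And>\<gamma> p. \<gamma> \<in> Gam a0 P \<Longrightarrow> f (gmul \<gamma> p) = f p"
  shows "(\<integral>\<^sup>+p. f p * indicator F p \<partial>lborel) = (\<integral>\<^sup>+p. f p * indicator F' p \<partial>lborel)"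
proof -
  have m: "F \<in> sets borel" "F' \<in> sets borel" using F by (auto simp: FD_def)
  have gm: "gmul \<gamma> \<in> borel_measurable borel" for \<gamma> using mfac_measurable[OF mfac_gmul_left] .
  have ind: "(\<lambda>p. indicator A (gmul \<gamma> p) :: ennreal) \<in> borel_measurable borel" if "A \<in> sets borel" for A \<gamma>
    using measurable_compose[OF gm borel_measurable_indicator[OF that]] .
  have step: "(\<integral>\<^sup>+p. f p * indicator A p \<partial>lborel)
      = (\<integral>\<^sup>+\<gamma>. \<integral>\<^sup>+p. f p * indicator A p * indicator A' (gmul \<gamma> p) \<partial>lborel \<partial>count_space (Gam a0 P))"
    if "FD A'" "A \<in> sets borel" "A' \<in> sets borel" for A A'
  proof -
    have "(\<integral>\<^sup>+p. f p * indicator A p \<partial>lborel)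
      = (\<integral>\<^sup>+p. (\<integral>\<^sup>+\<gamma>. f p * indicator A p * indicator A' (gmul \<gamma> p) \<partial>count_space (Gam a0 P)) \<partial>lborel)"
      by (simp add: nn_integral_cmult FD_count[OF that(1)])
    also have "\<dots> = (\<integral>\<^sup>+\<gamma>. \<integral>\<^sup>+p. f p * indicator A p * indicator A' (gmul \<gamma> p) \<partial>lborel \<partial>count_space (Gam a0 P))"
      using f ind[OF that(3)] that(2)
      by (intro nn_integral_count_space_nn_integral countable_Gam) (auto intro!: borel_measurable_times_ennreal)
    finally show ?thesis .
  qed
  have "(\<integral>\<^sup>+p. f p * indicator F p \<partial>lborel)
     = (\<integral>\<^sup>+\<gamma>. \<integral>\<^sup>+p. f p * indicator F p * indicator F' (gmul \<gamma> p) \<partial>lborel \<partial>count_space (Gam a0 P))"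
    by (rule step) (use F m in auto)
  also have "\<dots> = (\<integral>\<^sup>+\<gamma>. \<integral>\<^sup>+p. f p * indicator F' p * indicator F (gmul (gin \<gamma>) p) \<partial>lborel \<partial>count_space (Gam a0 P))"
  proof (rule nn_integral_cong)
    fix \<gamma> assume "\<gamma> \<in> space (count_space (Gam a0 P))"
    then have g: "\<gamma> \<in> Gam a0 P" by simp
    have "(\<lambda>p. f p * indicator F' p * indicator F (gmul (gin \<gamma>) p)) \<in> borel_measurable borel"
      using f m ind by (auto intro!: borel_measurable_times_ennreal)
    then have "(\<integral>\<^sup>+p. f (gmul \<gamma> p) * indicator F' (gmul \<gamma> p) * indicator F (gmul (gin \<gamma>) (gmul \<gamma> p)) \<partial>lborel)
      = (\<integral>\<^sup>+p. f p * indicator F' p * indicator F (gmul (gin \<gamma>) p) \<partial>lborel)"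
      using mfac_gmul_left[of \<gamma>] unfolding mfac_def by fastforce
    then show "(\<integral>\<^sup>+p. f p * indicator F p * indicator F' (gmul \<gamma> p) \<partial>lborel)
       = (\<integral>\<^sup>+p. f p * indicator F' p * indicator F (gmul (gin \<gamma>) p) \<partial>lborel)"
      by (simp add: gmul_cancel inv[OF g] mult_ac)
  qed
  also have "\<dots> = (\<integral>\<^sup>+\<gamma>. \<integral>\<^sup>+p. f p * indicator F' p * indicator F (gmul \<gamma> p) \<partial>lborel \<partial>count_space (Gam a0 P))"
    by (rule nn_integral_bij_count_space[OF bij_gin])
  also have "\<dots> = (\<integral>\<^sup>+p. f p * indicator F' p \<partial>lborel)"
    by (rule step[symmetric]) (use F m in auto)
  finally show ?thesis .
qed

end

section \<open>Integration over the quotient\<close>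

context lattice_data
begin

text \<open>Continuous functions on X. The codomain is left general so that real and imaginary parts
  are covered too.\<close>

definition CI :: "(pt \<Rightarrow> 'b::real_normed_vector) \<Rightarrow> bool" where
  "CI f \<longleftrightarrow> continuous_on UNIV f \<and> (\<forall>\<gamma>\<in>Gam a0 P. \<forall>p. f (gmul \<gamma> p) = f p)"

lemma SI_CI: "SI a0 P f \<Longrightarrow> CI f"
  by (simp add: SI_def CI_def smooth_continuous Gam_inv_def)

lemma CI_const: "CI (\<lambda>p. z)"
  by (simp add: CI_def)

lemma CI_add: "CI f \<Longrightarrow> CI g \<Longrightarrow> CI (\<lambda>p. f p + g p)"
  by (auto simp: CI_def intro!: continuous_intros)

lemma CI_diff: "CI f \<Longrightarrow> CI g \<Longrightarrow> CI (\<lambda>p. f p - g p)"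
  by (auto simp: CI_def intro!: continuous_intros)

lemma CI_mult: "CI f \<Longrightarrow> CI g \<Longrightarrow> CI (\<lambda>p. f p * g p :: complex)"
  by (auto simp: CI_def intro!: continuous_intros)

lemma CI_cnj: "CI f \<Longrightarrow> CI (\<lambda>p. cnj (f p))"
  by (auto simp: CI_def intro!: continuous_intros)

lemma CI_divide: "CI f \<Longrightarrow> CI (\<lambda>p. f p / z :: complex)"
  unfolding divide_inverse by (rule CI_mult[OF _ CI_const])

lemmas CI_intros = CI_const CI_add CI_diff CI_mult CI_cnj CI_divide

lemma CI_sum: "(\<And>a. a \<in> A \<Longrightarrow> CI (f a)) \<Longrightarrow> CI (\<lambda>p. \<Sum>a\<in>A. f a p :: complex)"
  by (auto simp: CI_def intro!: continuous_intros sum.cong)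

lemma CI_right: "CI f \<Longrightarrow> CI (\<lambda>p. f (gmul p g))"
  unfolding CI_def
  by (auto simp: gmul_assoc intro: continuous_on_compose2[OF _ gmul_right_continuous])

text \<open>The place where compactness of X enters: all values are already taken on the compact
  closure of a bounded fundamental domain.\<close>

lemma CI_bounded:
  assumes "CI f"
  obtains C where "\<And>p. norm (f p) \<le> C"
proof -
  obtain F where F: "FD F" "bounded F" using exists_bounded_FD by blast
  have "compact (closure F)" using F(2) by (simp add: compact_closure)
  moreover have "continuous_on (closure F) f" using assms continuous_on_subset unfolding CI_def by blast
  ultimately have "bounded (f ` closure F)" using compact_continuous_image compact_imp_bounded by blast
  then obtain C where C: "\<And>p. p \<in> closure F \<Longrightarrow> norm (f p) \<le> C" unfolding bounded_iff by auto
  have "norm (f p) \<le> C" for p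
  proof -
    obtain \<gamma> where "\<gamma> \<in> Gam a0 P" "gmul \<gamma> p \<in> F" using F(1) unfolding FD_def by blast
    then show ?thesis using C[of "gmul \<gamma> p"] closure_subset assms by (auto simp: CI_def)
  qed
  then show ?thesis using that by blast
qed

abbreviation FF :: "pt set" where "FF \<equiv> fund_dom a0 P"

lemma FF_sets: "FF \<in> sets lborel"
  using FD_fund_dom by (simp add: FD_def)

text \<open>Finite volume is inherited from a bounded fundamental domain, because the integral of 1
  does not depend on the domain.\<close>

lemma emeasure_FF: "emeasure lborel FF < \<infinity>"
proof -
  obtain F where F: "FD F" "bounded F" using exists_bounded_FD by blast
  have "emeasure lborel FF = (\<integral>\<^sup>+p. 1 * indicator FF p \<partial>lborel)" using FF_sets by simp
  also have "\<dots> = (\<integral>\<^sup>+p. 1 * indicator F p \<partial>lborel)"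
    by (rule nn_integral_FD_eq[OF FD_fund_dom F(1)]) auto
  also have "\<dots> = emeasure lborel F" using F(1) by (simp add: FD_def)
  also have "\<dots> < \<infinity>" using F(2) by (rule emeasure_bounded_finite)
  finally show ?thesis .
qed

lemma CI_measurable: "CI (f :: pt \<Rightarrow> 'b::euclidean_space) \<Longrightarrow> f \<in> borel_measurable borel"
  unfolding CI_def by (blast intro: borel_measurable_continuous_onI)

lemma FF_integrable:
  fixes f :: "pt \<Rightarrow> 'b::euclidean_space"
  assumes "f \<in> borel_measurable borel" "\<And>p. norm (f p) \<le> C"
  shows "set_integrable lborel FF f"
  unfolding set_integrable_def
proof (rule integrableI_bounded_set[where A=FF and B=C])
  show "(\<lambda>p. indicat_real FF p *\<^sub>R f p) \<in> borel_measurable lborel"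
    using FF_sets assms(1) by (intro borel_measurable_scaleR borel_measurable_indicator) auto
qed (use FF_sets emeasure_FF assms in auto)

lemma CI_integrable:
  fixes f :: "pt \<Rightarrow> 'b::euclidean_space"
  shows "CI f \<Longrightarrow> set_integrable lborel FF f"
  by (metis CI_bounded CI_measurable FF_integrable)

section \<open>The integral over X: right-invariance and positivity\<close>

lemma FD_right: "FD F \<Longrightarrow> FD {q. gmul q g \<in> F}"
proof -
  assume F: "FD F"
  have "(\<lambda>q. gmul q g) \<in> borel_measurable borel" by (rule mfac_measurable[OF mfac_gmul_right])
  then have "(\<lambda>q. gmul q g) -` F \<inter> space borel \<in> sets borel"
    using F by (intro measurable_sets) (auto simp: FD_def)
  then have "{q. gmul q g \<in> F} \<in> sets borel" by (simp add: vimage_def)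
  then show ?thesis using F by (simp add: FD_def gmul_assoc)
qed

text \<open>The substitution replaces the domain by its right translate, which is again a
  fundamental domain since left and right multiplication commute.\<close>

lemma nn_integral_right:
  assumes f: "f \<in> borel_measurable borel" and inv: "\<And>\<gamma> p. \<gamma> \<in> Gam a0 P \<Longrightarrow> f (gmul \<gamma> p) = f p"
  shows "(\<integral>\<^sup>+p. f (gmul p g) * indicator FF p \<partial>lborel) = (\<integral>\<^sup>+p. f p * indicator FF p \<partial>lborel)"
proof -
  let ?F' = "{q. gmul q (gin g) \<in> FF}"
  have F': "FD ?F'" by (rule FD_right[OF FD_fund_dom])
  then have "?F' \<in> sets borel" by (simp add: FD_def)
  then have "(\<lambda>q. f q * indicator ?F' q) \<in> borel_measurable borel"
    using f by (intro borel_measurable_times_ennreal borel_measurable_indicator) auto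
  then have "(\<integral>\<^sup>+p. f (gmul p g) * indicator ?F' (gmul p g) \<partial>lborel) = 1 * (\<integral>\<^sup>+p. f p * indicator ?F' p \<partial>lborel)"
    by (rule mfac_nn_integral[OF mfac_gmul_right])
  moreover have "indicator ?F' (gmul p g) = (indicator FF p :: ennreal)" for p
    by (simp add: indicator_def gmul_cancel)
  moreover have "(\<integral>\<^sup>+p. f p * indicator ?F' p \<partial>lborel) = (\<integral>\<^sup>+p. f p * indicator FF p \<partial>lborel)"
    by (rule nn_integral_FD_eq[OF F' FD_fund_dom f inv])
  ultimately show ?thesis by simp
qed

lemma real_integral_right:
  fixes h :: "pt \<Rightarrow> real"
  assumes h: "CI h"
  shows "(LINT p:FF|lborel. h (gmul p g)) = (LINT p:FF|lborel. h p)"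
proof -
  \<comment> \<open>Adding a bound makes the function nonnegative and reduces the claim to
    nonnegative integrals.\<close>
  obtain C where C: "\<And>p. norm (h p) \<le> C" using CI_bounded[OF h] by blast
  have nn: "0 \<le> h p + C" for p using C[of p] by auto
  have m: "(\<lambda>p. h p + C) \<in> borel_measurable borel" using CI_measurable[OF h] by simp
  have m2: "(\<lambda>p. h (gmul p g) + C) \<in> borel_measurable borel" using CI_measurable[OF CI_right[OF h]] by simp
  have eq: "(LINT p:FF|lborel. k p + C) = enn2real (\<integral>\<^sup>+p. ennreal (k p + C) * indicator FF p \<partial>lborel)"
    if "(\<lambda>p. k p + C) \<in> borel_measurable borel" "\<And>p. 0 \<le> k p + C" for k
  proof -
    have "(LINT p:FF|lborel. k p + C) = enn2real (\<integral>\<^sup>+p. ennreal (indicat_real FF p *\<^sub>R (k p + C)) \<partial>lborel)"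
      unfolding set_lebesgue_integral_def
    proof (rule integral_eq_nn_integral)
      show "(\<lambda>p. indicat_real FF p *\<^sub>R (k p + C)) \<in> borel_measurable lborel"
        using FF_sets that(1) by (intro borel_measurable_scaleR borel_measurable_indicator) auto
    qed (use that(2) in auto)
    also have "(\<integral>\<^sup>+p. ennreal (indicat_real FF p *\<^sub>R (k p + C)) \<partial>lborel) = (\<integral>\<^sup>+p. ennreal (k p + C) * indicator FF p \<partial>lborel)"
      by (intro nn_integral_cong) (auto simp: indicator_def)
    finally show ?thesis .
  qed
  have "(\<integral>\<^sup>+p. ennreal (h (gmul p g) + C) * indicator FF p \<partial>lborel) = (\<integral>\<^sup>+p. ennreal (h p + C) * indicator FF p \<partial>lborel)"
    using nn_integral_right[of "\<lambda>p. ennreal (h p + C)" g] m h by (simp add: CI_def)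
  then have "(LINT p:FF|lborel. h (gmul p g) + C) = (LINT p:FF|lborel. h p + C)"
    using eq[OF m nn] eq[of "\<lambda>p. h (gmul p g)", OF m2 nn] by simp
  moreover have "(LINT p:FF|lborel. k p + C) = (LINT p:FF|lborel. k p) + (LINT p:FF|lborel. C)" if "CI k" for k
    using CI_integrable[OF that] CI_integrable[OF CI_const] by (rule set_integral_add(2))
  ultimately show ?thesis using h CI_right[OF h] by simp
qed

definition IF :: "(pt \<Rightarrow> complex) \<Rightarrow> complex" where
  "IF f = (LINT p:FF|lborel. f p)"

lemma IF_Re_Im:
  assumes f: "CI f"
  shows "Re (IF f) = (LINT p:FF|lborel. Re (f p))" "Im (IF f) = (LINT p:FF|lborel. Im (f p))"
proof -
  have i: "integrable lborel (\<lambda>p. indicat_real FF p *\<^sub>R f p)"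
    using CI_integrable[OF f] by (simp add: set_integrable_def)
  show "Re (IF f) = (LINT p:FF|lborel. Re (f p))" "Im (IF f) = (LINT p:FF|lborel. Im (f p))"
    unfolding IF_def set_lebesgue_integral_def
    using integral_Re[OF i] integral_Im[OF i] by simp_all
qed

lemma CI_Re_Im: "CI f \<Longrightarrow> CI (\<lambda>p. Re (f p))" "CI f \<Longrightarrow> CI (\<lambda>p. Im (f p))"
  by (auto simp: CI_def intro!: continuous_intros)

lemma IF_right: "CI f \<Longrightarrow> IF (\<lambda>p. f (gmul p g)) = IF f"
  by (rule complex_eqI)
    (simp_all add: IF_Re_Im CI_right CI_Re_Im real_integral_right[of "\<lambda>p. Re (f p)"] real_integral_right[of "\<lambda>p. Im (f p)"])

lemma IF_add: "CI f \<Longrightarrow> CI g \<Longrightarrow> IF (\<lambda>p. f p + g p) = IF f + IF g"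
  unfolding IF_def by (intro set_integral_add CI_integrable)

lemma IF_diff: "CI f \<Longrightarrow> CI g \<Longrightarrow> IF (\<lambda>p. f p - g p) = IF f - IF g"
  unfolding IF_def by (intro set_integral_diff CI_integrable)

lemma IF_scale: "IF (\<lambda>p. z * f p) = z * IF f"
  unfolding IF_def by simp

lemma IF_scale_right: "IF (\<lambda>p. f p * z) = IF f * z"
  unfolding IF_def by simp

lemma IF_zero: "IF (\<lambda>p. 0) = 0"
  by (simp add: IF_def set_lebesgue_integral_def)

lemma IF_sum:
  assumes "finite A" "\<And>a. a \<in> A \<Longrightarrow> CI (f a)"
  shows "IF (\<lambda>p. \<Sum>a\<in>A. f a p) = (\<Sum>a\<in>A. IF (f a))"
  using assms
proof (induction A rule: finite_induct)
  case (insert x A)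
  then show ?case by (simp add: IF_add CI_sum)
qed (simp add: IF_zero)

lemma IF_cnj: "CI f \<Longrightarrow> IF (\<lambda>p. cnj (f p)) = cnj (IF f)"
  by (rule complex_eqI)
    (simp_all add: IF_Re_Im CI_cnj set_lebesgue_integral_def)

text \<open>A vanishing square integral gives f = 0 only almost everywhere on the domain, which may
  have empty interior. Continuity is therefore used on all of G, where the nonvanishing set is open,
  invariant and null, hence empty.\<close>

lemma IF_positive:
  assumes f: "CI f"
  shows "Re (IF (\<lambda>p. f p * cnj (f p))) \<ge> 0" "Im (IF (\<lambda>p. f p * cnj (f p))) = 0"
    "IF (\<lambda>p. f p * cnj (f p)) = 0 \<Longrightarrow> f p = 0"
proof -
  have ff: "CI (\<lambda>p. f p * cnj (f p))" using f by (intro CI_mult CI_cnj)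
  have re: "Re (f p * cnj (f p)) = (cmod (f p))\<^sup>2" "Im (f p * cnj (f p)) = 0" for p
    by (simp_all only: complex_norm_square[symmetric] of_real_power[symmetric] Re_complex_of_real Im_complex_of_real)
  show 1: "Re (IF (\<lambda>p. f p * cnj (f p))) \<ge> 0"
    unfolding IF_Re_Im[OF ff] re set_lebesgue_integral_def by (rule integral_nonneg_AE) auto
  show "Im (IF (\<lambda>p. f p * cnj (f p))) = 0"
    unfolding IF_Re_Im[OF ff] re by (simp add: set_lebesgue_integral_def)
  assume "IF (\<lambda>p. f p * cnj (f p)) = 0"
  then have "(LINT p:FF|lborel. (cmod (f p))\<^sup>2) = 0" using IF_Re_Im(1)[OF ff] by (simp only: re) simp
  moreover have "set_integrable lborel FF (\<lambda>p. (cmod (f p))\<^sup>2)"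
    using CI_integrable[OF CI_Re_Im(1)[OF ff]] by (simp only: re)
  ultimately have ae: "AE p in lborel. indicat_real FF p *\<^sub>R (cmod (f p))\<^sup>2 = 0"
    unfolding set_lebesgue_integral_def set_integrable_def
    by (subst (asm) integral_nonneg_eq_0_iff_AE) auto
  define U where "U = {p. f p \<noteq> 0}"
  have "open U" using f unfolding U_def CI_def by (intro open_Collect_neq) auto
  then have mU: "U \<in> sets borel" by simp
  have "(\<integral>\<^sup>+p. indicator U p * indicator FF p \<partial>lborel) = 0"
  proof (subst nn_integral_0_iff_AE)
    show "(\<lambda>p. indicator U p * indicator FF p :: ennreal) \<in> borel_measurable lborel"
      using mU FF_sets by (intro borel_measurable_times_ennreal borel_measurable_indicator) auto
    show "AE p in lborel. indicator U p * indicator FF p = (0 :: ennreal)"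
      using ae by eventually_elim (auto simp: U_def indicator_def split: if_splits)
  qed
  \<comment> \<open>The open set \<open>U\<close> is covered by the translates of its null part inside the fundamental domain.\<close>
  have "emeasure lborel U = (\<integral>\<^sup>+p. (\<integral>\<^sup>+\<gamma>. indicator U p * indicator FF (gmul \<gamma> p) \<partial>count_space (Gam a0 P)) \<partial>lborel)"
    using mU by (simp add: nn_integral_cmult FD_count[OF FD_fund_dom])
  also have "\<dots> = (\<integral>\<^sup>+\<gamma>. \<integral>\<^sup>+p. indicator U p * indicator FF (gmul \<gamma> p) \<partial>lborel \<partial>count_space (Gam a0 P))"
  proof (intro nn_integral_count_space_nn_integral countable_Gam)
    fix \<gamma>
    have "(\<lambda>p. indicator FF (gmul \<gamma> p) :: ennreal) \<in> borel_measurable borel"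
      using measurable_compose[OF mfac_measurable[OF mfac_gmul_left[of \<gamma>]] borel_measurable_indicator, of FF] FF_sets by simp
    then show "(\<lambda>p. indicator U p * indicator FF (gmul \<gamma> p) :: ennreal) \<in> borel_measurable lborel"
      using mU by (intro borel_measurable_times_ennreal) auto
  qed
  also have "\<dots> = (\<integral>\<^sup>+\<gamma>. 0 \<partial>count_space (Gam a0 P))"
  proof (rule nn_integral_cong)
    fix \<gamma> assume "\<gamma> \<in> space (count_space (Gam a0 P))"
    then have g: "\<gamma> \<in> Gam a0 P" by simp
    have "(\<lambda>p. indicator U p * indicator FF p :: ennreal) \<in> borel_measurable borel"
      using mU FF_sets by (intro borel_measurable_times_ennreal borel_measurable_indicator) auto
    from mfac_nn_integral[OF mfac_gmul_left[of \<gamma>] this]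
    have "(\<integral>\<^sup>+p. indicator U (gmul \<gamma> p) * indicator FF (gmul \<gamma> p) \<partial>lborel) = (0::ennreal)"
      using \<open>(\<integral>\<^sup>+p. indicator U p * indicator FF p \<partial>lborel) = 0\<close> by simp
    moreover have "indicator U (gmul \<gamma> p) = (indicator U p :: ennreal)" for p
      using f g by (simp add: U_def indicator_def CI_def)
    ultimately show "(\<integral>\<^sup>+p. indicator U p * indicator FF (gmul \<gamma> p) \<partial>lborel) = (0::ennreal)" by simp
  qed
  finally have "emeasure lborel U = 0" by simp
  then have "U = {}" using open_not_negligible[OF \<open>open U\<close>] mU
    by (metis negligible_iff_null_sets null_setsI sets_lborel null_sets_completionI)
  then show "f p = 0" by (auto simp: U_def)
qed

lemma IF_dominated:
  assumes q: "\<And>n. CI (q n)" and f: "CI f" and b: "\<And>n p. norm (q n p) \<le> C"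
    and l: "\<And>p. (\<lambda>n. q n p) \<longlonglongrightarrow> f p"
  shows "(\<lambda>n. IF (q n)) \<longlonglongrightarrow> IF f"
  unfolding IF_def set_lebesgue_integral_def
proof (rule integral_dominated_convergence[where w="\<lambda>p. indicat_real FF p *\<^sub>R C"])
  show "integrable lborel (\<lambda>p. indicat_real FF p *\<^sub>R C)"
    using CI_integrable[OF CI_const[of C]] by (simp add: set_integrable_def)
  show "(\<lambda>p. indicat_real FF p *\<^sub>R f p) \<in> borel_measurable lborel"
    using CI_integrable[OF f] by (auto simp: set_integrable_def)
  show "(\<lambda>p. indicat_real FF p *\<^sub>R q n p) \<in> borel_measurable lborel" for n
    using CI_integrable[OF q] by (auto simp: set_integrable_def)
  show "AE p in lborel. (\<lambda>n. indicat_real FF p *\<^sub>R q n p) \<longlonglongrightarrow> indicat_real FF p *\<^sub>R f p"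
    by (intro AE_I2 tendsto_intros l)
  show "AE p in lborel. norm (indicat_real FF p *\<^sub>R q n p) \<le> indicat_real FF p *\<^sub>R C" for n
    using b by (intro AE_I2) (auto simp: indicator_def)
qed

section \<open>Integration by parts along the frame fields\<close>

definition dquot :: "nat \<Rightarrow> real \<Rightarrow> (pt \<Rightarrow> complex) \<Rightarrow> pt \<Rightarrow> complex" where
  "dquot i s f p = (f (gmul p (one_par i s)) - f p) / complex_of_real s"

text \<open>Wider than \<open>SI\<close>: products f * cnj g are placed here with a single
  derivative, and these are the functions to be integrated.\<close>

definition C1I :: "(pt \<Rightarrow> complex) \<Rightarrow> bool" where
  "C1I f \<longleftrightarrow> CI f \<and> (\<forall>p. f differentiable (at p)) \<and> (\<forall>i\<in>{1..6}. CI (Eder i f))"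

lemma C1I_differentiable: "C1I f \<Longrightarrow> f differentiable (at p)"
  by (simp add: C1I_def)

lemma SI_C1I: "SI a0 P f \<Longrightarrow> C1I f"
  by (simp add: C1I_def SI_CI SI_differentiable SI_Eder)

lemma CI_dquot: "CI f \<Longrightarrow> CI (dquot i s f)"
  unfolding dquot_def by (intro CI_divide CI_diff CI_right)

lemma dquot_tendsto:
  assumes f: "C1I f" and i: "i \<in> {1..6}" and s: "s \<longlonglongrightarrow> 0" "\<And>n. s n \<noteq> 0"
  shows "(\<lambda>n. dquot i (s n) f p) \<longlonglongrightarrow> Eder i f p"
proof -
  have "((\<lambda>s. f (gmul p (one_par i s))) has_vector_derivative Eder i f p) (at 0)"
    using flow_vector_derivative[OF C1I_differentiable[OF f] i, of p 0] by (simp add: gmul_0)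
  then have "((\<lambda>h. norm (f (gmul p (one_par i h)) - f p - h *\<^sub>R Eder i f p) / norm h) \<longlongrightarrow> 0) (at 0)"
    by (simp add: has_vector_derivative_def has_derivative_iff_norm gmul_0)
  moreover have "norm (f (gmul p (one_par i h)) - f p - h *\<^sub>R Eder i f p) / norm h = norm (dquot i h f p - Eder i f p)"
    if "h \<noteq> 0" for h
  proof -
    have "dquot i h f p - Eder i f p = (f (gmul p (one_par i h)) - f p - h *\<^sub>R Eder i f p) / complex_of_real h"
      using that by (simp add: dquot_def scaleR_conv_of_real diff_divide_distrib)
    then show ?thesis by (simp only: norm_divide norm_of_real real_norm_def)
  qed
  ultimately have "((\<lambda>h. norm (dquot i h f p - Eder i f p)) \<longlongrightarrow> 0) (at 0)"
    by (subst (asm) tendsto_cong[where g="\<lambda>h. norm (dquot i h f p - Eder i f p)"])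
      (auto simp: eventually_at intro!: exI[of _ 1])
  then have "((\<lambda>h. dquot i h f p) \<longlongrightarrow> Eder i f p) (at 0)"
    by (simp add: tendsto_norm_zero_iff LIM_zero_iff)
  moreover have "filterlim s (at 0) sequentially"
    using s by (simp add: filterlim_at)
  ultimately show ?thesis by (rule filterlim_compose)
qed

text \<open>Mean value inequality along a flow line; the derivative is a continuous function on X
  and so bounded. The bound serves as majorant for dominated convergence.\<close>

lemma dquot_bounded:
  assumes f: "C1I f" and i: "i \<in> {1..6}"
  obtains C where "\<And>s p. s \<noteq> 0 \<Longrightarrow> norm (dquot i s f p) \<le> C"
proof -
  obtain C where C: "\<And>p. norm (Eder i f p) \<le> C" using CI_bounded f i unfolding C1I_def by metis
  have "norm (dquot i s f p) \<le> C" if s: "s \<noteq> 0" for s p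
  proof -
    have "norm (f (gmul p (one_par i s)) - f (gmul p (one_par i 0))) \<le> C * norm (s - 0)"
    proof (rule differentiable_bound[where S=UNIV and f'="\<lambda>(u::real) h. h *\<^sub>R Eder i f (gmul p (one_par i u))"])
      show "((\<lambda>s. f (gmul p (one_par i s))) has_derivative (\<lambda>h. h *\<^sub>R Eder i f (gmul p (one_par i u)))) (at u within UNIV)" for u :: real
        using flow_vector_derivative[OF C1I_differentiable[OF f] i, of p u] by (simp add: has_vector_derivative_def)
      show "onorm (\<lambda>h. h *\<^sub>R Eder i f (gmul p (one_par i u))) \<le> C" for u :: real
      proof (rule onorm_bound)
        show "0 \<le> C" using C[of p] norm_ge_zero order_trans by blast
        show "norm (h *\<^sub>R Eder i f (gmul p (one_par i u))) \<le> C * norm h" for h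
          using mult_left_mono[OF C[of "gmul p (one_par i u)"], of "\<bar>h\<bar>"] by (simp add: mult.commute)
      qed
    qed auto
    then show ?thesis using s by (simp add: dquot_def gmul_0 norm_divide field_simps)
  qed
  then show ?thesis using that by blast
qed

abbreviation sq :: "nat \<Rightarrow> real" where "sq n \<equiv> inverse (real (Suc n))"

lemma sq_tendsto: "sq \<longlonglongrightarrow> 0" "(\<lambda>n. - sq n) \<longlonglongrightarrow> 0"
  using LIMSEQ_inverse_real_of_nat tendsto_minus[OF LIMSEQ_inverse_real_of_nat] by auto

text \<open>Every difference quotient integrates to zero by right-invariance, and this survives the
  limit.\<close>

lemma IF_Eder:
  assumes f: "C1I f" and i: "i \<in> {1..6}"
  shows "IF (Eder i f) = 0"
proof -
  obtain C where C: "\<And>s p. s \<noteq> 0 \<Longrightarrow> norm (dquot i s f p) \<le> C" using dquot_bounded[OF f i] by blast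
  have cf: "CI f" "CI (Eder i f)" using f i by (auto simp: C1I_def)
  have "(\<lambda>n. IF (dquot i (sq n) f)) \<longlonglongrightarrow> IF (Eder i f)"
    by (rule IF_dominated[where C=C]) (use C cf dquot_tendsto[OF f i sq_tendsto(1)] in \<open>auto intro: CI_dquot\<close>)
  moreover have "IF (dquot i s f) = 0" for s
    unfolding dquot_def divide_inverse IF_scale_right using cf by (simp add: IF_diff CI_right IF_right)
  ultimately show ?thesis by (simp add: LIMSEQ_const_iff)
qed

lemma IF_parts:
  assumes f: "SI a0 P f" and g: "SI a0 P g" and i: "i \<in> {1..6}"
  shows "IF (\<lambda>p. Eder i f p * cnj (g p)) = - IF (\<lambda>p. f p * cnj (Eder i g p))"
proof -
  have d: "f differentiable (at p)" "g differentiable (at p)" for p using f g SI_differentiable by auto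
  have cf: "CI f" "CI g" using f g SI_CI by auto
  have ce: "CI (Eder j f)" "CI (Eder j g)" if "j \<in> {1..6}" for j
    using f g that SI_CI SI_Eder by auto
  have e: "Eder j (\<lambda>p. f p * cnj (g p)) = (\<lambda>p. f p * cnj (Eder j g p) + Eder j f p * cnj (g p))" for j
    by (rule HOL.ext) (rule Eder_mult_cnj[OF d])
  have "C1I (\<lambda>p. f p * cnj (g p))"
    unfolding C1I_def e
  proof (intro conjI ballI allI)
    show "(\<lambda>p. f p * cnj (g p)) differentiable (at p)" for p
      using has_derivative_mult_cnj[OF d] differentiable_def by blast
  qed (intro CI_intros cf ce, assumption?)+
  from IF_Eder[OF this i] have "IF (\<lambda>p. f p * cnj (Eder i g p) + Eder i f p * cnj (g p)) = 0" by (simp add: e)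
  moreover have "CI (\<lambda>p. f p * cnj (Eder i g p))" "CI (\<lambda>p. Eder i f p * cnj (g p))"
    by (intro CI_intros cf ce[OF i])+
  ultimately show ?thesis by (simp add: IF_add eq_neg_iff_add_eq_0 add.commute)
qed

text \<open>If the flows of two frame fields commute, the identity holds already for difference quotients:
  translate the integration variable by the inverse of both flows.\<close>
lemma IF_Eder_commute:
  assumes f: "SI a0 P f" and i: "i \<in> {1..6}" and j: "j \<in> {1..6}"
    and com: "\<And>s u. gmul (one_par i s) (one_par j u) = gmul (one_par j u) (one_par i s)"
  shows "IF (\<lambda>p. Eder i f p * cnj (Eder j f p)) = IF (\<lambda>p. Eder j f p * cnj (Eder i f p))"
proof -
  have f1: "C1I f" using f by (rule SI_C1I)
  have cf: "CI f" "CI (Eder i f)" "CI (Eder j f)" using f1 i j by (auto simp: C1I_def)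
  obtain C where C: "\<And>s p. s \<noteq> 0 \<Longrightarrow> norm (dquot i s f p) \<le> C" using dquot_bounded[OF f1 i] by blast
  obtain D where D: "\<And>s p. s \<noteq> 0 \<Longrightarrow> norm (dquot j s f p) \<le> D" using dquot_bounded[OF f1 j] by blast
  have inv1: "gmul (one_par k s) (one_par k (- s)) = 0" "gmul (one_par k (- s)) (one_par k s) = 0" for k s
    by (auto simp: bs_def gmul_def zero_prod_def)
  have B: "norm (dquot i s f p * cnj (dquot j u f p)) \<le> C * D" "norm (dquot j u f p * cnj (dquot i s f p)) \<le> C * D"
    if "s \<noteq> 0" "u \<noteq> 0" for s u p
  proof -
    have "norm (dquot i s f p) * norm (dquot j u f p) \<le> C * D"
      using C[OF that(1), of p] D[OF that(2), of p] by (intro mult_mono order_trans[OF norm_ge_zero]) auto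
    then show "norm (dquot i s f p * cnj (dquot j u f p)) \<le> C * D" "norm (dquot j u f p * cnj (dquot i s f p)) \<le> C * D"
      by (simp_all add: norm_mult mult.commute)
  qed
  \<comment> \<open>Translating back along both flows turns the step s into -s and exchanges the two
    factors; for this reason the second limit below runs along negative steps.\<close>
  have sym: "IF (\<lambda>p. dquot i s f p * cnj (dquot j s f p)) = IF (\<lambda>p. dquot j (-s) f p * cnj (dquot i (-s) f p))" for s
  proof -
    define g h g' h' where gh: "g = one_par i s" "h = one_par j s" "g' = one_par i (-s)" "h' = one_par j (-s)"
    define fg fh fg' fh' where d: "fg = (\<lambda>p. f (gmul p g))" "fh = (\<lambda>p. f (gmul p h))"
      "fg' = (\<lambda>p. f (gmul p g'))" "fh' = (\<lambda>p. f (gmul p h'))"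
    have c: "CI fg" "CI fh" "CI fg'" "CI fh'" unfolding d by (intro CI_right cf)+
    have cm: "CI (\<lambda>p. u p * cnj (v p))" if "CI u" "CI v" for u v using that by (intro CI_mult CI_cnj)
    have k: "gmul g g' = 0" "gmul g' g = 0" "gmul h h' = 0" "gmul h' h = 0" "gmul g' h' = gmul h' g'"
      unfolding gh by (rule inv1 com)+
    have t1: "IF (\<lambda>p. fg p * cnj (f p)) = IF (\<lambda>p. f p * cnj (fg' p))"
      using IF_right[OF cm[OF cf(1) c(3)], of g] by (simp add: d gmul_assoc k gmul_0)
    have t2: "IF (\<lambda>p. f p * cnj (fh p)) = IF (\<lambda>p. fh' p * cnj (f p))"
      using IF_right[OF cm[OF c(4) cf(1)], of h] by (simp add: d gmul_assoc k gmul_0)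
    \<comment> \<open>Commutation enters here: the inverse flows are exchanged so that
      \<open>g'\<close> stands next to \<open>g\<close>.\<close>
    have e1: "gmul (gmul g' h') g = h'" unfolding k(5) by (simp only: gmul_assoc k(2) gmul_0)
    have e2: "gmul (gmul g' h') h = g'" by (simp only: gmul_assoc k(4) gmul_0)
    have t3: "IF (\<lambda>p. fg p * cnj (fh p)) = IF (\<lambda>p. fh' p * cnj (fg' p))"
      using IF_right[OF cm[OF c(1,2)], of "gmul g' h'"] by (simp only: d gmul_assoc[of _ "gmul g' h'"] e1 e2)
    have expand: "IF (\<lambda>p. (u p - f p) * cnj (v p - f p)) = IF (\<lambda>p. u p * cnj (v p)) - IF (\<lambda>p. u p * cnj (f p))
       - IF (\<lambda>p. f p * cnj (v p)) + IF (\<lambda>p. f p * cnj (f p))" if "CI u" "CI v" for u v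
    proof -
      have "(\<lambda>p. (u p - f p) * cnj (v p - f p)) = (\<lambda>p. u p * cnj (v p) - u p * cnj (f p) - f p * cnj (v p) + f p * cnj (f p))"
        by (auto simp: algebra_simps)
      then show ?thesis using that cf by (simp add: IF_add IF_diff cm CI_diff)
    qed
    have "IF (\<lambda>p. (fg p - f p) * cnj (fh p - f p)) = IF (\<lambda>p. (fh' p - f p) * cnj (fg' p - f p))"
      by (simp only: expand c t1 t2 t3) simp
    moreover have "dquot i s f p * cnj (dquot j s f p) = (fg p - f p) * cnj (fh p - f p) * (1 / complex_of_real (s * s))"
      "dquot j (-s) f p * cnj (dquot i (-s) f p) = (fh' p - f p) * cnj (fg' p - f p) * (1 / complex_of_real (s * s))" for p
      by (simp_all add: dquot_def d gh)
    ultimately show ?thesis by (simp only: IF_scale_right)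
  qed
  have "(\<lambda>n. IF (\<lambda>p. dquot i (sq n) f p * cnj (dquot j (sq n) f p))) \<longlonglongrightarrow> IF (\<lambda>p. Eder i f p * cnj (Eder j f p))"
    by (rule IF_dominated[where C="C * D"])
      (use B cf dquot_tendsto[OF f1 i sq_tendsto(1)] dquot_tendsto[OF f1 j sq_tendsto(1)]
        in \<open>auto intro!: CI_mult CI_cnj CI_dquot tendsto_intros\<close>)
  moreover have "(\<lambda>n. IF (\<lambda>p. dquot j (- sq n) f p * cnj (dquot i (- sq n) f p))) \<longlonglongrightarrow> IF (\<lambda>p. Eder j f p * cnj (Eder i f p))"
    by (rule IF_dominated[where C="C * D"])
      (use B cf dquot_tendsto[OF f1 i sq_tendsto(2)] dquot_tendsto[OF f1 j sq_tendsto(2)]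
        in \<open>auto intro!: CI_mult CI_cnj CI_dquot tendsto_intros\<close>)
  ultimately show ?thesis unfolding sym using LIMSEQ_unique by blast
qed

end

section \<open>First order operators and the Laplacian\<close>

text \<open>Index 0 stands for the identity, so that terms of order zero and one share a single sum
  over {0..6}.\<close>

definition Dop :: "nat \<Rightarrow> (pt \<Rightarrow> complex) \<Rightarrow> pt \<Rightarrow> complex" where
  "Dop i f = (if i = 0 then f else Eder i f)"

lemma SI_Dop: "SI a0 P f \<Longrightarrow> i \<in> {0..6} \<Longrightarrow> SI a0 P (Dop i f)"
  by (cases "i = 0") (auto simp: Dop_def intro!: SI_Eder)

lemma Dop_comb:
  assumes "finite A" "\<And>R. R \<in> A \<Longrightarrow> f R differentiable (at p)"
  shows "Dop i (\<lambda>p. \<Sum>R\<in>A. K R * f R p) p = (\<Sum>R\<in>A. K R * Dop i (f R) p)"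
proof (cases "i = 0")
  case False
  have "Eder i (\<lambda>p. \<Sum>R\<in>A. K R * f R p) p = (\<Sum>R\<in>A. Eder i (\<lambda>p. K R * f R p) p)"
    using assms by (intro Eder_sum differentiable_mult) auto
  then show ?thesis using assms False by (simp add: Dop_def Eder_scale cong: sum.cong)
qed (simp add: Dop_def)

lemma Dop_zero: "Dop i (\<lambda>p. 0) p = 0"
  by (simp add: Dop_def Eder_const)

lemma smooth_forms_iff: "\<alpha> \<in> smooth_forms a0 P \<longleftrightarrow> (\<forall>p. supp6 (\<lambda>T. \<alpha> T p)) \<and> (\<forall>T. SI a0 P (\<alpha> T))"
  by (auto simp: smooth_forms_def supp6_def SI_def)

lemma sum_swap4:
  "(\<Sum>x\<in>A. \<Sum>y\<in>B. \<Sum>i\<in>C. \<Sum>z\<in>D. f x y i z) = (\<Sum>z\<in>D. \<Sum>x\<in>A. \<Sum>y\<in>B. \<Sum>i\<in>C. f x y i z :: complex)"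
proof -
  have "(\<Sum>x\<in>A. \<Sum>y\<in>B. \<Sum>i\<in>C. \<Sum>z\<in>D. f x y i z) = (\<Sum>x\<in>A. \<Sum>y\<in>B. \<Sum>z\<in>D. \<Sum>i\<in>C. f x y i z)"
    by (rule sum.cong[OF refl], rule sum.cong[OF refl], rule sum.swap)
  also have "\<dots> = (\<Sum>x\<in>A. \<Sum>z\<in>D. \<Sum>y\<in>B. \<Sum>i\<in>C. f x y i z)"
    by (rule sum.cong[OF refl], rule sum.swap)
  also have "\<dots> = (\<Sum>z\<in>D. \<Sum>x\<in>A. \<Sum>y\<in>B. \<Sum>i\<in>C. f x y i z)"
    by (rule sum.swap)
  finally show ?thesis .
qed

locale almost_kaehler = lattice_data +
  fixes a b c :: real
  assumes an0: "a \<noteq> 0" and cn0: "c \<noteq> 0"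
begin

abbreviation V :: "form set" where "V \<equiv> smooth_forms a0 P"
abbreviation U6 :: "nat set set" where "U6 \<equiv> Pow {1..6}"

text \<open>Constant coefficients suffice because the frame is left-invariant. The support clause
  keeps the values inside \<open>V\<close>.\<close>

definition FO :: "(form \<Rightarrow> form) \<Rightarrow> bool" where
  "FO A \<longleftrightarrow> (\<exists>M. (\<forall>i T S. \<not> T \<subseteq> {1..6} \<longrightarrow> M i T S = 0) \<and>
     (\<forall>\<alpha>\<in>V. \<forall>T p. A \<alpha> T p = (\<Sum>i\<in>{0..6}. \<Sum>S\<in>U6. M i T S * Dop i (\<alpha> S) p)))"

lemma FO_E:
  assumes "FO A"
  obtains M where "\<forall>i T S. \<not> T \<subseteq> {1..6} \<longrightarrow> M i T S = 0"
    "\<forall>\<alpha>\<in>V. \<forall>T p. A \<alpha> T p = (\<Sum>i\<in>{0..6}. \<Sum>S\<in>U6. M i T S * Dop i (\<alpha> S) p)"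
  using assms unfolding FO_def by (elim exE conjE)

lemma VD: "\<alpha> \<in> V \<Longrightarrow> SI a0 P (\<alpha> T)" "\<alpha> \<in> V \<Longrightarrow> supp6 (\<lambda>T. \<alpha> T p)" "\<alpha> \<in> V \<Longrightarrow> \<alpha> T differentiable (at p)"
  by (auto simp: smooth_forms_iff intro: SI_differentiable)

lemma V_comb:
  assumes "\<alpha> \<in> V" "\<beta> \<in> V"
  shows "(\<lambda>T p. z * \<alpha> T p + w * \<beta> T p) \<in> V"
  using assms by (auto simp: smooth_forms_iff supp6_def intro!: SI_add SI_scale)

lemma FO_V: "FO A \<Longrightarrow> \<alpha> \<in> V \<Longrightarrow> A \<alpha> \<in> V"
proof -
  assume A: "FO A" and \<alpha>: "\<alpha> \<in> V"
  obtain M where M0: "\<forall>i T S. \<not> T \<subseteq> {1..6} \<longrightarrow> M i T S = 0"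
    "\<forall>\<alpha>\<in>V. \<forall>T p. A \<alpha> T p = (\<Sum>i\<in>{0..6}. \<Sum>S\<in>U6. M i T S * Dop i (\<alpha> S) p)"
    by (rule FO_E[OF A])
  note M = M0[rule_format]
  have "A \<alpha> T = (\<lambda>p. \<Sum>i\<in>{0..6}. \<Sum>S\<in>U6. M i T S * Dop i (\<alpha> S) p)" for T
    by (rule HOL.ext) (rule M(2)[OF \<alpha>])
  then have "SI a0 P (A \<alpha> T)" for T using VD(1)[OF \<alpha>] by (auto intro!: SI_sum SI_scale SI_Dop)
  then show ?thesis using \<alpha> by (simp add: smooth_forms_iff[of "A \<alpha>"] supp6_def M)
qed

lemma FO_cong:
  assumes "FO A" "\<And>\<alpha>. \<alpha> \<in> V \<Longrightarrow> B' \<alpha> = A \<alpha>"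
  shows "FO B'"
proof -
  obtain M where M0: "\<forall>i T S. \<not> T \<subseteq> {1..6} \<longrightarrow> M i T S = 0"
    "\<forall>\<alpha>\<in>V. \<forall>T p. A \<alpha> T p = (\<Sum>i\<in>{0..6}. \<Sum>S\<in>U6. M i T S * Dop i (\<alpha> S) p)"
    by (rule FO_E[OF assms(1)])
  note M = M0[rule_format]
  show ?thesis unfolding FO_def by (rule exI[of _ M]) (simp add: M assms(2))
qed

lemma FO_zero: "FO (\<lambda>\<alpha> T p. 0)"
  unfolding FO_def by (rule exI[of _ "\<lambda>i T S. 0"]) simp

lemma FO_add:
  assumes "FO A" "FO B'"
  shows "FO (\<lambda>\<alpha> T p. A \<alpha> T p + B' \<alpha> T p)"
proof -
  obtain M where M0: "\<forall>i T S. \<not> T \<subseteq> {1..6} \<longrightarrow> M i T S = 0"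
    "\<forall>\<alpha>\<in>V. \<forall>T p. A \<alpha> T p = (\<Sum>i\<in>{0..6}. \<Sum>S\<in>U6. M i T S * Dop i (\<alpha> S) p)"
    by (rule FO_E[OF assms(1)])
  note M = M0[rule_format]
  obtain M' where M'0: "\<forall>i T S. \<not> T \<subseteq> {1..6} \<longrightarrow> M' i T S = 0"
    "\<forall>\<alpha>\<in>V. \<forall>T p. B' \<alpha> T p = (\<Sum>i\<in>{0..6}. \<Sum>S\<in>U6. M' i T S * Dop i (\<alpha> S) p)"
    by (rule FO_E[OF assms(2)])
  note M' = M'0[rule_format]
  show ?thesis unfolding FO_def
    by (rule exI[of _ "\<lambda>i T S. M i T S + M' i T S"]) (simp add: M M' algebra_simps sum.distrib)
qed

lemma FO_sum:
  assumes "finite I" "\<And>i. i \<in> I \<Longrightarrow> FO (A i)"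
  shows "FO (\<lambda>\<alpha> T p. \<Sum>i\<in>I. A i \<alpha> T p)"
  using assms by (induction I rule: finite_induct) (auto intro: FO_zero FO_add)

text \<open>Together with \<open>FO_pre\<close>: bidegree projections are constant matrices, so d
  placed between two of them remains of this class.\<close>

lemma FO_post:
  assumes "FO A" "\<And>T R. \<not> T \<subseteq> {1..6} \<Longrightarrow> K T R = 0"
  shows "FO (\<lambda>\<alpha> T p. \<Sum>R\<in>U6. K T R * A \<alpha> R p)"
proof -
  obtain M where M0: "\<forall>i T S. \<not> T \<subseteq> {1..6} \<longrightarrow> M i T S = 0"
    "\<forall>\<alpha>\<in>V. \<forall>T p. A \<alpha> T p = (\<Sum>i\<in>{0..6}. \<Sum>S\<in>U6. M i T S * Dop i (\<alpha> S) p)"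
    by (rule FO_E[OF assms(1)])
  note M = M0[rule_format]
  have "(\<Sum>R\<in>U6. K T R * A \<alpha> R p) = (\<Sum>i\<in>{0..6}. \<Sum>S\<in>U6. (\<Sum>R\<in>U6. K T R * M i R S) * Dop i (\<alpha> S) p)"
    if "\<alpha> \<in> V" for \<alpha> T p
  proof -
    have "(\<Sum>R\<in>U6. K T R * A \<alpha> R p) = (\<Sum>R\<in>U6. \<Sum>i\<in>{0..6}. \<Sum>S\<in>U6. K T R * M i R S * Dop i (\<alpha> S) p)"
      using that by (simp add: M sum_distrib_left mult.assoc)
    also have "\<dots> = (\<Sum>i\<in>{0..6}. \<Sum>R\<in>U6. \<Sum>S\<in>U6. K T R * M i R S * Dop i (\<alpha> S) p)" by (rule sum.swap)
    also have "\<dots> = (\<Sum>i\<in>{0..6}. \<Sum>S\<in>U6. \<Sum>R\<in>U6. K T R * M i R S * Dop i (\<alpha> S) p)"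
      by (rule sum.cong[OF refl], rule sum.swap)
    finally show ?thesis by (simp add: sum_distrib_right)
  qed
  then show ?thesis unfolding FO_def
    by (intro exI[of _ "\<lambda>i T S. \<Sum>R\<in>U6. K T R * M i R S"]) (simp add: assms(2))
qed

lemma matrix_V:
  assumes "\<alpha> \<in> V" "\<And>T R. \<not> T \<subseteq> {1..6} \<Longrightarrow> K T R = 0"
  shows "(\<lambda>T p. \<Sum>R\<in>U6. K T R * \<alpha> R p) \<in> V"
  using assms VD(1)[OF assms(1)] by (auto simp: smooth_forms_iff supp6_def intro!: SI_sum SI_scale)

lemma FO_pre:
  assumes "FO A" "\<And>T R. \<not> T \<subseteq> {1..6} \<Longrightarrow> K T R = 0"
  shows "FO (\<lambda>\<alpha>. A (\<lambda>T p. \<Sum>R\<in>U6. K T R * \<alpha> R p))"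
proof -
  obtain M where M0: "\<forall>i T S. \<not> T \<subseteq> {1..6} \<longrightarrow> M i T S = 0"
    "\<forall>\<alpha>\<in>V. \<forall>T p. A \<alpha> T p = (\<Sum>i\<in>{0..6}. \<Sum>S\<in>U6. M i T S * Dop i (\<alpha> S) p)"
    by (rule FO_E[OF assms(1)])
  note M = M0[rule_format]
  have "A (\<lambda>T p. \<Sum>R\<in>U6. K T R * \<alpha> R p) T p = (\<Sum>i\<in>{0..6}. \<Sum>R\<in>U6. (\<Sum>S\<in>U6. M i T S * K S R) * Dop i (\<alpha> R) p)"
    if \<alpha>: "\<alpha> \<in> V" for \<alpha> T p
  proof -
    have "A (\<lambda>T p. \<Sum>R\<in>U6. K T R * \<alpha> R p) T p
       = (\<Sum>i\<in>{0..6}. \<Sum>S\<in>U6. M i T S * Dop i (\<lambda>p. \<Sum>R\<in>U6. K S R * \<alpha> R p) p)"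
      by (rule M(2)[OF matrix_V[OF \<alpha> assms(2)]])
    also have "\<dots> = (\<Sum>i\<in>{0..6}. \<Sum>S\<in>U6. \<Sum>R\<in>U6. M i T S * K S R * Dop i (\<alpha> R) p)"
      by (simp add: Dop_comb VD(3)[OF \<alpha>] sum_distrib_left mult.assoc)
    also have "\<dots> = (\<Sum>i\<in>{0..6}. \<Sum>R\<in>U6. \<Sum>S\<in>U6. M i T S * K S R * Dop i (\<alpha> R) p)"
      by (rule sum.cong[OF refl], rule sum.swap)
    finally show ?thesis by (simp add: sum_distrib_right)
  qed
  then show ?thesis unfolding FO_def
    by (intro exI[of _ "\<lambda>i T R. \<Sum>S\<in>U6. M i T S * K S R"]) (simp add: M(1))
qed

lemma sum07: "(\<Sum>i\<in>{0..6::nat}. f i) = f 0 + (\<Sum>i\<in>{1..6}. f i :: complex)"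
proof -
  have "{0..6::nat} = insert 0 {1..6}" by auto
  then show ?thesis by simp
qed

lemma FO_dext: "FO dext"
  unfolding FO_def
proof (intro exI conjI allI ballI impI)
  let ?M = "\<lambda>i T S. if i = 0 then dcl (sl S) T else lw (dl i) (wl dl (sl S)) T"
  show "?M i T S = 0" if "\<not> T \<subseteq> {1..6}" for i T S
  proof -
    have "dcl is T = 0" for "is" by (cases "is") (use that in \<open>auto simp: dq_def lw_def\<close>)
    then show ?thesis using that by (simp add: lw_def)
  qed
  show "dext \<alpha> T p = (\<Sum>i\<in>{0..6}. \<Sum>S\<in>U6. ?M i T S * Dop i (\<alpha> S) p)" for \<alpha> T p
  proof -
    have "(\<Sum>S\<in>U6. ?M i T S * Dop i (\<alpha> S) p) = lw (dl i) (\<lambda>T. Eder i (\<alpha> T) p) T" if "i \<in> {1..6}" for i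
      using that by (subst wl_dl_expand) (simp add: Dop_def mult.commute)
    then have 1: "(\<Sum>i\<in>{1..6}. \<Sum>S\<in>U6. ?M i T S * Dop i (\<alpha> S) p) = (\<Sum>i\<in>{1..6}. lw (dl i) (\<lambda>T. Eder i (\<alpha> T) p) T)"
      by (rule sum.cong[OF refl])
    have 0: "(\<Sum>S\<in>U6. ?M 0 T S * Dop 0 (\<alpha> S) p) = dc (\<lambda>T. \<alpha> T p) T"
      by (simp add: Dop_def dc_def mult.commute)
    show ?thesis unfolding dext_eq sum07 0 1 by (rule add.commute)
  qed
qed

text \<open>The bidegree projection as a matrix in the real basis: pass to the complex coframe,
  mask, and return.\<close>

definition KP :: "nat \<Rightarrow> nat \<Rightarrow> nat set \<Rightarrow> nat set \<Rightarrow> complex" where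
  "KP r s T R = (\<Sum>S\<in>U6. (if ty r s S then wl (Nc a b c) (sl R) S else 0) * wl (thc a b c) (sl S) T)"

lemma KP_outside: "\<not> T \<subseteq> {1..6} \<Longrightarrow> KP r s T R = 0"
  by (simp add: KP_def wl_outside)

lemma proj_KP:
  assumes "supp6 (\<lambda>T. \<alpha> T p)"
  shows "proj a b c r s \<alpha> T p = (\<Sum>R\<in>U6. KP r s T R * \<alpha> R p)"
proof -
  have "proj a b c r s \<alpha> T p = (\<Sum>S\<in>U6. (\<Sum>R\<in>U6. \<alpha> R p * (if ty r s S then wl (Nc a b c) (sl R) S else 0)) * wl (thc a b c) (sl S) T)"
  proof -
    have "thcoef a b c \<alpha> p = ext (Nc a b c) (\<lambda>T. \<alpha> T p)" by (rule thcoef_eq) (use an0 cn0 assms in auto)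
    then show ?thesis unfolding proj_eq ext_def by (intro sum.cong) auto
  qed
  also have "\<dots> = (\<Sum>S\<in>U6. \<Sum>R\<in>U6. \<alpha> R p * ((if ty r s S then wl (Nc a b c) (sl R) S else 0) * wl (thc a b c) (sl S) T))"
    by (simp add: sum_distrib_right mult.assoc)
  also have "\<dots> = (\<Sum>R\<in>U6. \<Sum>S\<in>U6. \<alpha> R p * ((if ty r s S then wl (Nc a b c) (sl R) S else 0) * wl (thc a b c) (sl S) T))"
    by (rule sum.swap)
  finally show ?thesis by (simp add: KP_def sum_distrib_left mult.commute)
qed

lemma proj_V: "\<alpha> \<in> V \<Longrightarrow> proj a b c r s \<alpha> \<in> V"
proof -
  assume \<alpha>: "\<alpha> \<in> V"
  have "proj a b c r s \<alpha> = (\<lambda>T p. \<Sum>R\<in>U6. KP r s T R * \<alpha> R p)"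
    by (intro HOL.ext proj_KP VD(2)[OF \<alpha>])
  then show ?thesis using matrix_V[OF \<alpha> KP_outside] by simp
qed

lemma FO_proj_dext_proj: "FO (\<lambda>\<alpha>. proj a b c r' s' (dext (proj a b c r s \<alpha>)))"
proof (rule FO_cong)
  show "FO (\<lambda>\<alpha> T p. \<Sum>R\<in>U6. KP r' s' T R * dext (\<lambda>T p. \<Sum>R\<in>U6. KP r s T R * \<alpha> R p) R p)"
    by (intro FO_post[of "\<lambda>\<alpha>. dext (\<lambda>T p. \<Sum>R\<in>U6. KP r s T R * \<alpha> R p)"] FO_pre FO_dext KP_outside)
  fix \<alpha> assume \<alpha>: "\<alpha> \<in> V"
  have 1: "proj a b c r s \<alpha> = (\<lambda>T p. \<Sum>R\<in>U6. KP r s T R * \<alpha> R p)"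
    by (intro HOL.ext proj_KP VD(2)[OF \<alpha>])
  show "proj a b c r' s' (dext (proj a b c r s \<alpha>)) = (\<lambda>T p. \<Sum>R\<in>U6. KP r' s' T R * dext (\<lambda>T p. \<Sum>R\<in>U6. KP r s T R * \<alpha> R p) R p)"
    unfolding 1 by (intro HOL.ext proj_KP) (simp add: supp6_def dext_outside)
qed

lemma FO_dbar_mu: "FO (dbar_mu a b c)"
proof -
  have "FO (\<lambda>\<alpha> T p. \<Sum>r\<le>3. \<Sum>s\<le>3. proj a b c r (s + 1) (dext (proj a b c r s \<alpha>)) T p
      + (if 1 \<le> s then proj a b c (r + 2) (s - 1) (dext (proj a b c r s \<alpha>)) T p else 0))"
  proof (intro FO_sum FO_add FO_proj_dext_proj)
    fix r s :: nat
    show "FO (\<lambda>\<alpha> T p. if 1 \<le> s then proj a b c (r + 2) (s - 1) (dext (proj a b c r s \<alpha>)) T p else 0)"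
      by (cases "1 \<le> s") (simp_all only: if_True if_False FO_zero FO_proj_dext_proj)
  qed auto
  then show ?thesis by (rule FO_cong) (auto simp: dbar_mu_def fun_eq_iff)
qed

lemma dbar_mu_V: "\<alpha> \<in> V \<Longrightarrow> dbar_mu a b c \<alpha> \<in> V"
  by (rule FO_V[OF FO_dbar_mu])

text \<open>The coefficient of \<open>\<theta>\<^sub>S\<close>; unlike \<open>thcoef\<close> it is defined without a description operator.\<close>
definition tc :: "form \<Rightarrow> nat set \<Rightarrow> pt \<Rightarrow> complex" where
  "tc \<alpha> S p = ext (Nc a b c) (\<lambda>T. \<alpha> T p) S"

lemma SI_tc: "\<alpha> \<in> V \<Longrightarrow> SI a0 P (tc \<alpha> S)"
  unfolding tc_def[abs_def] ext_def by (intro SI_sum SI_mult VD(1) SI_const)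

lemma tc_outside: "\<not> S \<subseteq> {1..6} \<Longrightarrow> tc \<alpha> S p = 0"
  by (simp add: tc_def ext_outside)

lemma form_tc: "\<alpha> \<in> V \<Longrightarrow> \<alpha> T p = ext (thc a b c) (\<lambda>S. tc \<alpha> S p) T"
proof -
  assume "\<alpha> \<in> V"
  then have "ext (thc a b c) (ext (Nc a b c) (\<lambda>T. \<alpha> T p)) = (\<lambda>T. \<alpha> T p)" by (intro ext_thc_Nc an0 cn0 VD(2))
  from fun_cong[OF this, of T] show ?thesis by (simp add: tc_def)
qed

lemma form_zero_iff: "\<alpha> \<in> V \<Longrightarrow> \<alpha> = 0 \<longleftrightarrow> (\<forall>S p. tc \<alpha> S p = 0)"
proof
  assume "\<alpha> \<in> V" "\<forall>S p. tc \<alpha> S p = 0"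
  then show "\<alpha> = 0" by (auto simp: fun_eq_iff form_tc ext_def)
qed (simp add: tc_def ext_def)

lemma tc_comb: "tc (\<lambda>T p. z * \<alpha> T p + w * \<beta> T p) S p = z * tc \<alpha> S p + w * tc \<beta> S p"
  by (simp add: tc_def ext_add ext_scale)

definition kap :: real where
  "kap = sqrt (mdet (Gm a b c) [1,2,3,4,5,6] [1,2,3,4,5,6])"

lemma kap_nonzero: "kap \<noteq> 0"
  using mdet_Gm_nonzero[OF an0 cn0] by (simp add: kap_def)

lemma L2ip_IF: "L2ip a b c a0 P \<alpha> \<beta> = IF (pip a b c \<alpha> \<beta>) * complex_of_real kap"
  unfolding L2ip_def IF_scale_right[symmetric] by (simp add: IF_def kap_def)

lemma L2ip_tc:
  assumes "\<alpha> \<in> V" "\<beta> \<in> V"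
  shows "L2ip a b c a0 P \<alpha> \<beta> = (\<Sum>S\<in>U6. 2 ^ card S * IF (\<lambda>p. tc \<alpha> S p * cnj (tc \<beta> S p))) * complex_of_real kap"
proof -
  have c: "CI (tc \<alpha> S)" "CI (tc \<beta> S)" for S using assms SI_tc SI_CI by auto
  have "pip a b c \<alpha> \<beta> = (\<lambda>p. \<Sum>S\<in>U6. 2 ^ card S * (tc \<alpha> S p * cnj (tc \<beta> S p)))"
    by (rule HOL.ext) (simp add: pip_eq[OF an0 cn0] tc_def mult.assoc)
  then have "IF (pip a b c \<alpha> \<beta>) = (\<Sum>S\<in>U6. IF (\<lambda>p. 2 ^ card S * (tc \<alpha> S p * cnj (tc \<beta> S p))))"
    using c by (simp only:) (intro IF_sum CI_intros, auto)
  then show ?thesis unfolding L2ip_IF by (simp only: IF_scale)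
qed

lemma L2ip_cnj:
  assumes "\<alpha> \<in> V" "\<beta> \<in> V"
  shows "cnj (L2ip a b c a0 P \<alpha> \<beta>) = L2ip a b c a0 P \<beta> \<alpha>"
proof -
  have c: "CI (tc \<alpha> S)" "CI (tc \<beta> S)" for S using assms SI_tc SI_CI by auto
  have "cnj (IF (\<lambda>p. tc \<alpha> S p * cnj (tc \<beta> S p))) = IF (\<lambda>p. tc \<beta> S p * cnj (tc \<alpha> S p))" for S
    using c by (subst IF_cnj[symmetric]) (auto intro!: CI_intros simp: mult.commute)
  then show ?thesis by (simp add: L2ip_tc assms)
qed

lemma L2ip_comb_left:
  assumes "\<alpha> \<in> V" "\<alpha>' \<in> V" "\<beta> \<in> V"
  shows "L2ip a b c a0 P (\<lambda>T p. z * \<alpha> T p + w * \<alpha>' T p) \<beta> = z * L2ip a b c a0 P \<alpha> \<beta> + w * L2ip a b c a0 P \<alpha>' \<beta>"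
proof -
  have c: "CI (tc \<alpha> S)" "CI (tc \<beta> S)" "CI (tc \<alpha>' S)" for S using assms SI_tc SI_CI by auto
  have "IF (\<lambda>p. (z * tc \<alpha> S p + w * tc \<alpha>' S p) * cnj (tc \<beta> S p))
     = z * IF (\<lambda>p. tc \<alpha> S p * cnj (tc \<beta> S p)) + w * IF (\<lambda>p. tc \<alpha>' S p * cnj (tc \<beta> S p))" for S
    unfolding distrib_right mult.assoc using c by (subst IF_add) (auto intro!: CI_intros simp: IF_scale)
  then show ?thesis using assms
    by (simp add: L2ip_tc V_comb tc_comb algebra_simps sum.distrib sum_distrib_left)
qed

lemma L2ip_diff_right:
  assumes "\<alpha> \<in> V" "\<beta> \<in> V" "\<beta>' \<in> V"
  shows "L2ip a b c a0 P \<alpha> (\<lambda>T p. 1 * \<beta> T p + (-1) * \<beta>' T p) = L2ip a b c a0 P \<alpha> \<beta> - L2ip a b c a0 P \<alpha> \<beta>'"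
proof -
  have "(\<lambda>T p. 1 * \<beta> T p + (-1) * \<beta>' T p) \<in> V" using assms by (intro V_comb)
  then have "L2ip a b c a0 P \<alpha> (\<lambda>T p. 1 * \<beta> T p + (-1) * \<beta>' T p)
     = cnj (L2ip a b c a0 P (\<lambda>T p. 1 * \<beta> T p + (-1) * \<beta>' T p) \<alpha>)" using assms by (subst L2ip_cnj) auto
  also have "\<dots> = L2ip a b c a0 P \<alpha> \<beta> - L2ip a b c a0 P \<alpha> \<beta>'"
    unfolding L2ip_comb_left[OF assms(2,3,1)] using assms by (simp add: L2ip_cnj)
  finally show ?thesis .
qed

text \<open>The factor \<open>kap\<close> is left out: only its nonvanishing has been established,
  so positivity is stated for the sum alone.\<close>

definition nrm :: "form \<Rightarrow> real" where
  "nrm \<alpha> = (\<Sum>S\<in>U6. 2 ^ card S * Re (IF (\<lambda>p. tc \<alpha> S p * cnj (tc \<alpha> S p))))"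

lemma nrm:
  assumes "\<alpha> \<in> V"
  shows "L2ip a b c a0 P \<alpha> \<alpha> = complex_of_real (nrm \<alpha> * kap)" "nrm \<alpha> \<ge> 0" "nrm \<alpha> = 0 \<Longrightarrow> \<alpha> = 0"
proof -
  have c: "CI (tc \<alpha> S)" for S using assms SI_tc SI_CI by auto
  have "IF (\<lambda>p. tc \<alpha> S p * cnj (tc \<alpha> S p)) = complex_of_real (Re (IF (\<lambda>p. tc \<alpha> S p * cnj (tc \<alpha> S p))))" for S
    using IF_positive(2)[OF c] by (simp add: complex_eq_iff)
  then show "L2ip a b c a0 P \<alpha> \<alpha> = complex_of_real (nrm \<alpha> * kap)"
    unfolding L2ip_tc[OF assms assms] nrm_def by (simp only: of_real_mult of_real_sum of_real_power of_real_numeral)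
  show "nrm \<alpha> \<ge> 0" unfolding nrm_def using IF_positive(1)[OF c] by (intro sum_nonneg mult_nonneg_nonneg) auto
  assume "nrm \<alpha> = 0"
  then have "\<forall>S\<in>U6. 2 ^ card S * Re (IF (\<lambda>p. tc \<alpha> S p * cnj (tc \<alpha> S p))) = 0"
    unfolding nrm_def using IF_positive(1)[OF c] by (subst (asm) sum_nonneg_eq_0_iff) auto
  then have "IF (\<lambda>p. tc \<alpha> S p * cnj (tc \<alpha> S p)) = 0" if "S \<in> U6" for S
    using that IF_positive(2)[OF c] by (auto simp: complex_eq_iff)
  then have "tc \<alpha> S p = 0" for S p
  proof (cases "S \<in> U6")
    case True
    assume "\<And>S. S \<in> U6 \<Longrightarrow> IF (\<lambda>p. tc \<alpha> S p * cnj (tc \<alpha> S p)) = 0"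
    from IF_positive(3)[OF c this[OF True]] show ?thesis .
  qed (use tc_outside in blast)
  then show "\<alpha> = 0" using form_zero_iff[OF assms] by blast
qed

text \<open>Test with the difference of the two candidates. With \<open>adjoint_exists\<close> this
  justifies the description in \<open>dbar_mu_adj\<close>.\<close>

lemma adjoint_unique:
  assumes "\<gamma> \<in> V" "\<gamma>' \<in> V" "\<And>\<alpha>. \<alpha> \<in> V \<Longrightarrow> L2ip a b c a0 P \<alpha> \<gamma> = L2ip a b c a0 P \<alpha> \<gamma>'"
  shows "\<gamma> = \<gamma>'"
proof -
  let ?d = "\<lambda>T p. 1 * \<gamma> T p + (-1) * \<gamma>' T p"
  have d: "?d \<in> V" using assms by (intro V_comb)
  have "L2ip a b c a0 P ?d ?d = 0" unfolding L2ip_diff_right[OF d assms(1,2)] using assms(3)[OF d] by simp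
  then have "nrm ?d = 0" using nrm(1)[OF d] kap_nonzero by simp
  then have "?d = 0" by (rule nrm(3)[OF d])
  then show ?thesis by (simp add: fun_eq_iff)
qed

section \<open>The adjoint and the kernel of the Laplacian\<close>

lemma IF_Dop:
  assumes "SI a0 P f" "SI a0 P g" "i \<in> {0..6}"
  shows "IF (\<lambda>p. Dop i f p * cnj (g p)) = (if i = 0 then 1 else -1) * IF (\<lambda>p. f p * cnj (Dop i g p))"
  using IF_parts[OF assms(1,2), of i] assms(3) by (cases "i = 0") (auto simp: Dop_def)

lemma IF_lin2:
  assumes "finite X" "finite Y" "\<And>x y. x \<in> X \<Longrightarrow> y \<in> Y \<Longrightarrow> CI (f x y)"
  shows "IF (\<lambda>p. \<Sum>x\<in>X. \<Sum>y\<in>Y. k x y * f x y p) = (\<Sum>x\<in>X. \<Sum>y\<in>Y. k x y * IF (f x y))"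
proof -
  have "IF (\<lambda>p. \<Sum>x\<in>X. \<Sum>y\<in>Y. k x y * f x y p) = (\<Sum>x\<in>X. IF (\<lambda>p. \<Sum>y\<in>Y. k x y * f x y p))"
    using assms by (intro IF_sum CI_sum CI_mult[OF CI_const]) auto
  also have "\<dots> = (\<Sum>x\<in>X. \<Sum>y\<in>Y. IF (\<lambda>p. k x y * f x y p))"
    using assms by (intro sum.cong refl IF_sum CI_mult[OF CI_const]) auto
  finally show ?thesis by (simp only: IF_scale)
qed

text \<open>Integration by parts moves every derivative onto beta at the cost of a sign. The
  resulting plain pairing with \<open>w\<close> becomes the metric pairing with
  \<open>\<gamma>\<close> after inverting the induced inner product.\<close>

lemma adjoint_exists:
  assumes A: "FO A" and \<beta>: "\<beta> \<in> V"
  shows "\<exists>\<gamma>\<in>V. \<forall>\<alpha>\<in>V. L2ip a b c a0 P (A \<alpha>) \<beta> = L2ip a b c a0 P \<alpha> \<gamma>"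
proof -
  obtain M where M0: "\<forall>i T S. \<not> T \<subseteq> {1..6} \<longrightarrow> M i T S = 0"
    "\<forall>\<alpha>\<in>V. \<forall>T p. A \<alpha> T p = (\<Sum>i\<in>{0..6}. \<Sum>S\<in>U6. M i T S * Dop i (\<alpha> S) p)"
    by (rule FO_E[OF A])
  note M = M0[rule_format]
  define h where "h I K = wl (cH a b c) (sl I) K" for I K
  define e :: "nat \<Rightarrow> complex" where "e i = (if i = 0 then 1 else -1)" for i
  \<comment> \<open>Chosen so that the pairing of \<open>A \<alpha>\<close> with
    \<open>\<beta>\<close> becomes the sum over S of the integrals of
    \<open>\<alpha> S p * cnj (w S p)\<close>, with the metric absorbed into
    \<open>w\<close>.\<close>
  define w where "w S p = (\<Sum>I\<in>U6. \<Sum>K\<in>U6. \<Sum>i\<in>{0..6}. cnj (h I K * M i I S * e i) * Dop i (\<beta> K) p)" for S p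
  \<comment> \<open>Solves \<open>h \<gamma> = w\<close>; by \<open>wl_cH_cG\<close> the minors of G
    invert those of H.\<close>
  define \<gamma> where "\<gamma> = (\<lambda>K p. \<Sum>J\<in>U6. (if K \<subseteq> {1..6} then wl (cG a b c) (sl K) J else 0) * w J p)"
  have SIw: "SI a0 P (w S)" for S unfolding w_def[abs_def] using VD(1)[OF \<beta>]
    by (intro SI_sum SI_scale SI_Dop) auto
  have \<gamma>V: "\<gamma> \<in> V"
    unfolding smooth_forms_iff \<gamma>_def using SIw by (auto simp: supp6_def intro!: SI_sum SI_scale)
  have cm: "CI (\<lambda>p. f p * cnj (g p))" if "SI a0 P f" "SI a0 P g" for f g
    using that SI_CI by (intro CI_intros) auto
  have "IF (pip a b c (A \<alpha>) \<beta>) = IF (pip a b c \<alpha> \<gamma>)" if \<alpha>: "\<alpha> \<in> V" for \<alpha>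
  proof -
    have "IF (pip a b c (A \<alpha>) \<beta>) = (\<Sum>I\<in>U6. \<Sum>K\<in>U6. h I K * IF (\<lambda>p. A \<alpha> I p * cnj (\<beta> K p)))"
    proof -
      have "pip a b c (A \<alpha>) \<beta> = (\<lambda>p. \<Sum>I\<in>U6. \<Sum>K\<in>U6. h I K * (A \<alpha> I p * cnj (\<beta> K p)))"
        by (rule HOL.ext) (simp add: pip_eq_wl[OF an0 cn0] h_def mult_ac)
      moreover have "CI (\<lambda>p. A \<alpha> I p * cnj (\<beta> K p))" for I K
        by (rule cm[OF VD(1)[OF FO_V[OF A \<alpha>]] VD(1)[OF \<beta>]])
      ultimately show ?thesis by (simp only:) (rule IF_lin2, auto)
    qed
    also have "\<dots> = (\<Sum>I\<in>U6. \<Sum>K\<in>U6. \<Sum>i\<in>{0..6}. \<Sum>S\<in>U6. h I K * M i I S * e i * IF (\<lambda>p. \<alpha> S p * cnj (Dop i (\<beta> K) p)))"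
    proof (intro sum.cong refl)
      fix I K :: "nat set" assume "I \<in> U6" "K \<in> U6"
      have "(\<lambda>p. A \<alpha> I p * cnj (\<beta> K p)) = (\<lambda>p. \<Sum>i\<in>{0..6}. \<Sum>S\<in>U6. M i I S * (Dop i (\<alpha> S) p * cnj (\<beta> K p)))"
        by (rule HOL.ext) (simp add: M(2)[OF \<alpha>] sum_distrib_right mult.assoc)
      moreover have "CI (\<lambda>p. Dop i (\<alpha> S) p * cnj (\<beta> K p))" if "i \<in> {0..6}" for i S
        by (rule cm[OF SI_Dop[OF VD(1)[OF \<alpha>] that] VD(1)[OF \<beta>]])
      ultimately have "IF (\<lambda>p. A \<alpha> I p * cnj (\<beta> K p)) = (\<Sum>i\<in>{0..6}. \<Sum>S\<in>U6. M i I S * IF (\<lambda>p. Dop i (\<alpha> S) p * cnj (\<beta> K p)))"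
        by (simp only:) (rule IF_lin2, auto)
      also have "\<dots> = (\<Sum>i\<in>{0..6}. \<Sum>S\<in>U6. M i I S * (e i * IF (\<lambda>p. \<alpha> S p * cnj (Dop i (\<beta> K) p))))"
        unfolding e_def by (intro sum.cong refl arg_cong2[where f="(*)"] IF_Dop VD \<alpha> \<beta>)
      finally show "h I K * IF (\<lambda>p. A \<alpha> I p * cnj (\<beta> K p)) =
          (\<Sum>i\<in>{0..6}. \<Sum>S\<in>U6. h I K * M i I S * e i * IF (\<lambda>p. \<alpha> S p * cnj (Dop i (\<beta> K) p)))"
        by (simp add: sum_distrib_left mult.assoc)
    qed
    also have "\<dots> = (\<Sum>S\<in>U6. \<Sum>I\<in>U6. \<Sum>K\<in>U6. \<Sum>i\<in>{0..6}. h I K * M i I S * e i * IF (\<lambda>p. \<alpha> S p * cnj (Dop i (\<beta> K) p)))"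
      by (rule sum_swap4)
    also have "\<dots> = (\<Sum>S\<in>U6. IF (\<lambda>p. \<alpha> S p * cnj (w S p)))"
    proof (intro sum.cong refl)
      fix S :: "nat set" assume "S \<in> U6"
      have w: "(\<lambda>p. \<alpha> S p * cnj (w S p)) = (\<lambda>p. \<Sum>I\<in>U6. \<Sum>K\<in>U6. \<Sum>i\<in>{0..6}. h I K * M i I S * e i * (\<alpha> S p * cnj (Dop i (\<beta> K) p)))"
        by (rule HOL.ext) (simp add: w_def sum_distrib_left mult_ac)
      have c: "CI (\<lambda>p. \<alpha> S p * cnj (Dop i (\<beta> K) p))" if "i \<in> {0..6}" for K i
        by (rule cm[OF VD(1)[OF \<alpha>] SI_Dop[OF VD(1)[OF \<beta>] that]])
      have "IF (\<lambda>p. \<Sum>I\<in>U6. \<Sum>K\<in>U6. \<Sum>i\<in>{0..6}. h I K * M i I S * e i * (\<alpha> S p * cnj (Dop i (\<beta> K) p)))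
        = (\<Sum>I\<in>U6. IF (\<lambda>p. \<Sum>K\<in>U6. \<Sum>i\<in>{0..6}. h I K * M i I S * e i * (\<alpha> S p * cnj (Dop i (\<beta> K) p))))"
        by (intro IF_sum CI_sum CI_mult[OF CI_const] c) auto
      also have "\<dots> = (\<Sum>I\<in>U6. \<Sum>K\<in>U6. \<Sum>i\<in>{0..6}. h I K * M i I S * e i * IF (\<lambda>p. \<alpha> S p * cnj (Dop i (\<beta> K) p)))"
        by (intro sum.cong[OF refl] IF_lin2 c) auto
      finally show "(\<Sum>I\<in>U6. \<Sum>K\<in>U6. \<Sum>i\<in>{0..6}. h I K * M i I S * e i * IF (\<lambda>p. \<alpha> S p * cnj (Dop i (\<beta> K) p)))
         = IF (\<lambda>p. \<alpha> S p * cnj (w S p))"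
        unfolding w by (rule sym)
    qed
    also have "\<dots> = IF (\<lambda>p. \<Sum>S\<in>U6. \<alpha> S p * cnj (w S p))"
      using VD(1)[OF \<alpha>] SIw by (intro IF_sum[symmetric] cm) auto
    also have "(\<lambda>p. \<Sum>S\<in>U6. \<alpha> S p * cnj (w S p)) = pip a b c \<alpha> \<gamma>"
    proof
      fix p
      have hr: "cnj (h I K) = h I K" for I K unfolding h_def cnj_wl by simp
      have "(\<Sum>K\<in>U6. h I K * \<gamma> K p) = w I p" if I: "I \<in> U6" for I
      proof -
        have "(\<Sum>K\<in>U6. h I K * \<gamma> K p) = (\<Sum>K\<in>U6. \<Sum>J\<in>U6. h I K * wl (cG a b c) (sl K) J * w J p)"
          unfolding \<gamma>_def by (intro sum.cong refl) (simp add: sum_distrib_left mult.assoc)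
        also have "\<dots> = (\<Sum>J\<in>U6. (\<Sum>K\<in>U6. h I K * wl (cG a b c) (sl K) J) * w J p)"
          by (subst sum.swap) (simp add: sum_distrib_right)
        also have "\<dots> = (\<Sum>J\<in>U6. if J = I then w J p else 0)"
          using I unfolding h_def by (intro sum.cong refl) (simp only: wl_cH_cG[OF an0 cn0] Pow_iff, simp)
        finally show ?thesis using I by simp
      qed
      then have "(\<Sum>S\<in>U6. \<alpha> S p * cnj (w S p)) = (\<Sum>S\<in>U6. \<alpha> S p * cnj (\<Sum>K\<in>U6. h S K * \<gamma> K p))" by simp
      also have "\<dots> = pip a b c \<alpha> \<gamma> p"
        unfolding pip_eq_wl[OF an0 cn0] h_def[symmetric] by (simp add: sum_distrib_left hr mult_ac)
      finally show "(\<Sum>S\<in>U6. \<alpha> S p * cnj (w S p)) = pip a b c \<alpha> \<gamma> p" .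
    qed
    finally show ?thesis .
  qed
  then show ?thesis using \<gamma>V unfolding L2ip_IF by (intro bexI[of _ \<gamma>]) auto
qed

abbreviation adj :: "form \<Rightarrow> form" where "adj \<equiv> dbar_mu_adj a b c a0 P"

lemma adj:
  assumes "\<beta> \<in> V"
  shows "adj \<beta> \<in> V" "\<alpha> \<in> V \<Longrightarrow> L2ip a b c a0 P (dbar_mu a b c \<alpha>) \<beta> = L2ip a b c a0 P \<alpha> (adj \<beta>)"
proof -
  obtain \<gamma> where g: "\<gamma> \<in> V" "\<forall>\<alpha>\<in>V. L2ip a b c a0 P (dbar_mu a b c \<alpha>) \<beta> = L2ip a b c a0 P \<alpha> \<gamma>"
    using adjoint_exists[OF FO_dbar_mu assms] by blast
  have "adj \<beta> = \<gamma>" unfolding dbar_mu_adj_def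
    by (rule the_equality) (use g in \<open>auto intro: adjoint_unique\<close>)
  then show "adj \<beta> \<in> V" "\<alpha> \<in> V \<Longrightarrow> L2ip a b c a0 P (dbar_mu a b c \<alpha>) \<beta> = L2ip a b c a0 P \<alpha> (adj \<beta>)"
    using g by auto
qed

lemma zero_V: "0 \<in> V"
  by (simp add: smooth_forms_iff supp6_def zero_fun_def SI_const)

lemma L2ip_zero: "L2ip a b c a0 P 0 \<beta> = 0" "L2ip a b c a0 P \<beta> 0 = 0"
proof -
  have "pip a b c 0 \<beta> = (\<lambda>p. 0)" "pip a b c \<beta> 0 = (\<lambda>p. 0)" by (rule HOL.ext, simp add: pip_def zero_fun_def cong: if_cong)+
  then show "L2ip a b c a0 P 0 \<beta> = 0" "L2ip a b c a0 P \<beta> 0 = 0" by (simp_all only: L2ip_IF IF_zero mult_zero_left)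
qed

lemma adj_zero_iff:
  assumes "\<psi> \<in> V"
  shows "adj \<psi> = 0 \<longleftrightarrow> (\<forall>\<beta>\<in>V. L2ip a b c a0 P (dbar_mu a b c \<beta>) \<psi> = 0)"
proof
  assume "adj \<psi> = 0"
  then show "\<forall>\<beta>\<in>V. L2ip a b c a0 P (dbar_mu a b c \<beta>) \<psi> = 0" using adj(2)[OF assms] L2ip_zero by simp
next
  assume "\<forall>\<beta>\<in>V. L2ip a b c a0 P (dbar_mu a b c \<beta>) \<psi> = 0"
  then show "adj \<psi> = 0" using adj[OF assms] L2ip_zero by (intro adjoint_unique zero_V) auto
qed

lemma dbar_mu_zero: "dbar_mu a b c 0 = 0"
proof -
  obtain M where M0: "\<forall>i T S. \<not> T \<subseteq> {1..6} \<longrightarrow> M i T S = 0"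
    "\<forall>\<alpha>\<in>V. \<forall>T p. dbar_mu a b c \<alpha> T p = (\<Sum>i\<in>{0..6}. \<Sum>S\<in>U6. M i T S * Dop i (\<alpha> S) p)"
    by (rule FO_E[OF FO_dbar_mu])
  note M = M0[rule_format]
  from M(2)[OF zero_V] show ?thesis by (simp add: fun_eq_iff zero_fun_def Dop_zero)
qed

text \<open>Pairing the Laplacian of psi with psi gives the sum of the squared norms of its images
  under the operator and its adjoint; both must vanish.\<close>

lemma Lap_zero_iff:
  assumes \<psi>: "\<psi> \<in> V"
  shows "Lap a b c a0 P \<psi> = 0 \<longleftrightarrow> dbar_mu a b c \<psi> = 0 \<and> adj \<psi> = 0"
proof
  assume L: "Lap a b c a0 P \<psi> = 0"
  note dV = dbar_mu_V[OF \<psi>] and aV = adj(1)[OF \<psi>]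
  have "Lap a b c a0 P \<psi> = (\<lambda>T p. 1 * dbar_mu a b c (adj \<psi>) T p + 1 * adj (dbar_mu a b c \<psi>) T p)"
    by (simp add: Lap_def fun_eq_iff)
  then have "0 = L2ip a b c a0 P (\<lambda>T p. 1 * dbar_mu a b c (adj \<psi>) T p + 1 * adj (dbar_mu a b c \<psi>) T p) \<psi>"
    using L L2ip_zero by simp
  also have "\<dots> = L2ip a b c a0 P (dbar_mu a b c (adj \<psi>)) \<psi> + L2ip a b c a0 P (adj (dbar_mu a b c \<psi>)) \<psi>"
    by (subst L2ip_comb_left) (use dV aV \<psi> dbar_mu_V adj(1) in auto)
  also have "L2ip a b c a0 P (dbar_mu a b c (adj \<psi>)) \<psi> = L2ip a b c a0 P (adj \<psi>) (adj \<psi>)"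
    by (rule adj(2)[OF \<psi> aV])
  also have "L2ip a b c a0 P (adj (dbar_mu a b c \<psi>)) \<psi> = cnj (L2ip a b c a0 P \<psi> (adj (dbar_mu a b c \<psi>)))"
    by (rule L2ip_cnj[symmetric, OF \<psi> adj(1)[OF dV]])
  also have "L2ip a b c a0 P \<psi> (adj (dbar_mu a b c \<psi>)) = L2ip a b c a0 P (dbar_mu a b c \<psi>) (dbar_mu a b c \<psi>)"
    by (rule adj(2)[symmetric, OF dV \<psi>])
  finally have "complex_of_real ((nrm (adj \<psi>) + nrm (dbar_mu a b c \<psi>)) * kap) = 0"
    by (simp add: nrm(1)[OF dV] nrm(1)[OF aV] algebra_simps)
  then have "nrm (adj \<psi>) + nrm (dbar_mu a b c \<psi>) = 0" using kap_nonzero by (simp del: of_real_add of_real_mult)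
  then have "nrm (adj \<psi>) = 0" "nrm (dbar_mu a b c \<psi>) = 0"
    using nrm(2)[OF dV] nrm(2)[OF aV] by linarith+
  then show "dbar_mu a b c \<psi> = 0 \<and> adj \<psi> = 0" using nrm(3) dV aV by blast
next
  assume "dbar_mu a b c \<psi> = 0 \<and> adj \<psi> = 0"
  moreover have "adj 0 = 0" using adj_zero_iff[OF zero_V] L2ip_zero by blast
  ultimately show "Lap a b c a0 P \<psi> = 0" by (simp add: Lap_def dbar_mu_zero)
qed

end

section \<open>Structure equations\<close>

lemma sg_least: "(\<And>i. i \<in> S \<Longrightarrow> k \<le> i) \<Longrightarrow> sg k S = 1"
proof -
  assume "\<And>i. i \<in> S \<Longrightarrow> k \<le> i"
  then have "{i\<in>S. i < k} = {}" by force
  then show ?thesis unfolding sg_def by (simp only: card.empty power_0)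
qed

lemma lw_single: "k \<in> {1..6} \<Longrightarrow> lw u x {k} = u k * x {}"
  using sg_least[of "{k}" k] by (simp add: lw_def)

lemma lw_pair:
  assumes "k < l" "k \<in> {1..6}" "l \<in> {1..6}"
  shows "lw u x {k,l} = u k * x {l} - u l * x {k}"
proof -
  have "sg k {k,l} = 1" using assms by (intro sg_least) auto
  moreover have "sg l ({k,l} - {k}) = - sg l {k,l}" using assms by (intro sg_remove_less) auto
  moreover have "{k,l} - {k} = {l}" "{k,l} - {l} = {k}" using assms by auto
  moreover have "sg l {l} = 1" by (rule sg_least) auto
  moreover have "- sg l {k,l} = 1 \<Longrightarrow> sg l {k,l} = -1" by (metis minus_minus)
  ultimately show ?thesis using assms by (simp add: lw_def)
qed

lemma lw_triple:
  assumes "k < l" "l < m" "k \<in> {1..6}" "l \<in> {1..6}" "m \<in> {1..6}"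
  shows "lw u x {k,l,m} = u k * x {l,m} - u l * x {k,m} + u m * x {k,l}"
proof -
  have "sg k {k,l,m} = 1" using assms by (intro sg_least) auto
  moreover have "sg l ({k,l,m} - {k}) = - sg l {k,l,m}" "sg m ({k,l,m} - {k}) = - sg m {k,l,m}"
    using assms by (intro sg_remove_less; auto)+
  moreover have "sg m ({l,m} - {l}) = - sg m {l,m}" using assms by (intro sg_remove_less) auto
  moreover have "{k,l,m} - {k} = {l,m}" "{k,l,m} - {l} = {k,m}" "{k,l,m} - {m} = {k,l}" "{l,m} - {l} = {m}" using assms by auto
  moreover have "sg l {l,m} = 1" "sg m {m} = 1" using assms by (intro sg_least; auto)+
  moreover have "- sg l {k,l,m} = 1 \<Longrightarrow> sg l {k,l,m} = -1" by (metis minus_minus)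
  ultimately show ?thesis using assms by (simp add: lw_def)
qed

abbreviation on0 :: "nat set \<Rightarrow> complex" where "on0 \<equiv> wl dl []"

text \<open>Two-forms are even: passing a one-form across costs two signs, which cancel.\<close>

lemma dq_lw: "dq M i (lw u x) S = lw u (dq M i x) S"
proof -
  have c: "lw v (lw w (lw u x)) S = lw u (lw v (lw w x)) S" for v w S
  proof -
    have "lw v (lw w (lw u x)) S = lw v (\<lambda>S. (-1) * lw u (lw w x) S) S"
      by (subst lw_anticomm[of w u, abs_def]) simp
    also have "\<dots> = - lw v (lw u (lw w x)) S" by (simp only: lw_scale) simp
    finally show ?thesis by (simp add: lw_anticomm[of v u])
  qed
  have d: "lw u (\<lambda>S. - f S - g S) S = - lw u f S - lw u g S" "lw u (\<lambda>S. f S - g S) S = lw u f S - lw u g S"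
    "lw u (\<lambda>S. - f S) S = - lw u f S" "lw u (\<lambda>S. 0) S = 0" for f g :: "nat set \<Rightarrow> complex"
    by (simp_all add: lw_def algebra_simps sum_subtractf sum_negf)
  show ?thesis unfolding dq_def[abs_def] by (auto simp: c d)
qed

lemma dq_linear:
  "dq M i (\<lambda>S. x S + y S) S = dq M i x S + dq M i y S"
  "dq M i (\<lambda>S. z * x S) S = z * dq M i x S"
  by (simp_all add: dq_def lw_add[abs_def] lw_scale[abs_def] lw_add lw_scale algebra_simps)

lemma dq_zero: "dq M i (\<lambda>S. 0) S = 0"
  using dq_linear(2)[of M i 0 "\<lambda>S. 0" S] by simp

lemma dq_sum: "dq M i (\<lambda>S. \<Sum>a\<in>A. f a S) S = (\<Sum>a\<in>A. dq M i (f a) S)"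
  by (induction A rule: infinite_finite_induct) (simp_all add: dq_zero dq_linear(1))

lemma dc_scale: "dc (\<lambda>S. z * x S) S = z * dc x S"
  by (simp add: dc_def sum_distrib_left mult.assoc)

lemma dc_sum: "dc (\<lambda>S. \<Sum>a\<in>A. f a S) S = (\<Sum>a\<in>A. dc (f a) S)"
  by (simp add: dc_def sum_distrib_right) (rule sum.swap)

lemma dc_basis: "T \<subseteq> {1..6} \<Longrightarrow> dc (wl dl (sl T)) S = dcl (sl T) S"
proof -
  assume T: "T \<subseteq> {1..6}"
  have "dc (wl dl (sl T)) S = (\<Sum>R\<in>Pow {1..6}. if R = T then dcl (sl T) S else 0)"
    unfolding dc_def by (intro sum.cong refl) (auto simp: wl_dl[OF T])
  then show ?thesis using T by simp
qed

lemma dc_one_form: "dc (lw u on0) S = (\<Sum>j\<in>{1..6}. u j * dq dl j on0 S)"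
proof -
  have "dc (lw (dl j) on0) S = dq dl j on0 S" if "j \<in> {1..6}" for j
    using dc_basis[of "{j}" S] that by (simp add: lw_def)
  moreover have "lw u on0 = (\<lambda>S. \<Sum>j\<in>{1..6}. u j * lw (dl j) on0 S)" using lw_expand by blast
  ultimately show ?thesis by (simp only: dc_sum dc_scale cong: sum.cong)
qed

text \<open>\<open>dc\<close> applies the Leibniz rule to increasing lists only. The other pairs
  follow from anticommutation, because the two-forms d e^j and d e^l commute with one-forms.\<close>

lemma dc_basis_pair:
  assumes "j \<in> {1..6}" "l \<in> {1..6}"
  shows "dc (lw (dl j) (lw (dl l) on0)) S = dq dl j (lw (dl l) on0) S - lw (dl j) (dq dl l on0) S"
proof -
  have lt: "dc (lw (dl j) (lw (dl l) on0)) S = dq dl j (lw (dl l) on0) S - lw (dl j) (dq dl l on0) S"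
    if "j < l" "j \<in> {1..6}" "l \<in> {1..6}" for j l
  proof -
    have s: "sl {j,l} = [j,l]" using that by (intro sorted_distinct_set_unique) auto
    have "dcl [l] = dq dl l on0" by (rule HOL.ext) (simp add: lw_def)
    moreover have "dcl [j,l] S = dq dl j (wl dl [l]) S - lw (dl j) (dcl [l]) S"
      by (rule fun_cong[OF dcl.simps(2)])
    moreover have "dc (wl dl [j,l]) S = dcl [j,l] S" using dc_basis[of "{j,l}" S] that unfolding s by simp
    ultimately show ?thesis by (simp only: wl.simps(2))
  qed
  consider "j < l" | "j = l" | "l < j" by linarith
  then show ?thesis
  proof cases
    case 1
    then show ?thesis using lt assms by blast
  next
    case 2
    have "lw (dl l) (lw (dl l) on0) = (\<lambda>S. 0)" by (rule HOL.ext) (rule lw_lw_same)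
    then show ?thesis unfolding 2 by (simp only: dq_lw) (simp add: dc_def)
  next
    case 3
    have "lw (dl j) (lw (dl l) on0) = (\<lambda>S. (-1) * lw (dl l) (lw (dl j) on0) S)"
      by (rule HOL.ext) (simp only: lw_anticomm[of "dl j"] mult_minus_left mult_1)
    then have "dc (lw (dl j) (lw (dl l) on0)) S = - dc (lw (dl l) (lw (dl j) on0)) S"
      by (simp only: dc_scale) simp
    also have "\<dots> = - (dq dl l (lw (dl j) on0) S - lw (dl l) (dq dl j on0) S)" using lt[OF 3] assms by simp
    finally show ?thesis by (simp only: dq_lw) simp
  qed
qed

lemma dc_two_form: "dc (lw u (lw v on0)) S =
  (\<Sum>j\<in>{1..6}. u j * dq dl j (lw v on0) S) - lw u (\<lambda>R. \<Sum>l\<in>{1..6}. v l * dq dl l on0 R) S"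
proof -
  have v: "lw v on0 = (\<lambda>S. \<Sum>l\<in>{1..6}. v l * lw (dl l) on0 S)" using lw_expand by blast
  have "lw u (lw v on0) = (\<lambda>S. \<Sum>j\<in>{1..6}. u j * (\<Sum>l\<in>{1..6}. v l * lw (dl j) (lw (dl l) on0) S))"
    by (rule HOL.ext, subst lw_expand, subst v) (simp only: lw_sum lw_scale)
  then have "dc (lw u (lw v on0)) S = (\<Sum>j\<in>{1..6}. u j * (\<Sum>l\<in>{1..6}. v l * dc (lw (dl j) (lw (dl l) on0)) S))"
    by (simp only: dc_sum dc_scale)
  also have "\<dots> = (\<Sum>j\<in>{1..6}. u j * (\<Sum>l\<in>{1..6}. v l * (dq dl j (lw (dl l) on0) S - lw (dl j) (dq dl l on0) S)))"
    by (intro sum.cong refl arg_cong2[where f="(*)"] dc_basis_pair)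
  also have "\<dots> = (\<Sum>j\<in>{1..6}. u j * (dq dl j (lw v on0) S - lw (dl j) (\<lambda>R. \<Sum>l\<in>{1..6}. v l * dq dl l on0 R) S))"
    unfolding v by (simp only: dq_sum dq_linear lw_sum lw_scale right_diff_distrib sum_subtractf)
  also have "\<dots> = (\<Sum>j\<in>{1..6}. u j * dq dl j (lw v on0) S) - (\<Sum>j\<in>{1..6}. u j * lw (dl j) (\<lambda>R. \<Sum>l\<in>{1..6}. v l * dq dl l on0 R) S)"
    by (simp only: right_diff_distrib sum_subtractf)
  finally show ?thesis by (simp only: lw_expand[of u, symmetric])
qed

lemma ext_dq: "ext M (dq dl i x) S = dq M i (ext M x) S"
proof -
  have e: "ext M (lw (dl j) (lw (dl k) y)) S = lw (M j) (lw (M k) (ext M y)) S"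
    if "j \<in> {1..6}" "k \<in> {1..6}" for j k y S
  proof -
    have "ext M (lw (dl k) y) = lw (M k) (ext M y)" by (rule HOL.ext) (rule ext_lw_dl[OF that(2)])
    then show ?thesis by (simp add: ext_lw_dl[OF that(1)])
  qed
  have d: "ext M (\<lambda>S. - f S - g S) S = - ext M f S - ext M g S" "ext M (\<lambda>S. f S - g S) S = ext M f S - ext M g S"
    "ext M (\<lambda>S. - f S) S = - ext M f S" "ext M (\<lambda>S. 0) S = 0" for f g :: "nat set \<Rightarrow> complex"
    by (simp_all add: ext_def algebra_simps sum_subtractf sum_negf)
  show ?thesis unfolding dq_def[abs_def] by (auto simp: e d)
qed

lemma ty_cases:
  "ty 1 0 S \<longleftrightarrow> S = {1} \<or> S = {2} \<or> S = {3}"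
  "ty 2 0 S \<longleftrightarrow> S = {1,2} \<or> S = {1,3} \<or> S = {2,3}"
  "ty 3 0 S \<longleftrightarrow> S = {1,2,3}"
proof -
  have P: "S \<subseteq> {1,2,3} \<and> card S = r" if "ty r 0 S" for r
  proof -
    have S: "S \<subseteq> {1..6}" "card (S \<inter> {1,2,3}) = r" "card (S \<inter> {4,5,6}) = 0" using that by (simp_all add: ty_def)
    then have "S \<inter> {4,5,6} = {}" by simp
    have "S \<subseteq> {1,2,3}"
    proof
      fix i assume "i \<in> S"
      then have "i \<in> {1..6}" "i \<noteq> 4" "i \<noteq> 5" "i \<noteq> 6" using S(1) \<open>S \<inter> {4,5,6} = {}\<close> by auto
      then show "i \<in> {1,2,3}" unfolding in6 by simp
    qed
    then show ?thesis using S(2) by (simp add: Int_absorb2)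
  qed
  show "ty 1 0 S \<longleftrightarrow> S = {1} \<or> S = {2} \<or> S = {3}"
  proof
    assume "ty 1 0 S"
    then have S: "S \<subseteq> {1,2,3}" "card S = 1" using P by auto
    obtain x where "S = {x}" using S(2) by (rule card_1_singletonE)
    then show "S = {1} \<or> S = {2} \<or> S = {3}" using S(1) by simp
  qed (elim disjE; simp add: ty_def)
  show "ty 2 0 S \<longleftrightarrow> S = {1,2} \<or> S = {1,3} \<or> S = {2,3}"
  proof
    assume "ty 2 0 S"
    then have S: "S \<subseteq> {1,2,3}" "card S = 2" using P by auto
    then obtain x y where xy: "S = {x,y}" "x \<noteq> y" by (auto simp: card_2_iff)
    then have "x = 1 \<or> x = 2 \<or> x = 3" "y = 1 \<or> y = 2 \<or> y = 3" using S(1) by auto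
    then show "S = {1,2} \<or> S = {1,3} \<or> S = {2,3}" using xy by (elim disjE) (simp_all add: insert_commute)
  qed (elim disjE; simp add: ty_def)
  show "ty 3 0 S \<longleftrightarrow> S = {1,2,3}"
  proof
    assume "ty 3 0 S"
    then have "S \<subseteq> {1,2,3}" "card S = 3" using P by auto
    then show "S = {1,2,3}" by (intro card_subset_eq) auto
  qed (simp add: ty_def)
qed

context almost_kaehler
begin

text \<open>\<open>th1 k S\<close> and \<open>th2 k l S\<close> are the coefficients of \<open>\<theta>\<^sub>S\<close> in \<open>d \<theta>\<^sup>k\<close> and \<open>d (\<theta>\<^sup>k \<and> \<theta>\<^sup>l)\<close>.\<close>
definition th1 :: "nat \<Rightarrow> nat set \<Rightarrow> complex" where
  "th1 k S = (\<Sum>j\<in>{1..6}. thc a b c k j * dq (Nc a b c) j on0 S)"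

definition th2 :: "nat \<Rightarrow> nat \<Rightarrow> nat set \<Rightarrow> complex" where
  "th2 k l S = (\<Sum>j\<in>{1..6}. thc a b c k j * dq (Nc a b c) j (lw (dl l) on0) S) - lw (dl k) (th1 l) S"

lemma ext_on0: "ext M on0 = on0"
  using ext_wl[of M dl "[]"] by simp

lemma lw_mm: "k \<in> {1..6} \<Longrightarrow> lw (\<lambda>l. \<Sum>j\<in>{1..6}. thc a b c k j * Nc a b c j l) x = lw (dl k) x"
  by (rule lw_cong) (use mm_thc_Nc[OF an0 cn0] in \<open>auto simp: mm_def\<close>)

lemma ext_dc_theta1: "k \<in> {1..6} \<Longrightarrow> ext (Nc a b c) (dc (wl (thc a b c) [k])) S = th1 k S"
proof -
  have "dc (wl (thc a b c) [k]) = (\<lambda>S. \<Sum>j\<in>{1..6}. thc a b c k j * dq dl j on0 S)"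
    by (rule HOL.ext) (use dc_one_form in simp)
  then show "?thesis" by (simp only: ext_sum ext_scale ext_dq ext_on0 th1_def)
qed

lemma ext_dc_theta2:
  assumes "k \<in> {1..6}" "l \<in> {1..6}"
  shows "ext (Nc a b c) (dc (wl (thc a b c) [k,l])) S = th2 k l S"
proof -
  let ?N = "Nc a b c"
  have e1: "ext ?N (lw (thc a b c l) on0) = lw (dl l) on0"
    by (rule HOL.ext) (simp only: ext_lw ext_on0 lw_mm[OF assms(2)])
  have e2: "ext ?N (\<lambda>R. \<Sum>m\<in>{1..6}. thc a b c l m * dq dl m on0 R) = th1 l"
    by (rule HOL.ext) (simp only: ext_sum ext_scale ext_dq ext_on0 th1_def)
  have "dc (wl (thc a b c) [k,l]) = (\<lambda>S. (\<Sum>j\<in>{1..6}. thc a b c k j * dq dl j (lw (thc a b c l) on0) S)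
     + (-1) * lw (thc a b c k) (\<lambda>R. \<Sum>m\<in>{1..6}. thc a b c l m * dq dl m on0 R) S)"
    by (rule HOL.ext) (use dc_two_form[of "thc a b c k" "thc a b c l"] in simp)
  then have "ext ?N (dc (wl (thc a b c) [k,l])) S = (\<Sum>j\<in>{1..6}. thc a b c k j * dq ?N j (lw (dl l) on0) S)
     + (-1) * ext ?N (lw (thc a b c k) (\<lambda>R. \<Sum>m\<in>{1..6}. thc a b c l m * dq dl m on0 R)) S"
    by (simp only: ext_add ext_sum ext_scale ext_dq e1)
  also have "ext ?N (lw (thc a b c k) (\<lambda>R. \<Sum>m\<in>{1..6}. thc a b c l m * dq dl m on0 R)) S = lw (dl k) (th1 l) S"
    by (simp only: ext_lw e2 lw_mm[OF assms(1)])
  finally show ?thesis by (simp add: th2_def)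
qed

lemma lw_lw_on0_pair:
  "k < l \<Longrightarrow> k \<in> {1..6} \<Longrightarrow> l \<in> {1..6} \<Longrightarrow> lw u (lw v on0) {k,l} = u k * v l - u l * v k"
  by (simp add: lw_pair lw_single del: wl.simps) simp

lemma th1_1: "th1 1 S = 0"
  unfolding th1_def sum6 by (simp add: thc_def phc_def dq_def)

text \<open>The entries used later. For k = 2, 3 they are (1,1)-components of d theta^k, the
  inhomogeneous terms in degree (1,0); for k = 5, 6 they are (2,0)-components of d of conjugate
  forms, that is, values of mu.\<close>

lemma th1_values:
  "th1 2 {1,5} = - (1 / (2 * a))" "th1 2 {1,6} = - (c / 4)"
  "th1 3 {1,5} = - (c / 4)" "th1 3 {1,6} = 1 / (2 * a)"
  "th1 2 {2,5} = 0" "th1 2 {2,6} = 0" "th1 2 {3,5} = 0" "th1 2 {3,6} = 0"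
  "th1 3 {2,5} = 0" "th1 3 {2,6} = 0" "th1 3 {3,5} = 0" "th1 3 {3,6} = 0"
  "th1 5 {1,2} = - (1 / (2 * a))" "th1 5 {1,3} = c / 4" "th1 5 {2,3} = 0"
  "th1 6 {1,2} = c / 4" "th1 6 {1,3} = 1 / (2 * a)" "th1 6 {2,3} = 0"
  unfolding th1_def sum6 dq_def
  using an0 cn0 by (simp_all add: lw_lw_on0_pair thc_def phc_def Nc_def field_simps del: wl.simps)

text \<open>The first entry removes the last coefficient in degree (2,0); the second is a value of
  mu from (1,1) to (3,0).\<close>

lemma th2_values: "th2 2 3 {1,3,5} = 1 / (2 * a)" "th2 3 5 {1,2,3} = 1 / (2 * a)"
  unfolding th2_def th1_def sum6 dq_def
  using an0 cn0 by (simp_all add: lw_triple lw_pair lw_single thc_def phc_def Nc_def dl_def field_simps)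

section \<open>The operators in coframe coefficients\<close>

lemma Eder_zero_fun: "(\<And>p. f p = 0) \<Longrightarrow> Eder i f p = 0"
proof -
  assume "\<And>p. f p = 0"
  then have "f = (\<lambda>p. 0)" by auto
  then show ?thesis by (simp add: Eder_const)
qed

lemma Eder_tc: "\<alpha> \<in> V \<Longrightarrow> ext (Nc a b c) (\<lambda>T. Eder i (\<alpha> T) p) S = Eder i (tc \<alpha> S) p"
proof -
  assume \<alpha>: "\<alpha> \<in> V"
  have "tc \<alpha> S = (\<lambda>p. \<Sum>T\<in>U6. wl (Nc a b c) (sl T) S * \<alpha> T p)"
    by (rule HOL.ext) (simp add: tc_def ext_def mult.commute)
  then have "Eder i (tc \<alpha> S) p = (\<Sum>T\<in>U6. Eder i (\<lambda>p. wl (Nc a b c) (sl T) S * \<alpha> T p) p)"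
    using VD(3)[OF \<alpha>] by (simp only:) (intro Eder_sum differentiable_mult, auto)
  also have "\<dots> = (\<Sum>T\<in>U6. wl (Nc a b c) (sl T) S * Eder i (\<alpha> T) p)"
    by (intro sum.cong refl Eder_scale VD(3)[OF \<alpha>])
  finally show ?thesis by (simp add: ext_def mult.commute)
qed

text \<open>The direction theta^k is differentiated by its dual field, the sum over i of
  \<open>Nc a b c i k\<close> times E_i. The second sum carries the structure equations of the
  complex coframe.\<close>

lemma tc_dext:
  assumes \<alpha>: "\<alpha> \<in> V"
  shows "tc (dext \<alpha>) S p = (\<Sum>i\<in>{1..6}. lw (Nc a b c i) (\<lambda>T. Eder i (tc \<alpha> T) p) S)
     + (\<Sum>R\<in>U6. tc \<alpha> R p * ext (Nc a b c) (dc (wl (thc a b c) (sl R))) S)"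
proof -
  have "(\<lambda>T. \<alpha> T p) = (\<lambda>T. \<Sum>R\<in>U6. tc \<alpha> R p * wl (thc a b c) (sl R) T)"
    by (rule HOL.ext) (use form_tc[OF \<alpha>] in \<open>simp add: ext_def\<close>)
  then have d: "dc (\<lambda>T. \<alpha> T p) = (\<lambda>T. \<Sum>R\<in>U6. tc \<alpha> R p * dc (wl (thc a b c) (sl R)) T)"
    by (simp only: dc_sum[abs_def] dc_scale)
  have l: "ext (Nc a b c) (lw (dl i) (\<lambda>T. Eder i (\<alpha> T) p)) S = lw (Nc a b c i) (\<lambda>T. Eder i (tc \<alpha> T) p) S"
    if "i \<in> {1..6}" for i
    using that by (simp only: ext_lw_dl Eder_tc[OF \<alpha>, abs_def])
  have "tc (dext \<alpha>) S p = (\<Sum>i\<in>{1..6}. ext (Nc a b c) (lw (dl i) (\<lambda>T. Eder i (\<alpha> T) p)) S)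
     + (\<Sum>R\<in>U6. tc \<alpha> R p * ext (Nc a b c) (dc (wl (thc a b c) (sl R))) S)"
    unfolding tc_def[of "dext \<alpha>"] dext_eq d by (simp only: ext_add ext_sum ext_scale)
  also have "(\<Sum>i\<in>{1..6}. ext (Nc a b c) (lw (dl i) (\<lambda>T. Eder i (\<alpha> T) p)) S)
      = (\<Sum>i\<in>{1..6}. lw (Nc a b c i) (\<lambda>T. Eder i (tc \<alpha> T) p) S)"
    by (intro sum.cong refl l)
  finally show ?thesis .
qed

lemma dext_V: "\<alpha> \<in> V \<Longrightarrow> dext \<alpha> \<in> V"
  by (rule FO_V[OF FO_dext])

lemma tc_proj: "\<alpha> \<in> V \<Longrightarrow> tc (proj a b c r s \<alpha>) S p = (if ty r s S then tc \<alpha> S p else 0)"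
proof -
  assume \<alpha>: "\<alpha> \<in> V"
  have t: "thcoef a b c \<beta> p = ext (Nc a b c) (\<lambda>T. \<beta> T p)" if "\<beta> \<in> V" for \<beta>
    by (rule thcoef_eq) (use an0 cn0 VD(2)[OF that] in auto)
  show ?thesis using thcoef_proj[OF an0 cn0, of b r s \<alpha> p S]
    unfolding t[OF \<alpha>] t[OF proj_V[OF \<alpha>]] by (simp add: tc_def)
qed

lemma tc_dbar_mu:
  assumes \<alpha>: "\<alpha> \<in> V"
  shows "tc (dbar_mu a b c \<alpha>) S p = (\<Sum>r\<le>3. \<Sum>s\<le>3.
      (if ty r (s + 1) S then tc (dext (proj a b c r s \<alpha>)) S p else 0)
      + (if 1 \<le> s \<and> ty (r + 2) (s - 1) S then tc (dext (proj a b c r s \<alpha>)) S p else 0))"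
proof -
  have V: "dext (proj a b c r s \<alpha>) \<in> V" for r s by (rule dext_V[OF proj_V[OF \<alpha>]])
  have "tc (dbar_mu a b c \<alpha>) S p = (\<Sum>r\<le>3. \<Sum>s\<le>3. tc (proj a b c r (s + 1) (dext (proj a b c r s \<alpha>))) S p
      + ext (Nc a b c) (\<lambda>T. if 1 \<le> s then proj a b c (r + 2) (s - 1) (dext (proj a b c r s \<alpha>)) T p else 0) S)"
    unfolding tc_def dbar_mu_def by (simp only: ext_add ext_sum)
  moreover have "ext (Nc a b c) (\<lambda>T. if 1 \<le> s then proj a b c (r + 2) (s - 1) (dext (proj a b c r s \<alpha>)) T p else 0) S
      = (if 1 \<le> s \<and> ty (r + 2) (s - 1) S then tc (dext (proj a b c r s \<alpha>)) S p else 0)" for r s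
    using tc_proj[OF V, of "r + 2" "s - 1" r s S p] by (cases "1 \<le> s") (simp_all add: tc_def ext_def[of _ "\<lambda>T. 0"])
  ultimately show ?thesis by (simp only: tc_proj[OF V])
qed

lemma pure_iff:
  assumes \<alpha>: "\<alpha> \<in> V"
  shows "proj a b c r s \<alpha> = \<alpha> \<longleftrightarrow> (\<forall>S p. \<not> ty r s S \<longrightarrow> tc \<alpha> S p = 0)"
proof
  assume "proj a b c r s \<alpha> = \<alpha>"
  then show "\<forall>S p. \<not> ty r s S \<longrightarrow> tc \<alpha> S p = 0" using tc_proj[OF \<alpha>, of r s] by metis
next
  assume z: "\<forall>S p. \<not> ty r s S \<longrightarrow> tc \<alpha> S p = 0"
  have "tc (proj a b c r s \<alpha>) S p = tc \<alpha> S p" for S p using z by (simp add: tc_proj[OF \<alpha>])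
  then show "proj a b c r s \<alpha> = \<alpha>"
    by (intro HOL.ext) (simp only: form_tc[OF \<alpha>] form_tc[OF proj_V[OF \<alpha>]])
qed

lemma tc_dext_zero:
  assumes "\<alpha> \<in> V" "\<And>S p. tc \<alpha> S p = 0"
  shows "tc (dext \<alpha>) S p = 0"
proof -
  have "lw u (\<lambda>T. 0) S = 0" for u by (simp add: lw_def)
  then show ?thesis unfolding tc_dext[OF assms(1)] by (simp add: assms(2) Eder_zero_fun)
qed

text \<open>The sum over source bidegrees collapses, because every other projection of alpha is the
  zero form.\<close>

lemma tc_dbar_mu_pure:
  assumes \<alpha>: "\<alpha> \<in> V" and pure: "proj a b c r s \<alpha> = \<alpha>" and rs: "r \<le> 3" "s \<le> 3"
  shows "tc (dbar_mu a b c \<alpha>) S p = (if ty r (s + 1) S then tc (dext \<alpha>) S p else 0)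
      + (if 1 \<le> s \<and> ty (r + 2) (s - 1) S then tc (dext \<alpha>) S p else 0)"
proof -
  have z: "tc (dext (proj a b c r' s' \<alpha>)) S p = 0" if "\<not> (r' = r \<and> s' = s)" for r' s'
  proof (rule tc_dext_zero[OF proj_V[OF \<alpha>]])
    fix R p
    have "tc \<alpha> R p = 0" if "\<not> ty r s R" using pure_iff[OF \<alpha>] pure that by blast
    moreover have "\<not> (ty r s R \<and> ty r' s' R)" using that by (auto simp: ty_def)
    ultimately show "tc (proj a b c r' s' \<alpha>) R p = 0" by (auto simp: tc_proj[OF \<alpha>])
  qed
  let ?X = "(if ty r (s + 1) S then tc (dext \<alpha>) S p else 0)
      + (if 1 \<le> s \<and> ty (r + 2) (s - 1) S then tc (dext \<alpha>) S p else 0)"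
  have "tc (dbar_mu a b c \<alpha>) S p = (\<Sum>r'\<le>3. \<Sum>s'\<le>3. if s' = s then (if r' = r then ?X else 0) else 0)"
    unfolding tc_dbar_mu[OF \<alpha>]
  proof (intro sum.cong refl)
    fix r' s' :: nat
    show "(if ty r' (s' + 1) S then tc (dext (proj a b c r' s' \<alpha>)) S p else 0) +
       (if 1 \<le> s' \<and> ty (r' + 2) (s' - 1) S then tc (dext (proj a b c r' s' \<alpha>)) S p else 0)
       = (if s' = s then (if r' = r then ?X else 0) else 0)"
      using z[of r' s'] pure by (cases "r' = r \<and> s' = s") auto
  qed
  also have "\<dots> = (\<Sum>r'\<le>3. if r' = r then ?X else 0)"
    using rs(2) by (intro sum.cong refl) (simp only: sum.delta finite_atMost atMost_iff if_True)
  also have "\<dots> = ?X" using rs(1) by (simp only: sum.delta finite_atMost atMost_iff if_True)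
  finally show ?thesis .
qed

section \<open>Test forms and the weak adjoint equation\<close>

definition gform :: "(pt \<Rightarrow> complex) \<Rightarrow> nat set \<Rightarrow> form" where
  "gform g S = (\<lambda>T p. g p * wl (thc a b c) (sl S) T)"

lemma gform_V: "SI a0 P g \<Longrightarrow> gform g S \<in> V"
  unfolding smooth_forms_iff gform_def by (auto simp: supp6_def wl_outside intro!: SI_mult SI_const)

lemma tc_gform: "S \<subseteq> {1..6} \<Longrightarrow> tc (gform g S) R p = (if R = S then g p else 0)"
proof -
  assume S: "S \<subseteq> {1..6}"
  have "wl (mm (thc a b c) (Nc a b c)) (sl S) = wl dl (sl S)"
    by (rule wl_cong) (use mm_thc_Nc[OF an0 cn0] S finite_subset[OF S] in auto)
  then show ?thesis unfolding tc_def gform_def ext_scale ext_wl by (simp add: wl_dl[OF S])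
qed

lemma pure_gform: "SI a0 P g \<Longrightarrow> ty r s S \<Longrightarrow> proj a b c r s (gform g S) = gform g S"
  by (subst pure_iff[OF gform_V]) (auto simp: tc_gform ty_def)

lemma tc_dext_gform:
  assumes "SI a0 P g" "S \<subseteq> {1..6}"
  shows "tc (dext (gform g S)) R p = (\<Sum>i\<in>{1..6}. lw (Nc a b c i) (\<lambda>T. if T = S then Eder i g p else 0) R)
     + g p * ext (Nc a b c) (dc (wl (thc a b c) (sl S))) R"
proof -
  have e: "(\<lambda>T. Eder i (tc (gform g S) T) p) = (\<lambda>T. if T = S then Eder i g p else 0)" for i
  proof
    fix T
    have "tc (gform g S) T = (if T = S then g else (\<lambda>p. 0))" by (rule HOL.ext) (simp add: tc_gform[OF assms(2)])
    then show "Eder i (tc (gform g S) T) p = (if T = S then Eder i g p else 0)" by (simp add: Eder_const)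
  qed
  have "(\<Sum>R'\<in>U6. tc (gform g S) R' p * ext (Nc a b c) (dc (wl (thc a b c) (sl R'))) R)
     = (\<Sum>R'\<in>U6. if R' = S then g p * ext (Nc a b c) (dc (wl (thc a b c) (sl S))) R else 0)"
    by (intro sum.cong refl) (simp add: tc_gform[OF assms(2)])
  also have "\<dots> = g p * ext (Nc a b c) (dc (wl (thc a b c) (sl S))) R" using assms(2) by simp
  finally show ?thesis unfolding tc_dext[OF gform_V[OF assms(1)]] e by simp
qed

lemma SI_test_zero:
  assumes "SI a0 P w" "\<And>g. SI a0 P g \<Longrightarrow> IF (\<lambda>p. g p * cnj (w p)) = 0"
  shows "w p = 0"
  using IF_positive(3)[OF SI_CI[OF assms(1)] assms(2)[OF assms(1)]] .

text \<open>The equation \<open>adj \<psi> = 0\<close> in weak form, one scalar identity for each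
  test form, with the volume factor cancelled.\<close>

lemma adj_test:
  assumes "\<psi> \<in> V" "adj \<psi> = 0" "\<beta> \<in> V" "F \<subseteq> U6"
    "\<And>R p. R \<notin> F \<Longrightarrow> tc \<psi> R p = 0"
  shows "(\<Sum>S\<in>F. 2 ^ card S * IF (\<lambda>p. tc (dbar_mu a b c \<beta>) S p * cnj (tc \<psi> S p))) = 0"
proof -
  have "L2ip a b c a0 P (dbar_mu a b c \<beta>) \<psi> = 0" using adj_zero_iff[OF assms(1)] assms(2,3) by blast
  then have "(\<Sum>S\<in>U6. 2 ^ card S * IF (\<lambda>p. tc (dbar_mu a b c \<beta>) S p * cnj (tc \<psi> S p))) = 0"
    unfolding L2ip_tc[OF dbar_mu_V[OF assms(3)] assms(1)] using kap_nonzero by simp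
  also have "(\<Sum>S\<in>U6. 2 ^ card S * IF (\<lambda>p. tc (dbar_mu a b c \<beta>) S p * cnj (tc \<psi> S p)))
      = (\<Sum>S\<in>F. 2 ^ card S * IF (\<lambda>p. tc (dbar_mu a b c \<beta>) S p * cnj (tc \<psi> S p)))"
    using assms(4,5) by (intro sum.mono_neutral_right) (auto simp: IF_zero)
  finally show ?thesis by simp
qed

lemma Harm_iff: "\<psi> \<in> Harm a b c a0 P r \<longleftrightarrow> \<psi> \<in> V \<and> proj a b c r 0 \<psi> = \<psi> \<and> dbar_mu a b c \<psi> = 0 \<and> adj \<psi> = 0"
  using Lap_zero_iff by (auto simp: Harm_def)

lemma zero_Harm: "0 \<in> Harm a b c a0 P r"
proof -
  have "adj 0 = 0" using adj_zero_iff[OF zero_V] L2ip_zero dbar_mu_zero by simp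
  moreover have "proj a b c r 0 0 = 0" using pure_iff[OF zero_V] form_zero_iff[OF zero_V] by blast
  ultimately show ?thesis by (simp add: Harm_iff zero_V dbar_mu_zero)
qed

end

section \<open>Harmonic forms\<close>

declare One_nat_def [simp del]

text \<open>The determinant is -(r^2 + t^2). The system arises twice, with r = 1/(2a) and t =
  c/4.\<close>

lemma linear_system_trivial:
  fixes x y :: complex and r t :: real
  assumes "r \<noteq> 0" "complex_of_real t * x + complex_of_real r * y = 0" "complex_of_real r * x = complex_of_real t * y"
  shows "x = 0 \<and> y = 0"
proof -
  have "complex_of_real (r\<^sup>2 + t\<^sup>2) * x
     = complex_of_real r * (complex_of_real r * x) + complex_of_real t * (complex_of_real t * x)"
    by (simp add: power2_eq_square algebra_simps)
  also have "\<dots> = complex_of_real t * (complex_of_real t * x + complex_of_real r * y)"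
    unfolding assms(3) by (simp add: algebra_simps)
  finally have "complex_of_real (r\<^sup>2 + t\<^sup>2) * x = 0" using assms(2) by simp
  moreover have "r\<^sup>2 + t\<^sup>2 \<noteq> 0" using assms(1) by (simp add: add_nonneg_eq_0_iff)
  ultimately have "x = 0" by (metis mult_eq_0_iff of_real_eq_0_iff)
  then show ?thesis using assms(1,2) by simp
qed

text \<open>The pairs of real fields that make up the duals of theta^4, theta^5 and theta^6; for
  theta^6 there is an additional E_3 term proportional to b.\<close>

lemma one_par_commute:
  "gmul (one_par 1 s) (one_par 2 u) = gmul (one_par 2 u) (one_par 1 s)"
  "gmul (one_par 3 s) (one_par 6 u) = gmul (one_par 6 u) (one_par 3 s)"
  "gmul (one_par 4 s) (one_par 5 u) = gmul (one_par 5 u) (one_par 4 s)"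
  by (simp_all add: bs_def gmul_def)

context almost_kaehler
begin

text \<open>The equation reads E_i f = k E_j f with k purely imaginary. By commutation the integral
  of E_i f times cnj (E_j f) is symmetric in i and j, whereas the equation makes it antisymmetric;
  so the integral of |E_j f|^2 vanishes.\<close>

lemma cauchy_riemann_trivial:
  assumes f: "SI a0 P f" and i: "i \<in> {1..6}" and j: "j \<in> {1..6}"
    and com: "\<And>s u. gmul (one_par i s) (one_par j u) = gmul (one_par j u) (one_par i s)"
    and r: "r \<noteq> 0" and eq: "\<And>p. complex_of_real r * Eder i f p + (\<i> / 2) * Eder j f p = 0"
  shows "Eder i f p = 0 \<and> Eder j f p = 0"
proof -
  define k where "k = - (\<i> / (2 * complex_of_real r))"
  have A: "Eder i f p = k * Eder j f p" for p
    using eq[of p] r by (simp add: k_def field_simps add_eq_0_iff)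
  have k: "cnj k = - k" "k \<noteq> 0" using r by (simp_all add: k_def)
  have "IF (\<lambda>p. Eder i f p * cnj (Eder j f p)) = IF (\<lambda>p. Eder j f p * cnj (Eder i f p))"
    by (rule IF_Eder_commute[OF f i j com])
  moreover have "IF (\<lambda>p. Eder i f p * cnj (Eder j f p)) = k * IF (\<lambda>p. Eder j f p * cnj (Eder j f p))"
    unfolding A mult.assoc by (rule IF_scale)
  moreover have "IF (\<lambda>p. Eder j f p * cnj (Eder i f p)) = - k * IF (\<lambda>p. Eder j f p * cnj (Eder j f p))"
    unfolding A complex_cnj_mult k mult.left_commute[of _ "- k"] by (rule IF_scale)
  ultimately have "IF (\<lambda>p. Eder j f p * cnj (Eder j f p)) = 0" using k(2) by simp
  then have "Eder j f p = 0" for p by (rule IF_positive(3)[OF SI_CI[OF SI_Eder[OF f j]]])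
  then show ?thesis using A by simp
qed

text \<open>Integrate by parts against u itself: u is orthogonal to every derivative of f that
  occurs in its own expression.\<close>

lemma gradient_orthogonal:
  assumes f: "SI a0 P f" and u: "SI a0 P u"
    and eq: "\<And>p. u p = (\<Sum>i\<in>{1..6}. k i * Eder i f p)"
    and z: "\<And>i p. i \<in> {1..6} \<Longrightarrow> k i \<noteq> 0 \<Longrightarrow> Eder i u p = 0"
  shows "u p = 0"
proof (rule IF_positive(3)[OF SI_CI[OF u]])
  have uu: "(\<lambda>p. u p * cnj (u p)) = (\<lambda>p. \<Sum>i\<in>{1..6}. k i * (Eder i f p * cnj (u p)))"
    by (rule HOL.ext, subst (1) eq) (simp add: sum_distrib_right mult.assoc)
  have "IF (\<lambda>p. \<Sum>i\<in>{1..6}. k i * (Eder i f p * cnj (u p))) = (\<Sum>i\<in>{1..6}. IF (\<lambda>p. k i * (Eder i f p * cnj (u p))))"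
    by (intro IF_sum CI_intros SI_CI SI_Eder f u) auto
  also have "\<dots> = 0"
  proof (intro sum.neutral ballI)
    fix i :: nat assume i: "i \<in> {1..6}"
    have "IF (\<lambda>p. Eder i f p * cnj (u p)) = - IF (\<lambda>p. f p * cnj (Eder i u p))" by (rule IF_parts[OF f u i])
    then show "IF (\<lambda>p. k i * (Eder i f p * cnj (u p))) = 0"
      using z[OF i] by (cases "k i = 0") (simp_all add: IF_scale IF_zero)
  qed
  finally show "IF (\<lambda>p. u p * cnj (u p)) = 0" unfolding uu .
qed

lemma antiholomorphic_23_trivial:
  assumes f: "SI a0 P f"
    and e5: "\<And>p. (\<Sum>i\<in>{1..6}. Nc a b c i 5 * Eder i f p) = 0"
    and e6: "\<And>p. (\<Sum>i\<in>{1..6}. Nc a b c i 6 * Eder i f p) = 0"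
  shows "Eder 3 f p = 0" "Eder 4 f p = 0" "Eder 5 f p = 0" "Eder 6 f p = 0"
proof -
  have 5: "complex_of_real (1 / (2 * c)) * Eder 3 f p + (\<i> / 2) * Eder 6 f p = 0" for p
    using e5[of p] unfolding sum6 by (simp add: Nc_def)
  have c0: "1 / (2 * c) \<noteq> 0" using cn0 by simp
  have 36: "Eder 3 f p = 0 \<and> Eder 6 f p = 0" for p
    by (rule cauchy_riemann_trivial[OF f _ _ one_par_commute(2) c0 5]) auto
  \<comment> \<open>Column 6 of \<open>Nc\<close> contains an E_3 term proportional to
    \<open>b\<close>, already known to vanish by \<open>36\<close>; this is why column 5 is treated
    first.\<close>
  have 6: "complex_of_real (1 / (2 * c)) * Eder 4 f p + (\<i> / 2) * Eder 5 f p = 0" for p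
    using e6[of p] 36[of p] unfolding sum6 by (simp add: Nc_def)
  have 45: "Eder 4 f p = 0 \<and> Eder 5 f p = 0" for p
    by (rule cauchy_riemann_trivial[OF f _ _ one_par_commute(3) c0 6]) auto
  show "Eder 3 f p = 0" "Eder 4 f p = 0" "Eder 5 f p = 0" "Eder 6 f p = 0" using 36 45 by auto
qed

lemma antiholomorphic_1_trivial:
  assumes f: "SI a0 P f" and e4: "\<And>p. (\<Sum>i\<in>{1..6}. Nc a b c i 4 * Eder i f p) = 0"
  shows "Eder 1 f p = 0 \<and> Eder 2 f p = 0"
proof -
  have 4: "complex_of_real (1 / (2 * a)) * Eder 1 f p + (\<i> / 2) * Eder 2 f p = 0" for p
    using e4[of p] unfolding sum6 by (simp add: Nc_def)
  have a0: "1 / (2 * a) \<noteq> 0" using an0 by simp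
  show ?thesis by (rule cauchy_riemann_trivial[OF f _ _ one_par_commute(1) a0 4]) auto
qed

section \<open>Degree (1,0)\<close>

lemma sl_values: "sl {k} = [k]" "k < l \<Longrightarrow> sl {k,l} = [k,l]"
  by simp (intro sorted_distinct_set_unique; auto)

text \<open>For reasons of bidegree the adjoint equation says nothing about (1,0)-forms, so
  everything has to come from the (1,1)-components of d psi.\<close>

lemma closed_10_constant:
  assumes \<psi>: "\<psi> \<in> V" "proj a b c 1 0 \<psi> = \<psi>" "dbar_mu a b c \<psi> = 0"
  shows "\<exists>z. \<psi> = gform (\<lambda>p. z) {1}"
proof -
  have z: "tc \<psi> S p = 0" if "S \<noteq> {1}" "S \<noteq> {2}" "S \<noteq> {3}" for S p
    using pure_iff[OF \<psi>(1)] \<psi>(2) that ty_cases(1) by blast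
  define f1 f2 f3 where f: "f1 = tc \<psi> {1}" "f2 = tc \<psi> {2}" "f3 = tc \<psi> {3}"
  have SIf: "SI a0 P f1" "SI a0 P f2" "SI a0 P f3" unfolding f by (rule SI_tc[OF \<psi>(1)])+
  \<comment> \<open>The vanishing coefficient of theta^k theta^l in d psi. No multiple of
    \<open>f1\<close> stands on the right because theta^1 is closed.\<close>
  have eqn: "(\<Sum>i\<in>{1..6}. Nc a b c i l * Eder i (tc \<psi> {k}) p) = f2 p * th1 2 {k,l} + f3 p * th1 3 {k,l}"
    if k: "k \<in> {1,2,3}" and l: "l \<in> {4,5,6}" for k l p
  proof -
    have kl: "k < l" "k \<in> {1..6}" "l \<in> {1..6}" using k l by auto
    have "ty 1 1 {k,l}" using k l by (elim insertE) (simp_all add: ty_def)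
    moreover have "tc (dbar_mu a b c \<psi>) {k,l} p = 0" using \<psi>(3) form_zero_iff[OF dbar_mu_V[OF \<psi>(1)]] by blast
    ultimately have "tc (dext \<psi>) {k,l} p = 0" using tc_dbar_mu_pure[OF \<psi>(1,2), of "{k,l}" p] by simp
    moreover have "lw (Nc a b c i) (\<lambda>T. Eder i (tc \<psi> T) p) {k,l} = - (Nc a b c i l * Eder i (tc \<psi> {k}) p)" for i
    proof -
      have "Eder i (tc \<psi> {l}) p = 0" by (rule Eder_zero_fun, rule z) (use l in auto)
      then show ?thesis by (simp add: lw_pair[OF kl])
    qed
    moreover have "(\<Sum>R\<in>U6. tc \<psi> R p * ext (Nc a b c) (dc (wl (thc a b c) (sl R))) {k,l})
        = f2 p * th1 2 {k,l} + f3 p * th1 3 {k,l}"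
    proof -
      have "(\<Sum>R\<in>U6. tc \<psi> R p * ext (Nc a b c) (dc (wl (thc a b c) (sl R))) {k,l})
        = (\<Sum>R\<in>{{1},{2},{3}}. tc \<psi> R p * ext (Nc a b c) (dc (wl (thc a b c) (sl R))) {k,l})"
        by (rule sum.mono_neutral_right) (use z in auto)
      also have "\<dots> = f1 p * th1 1 {k,l} + f2 p * th1 2 {k,l} + f3 p * th1 3 {k,l}"
        using ext_dc_theta1[of 1 "{k,l}"] ext_dc_theta1[of 2 "{k,l}"] ext_dc_theta1[of 3 "{k,l}"]
        by (simp add: f sl_values del: wl.simps One_nat_def)
      finally show ?thesis by (simp only: th1_1) simp
    qed
    ultimately show ?thesis unfolding tc_dext[OF \<psi>(1)] by (simp add: sum_negf)
  qed
  have k2: "Eder 3 f2 p = 0" "Eder 4 f2 p = 0" "Eder 5 f2 p = 0" "Eder 6 f2 p = 0" for p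
    using antiholomorphic_23_trivial[OF SIf(2)] eqn[of 2 5] eqn[of 2 6] by (simp_all add: f th1_values)
  have k3: "Eder 3 f3 p = 0" "Eder 4 f3 p = 0" "Eder 5 f3 p = 0" "Eder 6 f3 p = 0" for p
    using antiholomorphic_23_trivial[OF SIf(3)] eqn[of 3 5] eqn[of 3 6] by (simp_all add: f th1_values)
  \<comment> \<open>The inhomogeneous terms of the equations for \<open>f1\<close> are constant along the fibres, hence
    orthogonal to the fibrewise derivatives of \<open>f1\<close>, which they equal.\<close>
  have comb: "x * f2 p + y * f3 p = 0"
    if l: "l = 5 \<or> l = 6" and eq: "\<And>p. x * f2 p + y * f3 p = (\<Sum>i\<in>{1..6}. Nc a b c i l * Eder i f1 p)" for x y l p
  proof (rule gradient_orthogonal[OF SIf(1) _ eq])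
    show "SI a0 P (\<lambda>p. x * f2 p + y * f3 p)" by (intro SI_add SI_scale SIf)
    fix i p assume i: "i \<in> {1..6}" "Nc a b c i l \<noteq> 0"
    have d: "(\<lambda>p. x * f2 p) differentiable (at p)" "(\<lambda>p. y * f3 p) differentiable (at p)"
      "f2 differentiable (at p)" "f3 differentiable (at p)"
      by (rule SI_differentiable[of a0 P], intro SI_scale SIf)+
    have "i = 3 \<or> i = 4 \<or> i = 5 \<or> i = 6" proof -
      have "Nc a b c 1 l = 0" "Nc a b c 2 l = 0" using l by (auto simp: Nc_def)
      then show ?thesis using i unfolding in6 by auto
    qed
    then show "Eder i (\<lambda>p. x * f2 p + y * f3 p) p = 0"
      unfolding Eder_add[OF d(1,2)] Eder_scale[OF d(3)] Eder_scale[OF d(4)] using k2[of p] k3[of p] by auto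
  qed
  have f23: "f2 p = 0 \<and> f3 p = 0" for p
  proof -
    have 5: "th1 2 {1,5} * f2 p + th1 3 {1,5} * f3 p = 0"
      by (rule comb[of 5]) (use eqn[of 1 5] in \<open>auto simp: f mult.commute\<close>)
    have 6: "th1 2 {1,6} * f2 p + th1 3 {1,6} * f3 p = 0"
      by (rule comb[of 6]) (use eqn[of 1 6] in \<open>auto simp: f mult.commute\<close>)
    have "complex_of_real (c / 4) * f3 p + complex_of_real (1 / (2 * a)) * f2 p = - (th1 2 {1,5} * f2 p + th1 3 {1,5} * f3 p)"
      "complex_of_real (1 / (2 * a)) * f3 p - complex_of_real (c / 4) * f2 p = th1 2 {1,6} * f2 p + th1 3 {1,6} * f3 p"
      by (simp_all add: th1_values)
    then have "complex_of_real (c / 4) * f3 p + complex_of_real (1 / (2 * a)) * f2 p = 0"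
      "complex_of_real (1 / (2 * a)) * f3 p = complex_of_real (c / 4) * f2 p"
      unfolding 5 6 by simp_all
    moreover have "1 / (2 * a) \<noteq> 0" using an0 by simp
    ultimately show ?thesis using linear_system_trivial by blast
  qed
  have h: "(\<Sum>i\<in>{1..6}. Nc a b c i l * Eder i f1 p) = 0" if "l \<in> {4,5,6}" for l p
    using eqn[of 1 l p] that f23[of p] by (simp add: f(1))
  have "Eder i f1 p = 0" if "i \<in> {1..6}" for i p
    using antiholomorphic_23_trivial[OF SIf(1) h h, of p] antiholomorphic_1_trivial[OF SIf(1) h, of p] that
    unfolding in6 by auto
  then obtain w where w: "\<And>p. f1 p = w" using constant_if_Eder_zero[of f1] SI_differentiable[OF SIf(1)] by blast
  have "\<psi> T p = gform (\<lambda>p. w) {1} T p" for T p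
  proof -
    have "tc \<psi> S p = tc (gform (\<lambda>p. w) {1}) S p" for S
      using z[of S p] f23[of p] w[of p] by (auto simp: tc_gform f)
    then show ?thesis by (simp only: form_tc[OF \<psi>(1)] form_tc[OF gform_V[OF SI_const]])
  qed
  then show ?thesis by blast
qed

lemma constant_10_harmonic: "gform (\<lambda>p. z) {1} \<in> Harm a b c a0 P 1"
proof -
  let ?\<psi> = "gform (\<lambda>p. z) {1}"
  have V: "?\<psi> \<in> V" by (rule gform_V[OF SI_const])
  have t: "ty 1 0 {1}" by (simp add: ty_def)
  have pure: "proj a b c 1 0 ?\<psi> = ?\<psi>" by (rule pure_gform[OF SI_const t])
  have d: "tc (dext ?\<psi>) S p = 0" for S p
  proof -
    have e: "(\<lambda>T. if T = {1} then Eder i (\<lambda>p. z) p else 0) = (\<lambda>T. 0)" for i by (auto simp: Eder_const)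
    have "lw (Nc a b c i) (\<lambda>T. if T = {1} then Eder i (\<lambda>p. z) p else 0) S = 0" for i
      unfolding e by (simp add: lw_def)
    moreover have "ext (Nc a b c) (dc (wl (thc a b c) (sl {1}))) S = 0"
      using ext_dc_theta1[of 1 S] th1_1 by (simp add: sl_values del: wl.simps)
    ultimately show ?thesis by (subst tc_dext_gform[OF SI_const]) (simp_all del: wl.simps)
  qed
  have "tc (dbar_mu a b c ?\<psi>) S p = 0" for S p using tc_dbar_mu_pure[OF V pure] d by simp
  then have 1: "dbar_mu a b c ?\<psi> = 0" using form_zero_iff[OF dbar_mu_V[OF V]] by blast
  have "L2ip a b c a0 P (dbar_mu a b c \<beta>) ?\<psi> = 0" if \<beta>: "\<beta> \<in> V" for \<beta>
  proof -
    \<comment> \<open>The operator raises the antiholomorphic degree by one or the holomorphic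
      degree by two, so nothing lands in bidegree (1,0).\<close>
    have "\<not> ty r (s + 1) {1}" "\<not> ty (r + 2) (s - 1) {1}" for r s :: nat by (simp_all add: ty_def)
    then have "tc (dbar_mu a b c \<beta>) {1} p = 0" for p unfolding tc_dbar_mu[OF \<beta>] by (intro sum.neutral ballI) simp
    then have "tc (dbar_mu a b c \<beta>) S p * cnj (tc ?\<psi> S p) = 0" for S p by (simp add: tc_gform)
    then show ?thesis unfolding L2ip_tc[OF dbar_mu_V[OF \<beta>] V] by (simp only: IF_zero) simp
  qed
  then have "adj ?\<psi> = 0" using adj_zero_iff[OF V] by blast
  then show ?thesis using V pure 1 by (simp add: Harm_iff)
qed

lemma Harm_1: "Harm a b c a0 P 1 = range (\<lambda>z. gform (\<lambda>p. z) {1})"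
proof (intro equalityI subsetI)
  fix \<psi> assume "\<psi> \<in> Harm a b c a0 P 1"
  then obtain z where "\<psi> = gform (\<lambda>p. z) {1}" using closed_10_constant unfolding Harm_iff by blast
  then show "\<psi> \<in> range (\<lambda>z. gform (\<lambda>p. z) {1})" by simp
qed (use constant_10_harmonic in blast)

lemma Harm_3: "Harm a b c a0 P 3 = {0}"
proof -
  have "\<psi> = 0" if "\<psi> \<in> Harm a b c a0 P 3" for \<psi>
  proof -
    have \<psi>: "\<psi> \<in> V" "proj a b c 3 0 \<psi> = \<psi>" "adj \<psi> = 0" using that by (simp_all add: Harm_iff)
    have z: "tc \<psi> S p = 0" if "S \<noteq> {1,2,3}" for S p
      using pure_iff[OF \<psi>(1)] \<psi>(2) that ty_cases(3) by blast
    have "tc \<psi> {1,2,3} p = 0" for p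
    proof (rule SI_test_zero[OF SI_tc[OF \<psi>(1)]])
      fix g assume g: "SI a0 P g"
      \<comment> \<open>A (1,1)-form whose image under mu is a nonzero multiple of theta^{123}.
        Removing an index from {1,2,3} never leaves {3,5}, so derivatives of \<open>g\<close> do not
        contribute.\<close>
      have t: "ty 1 1 {3,5}" by (simp add: ty_def)
      have d: "tc (dext (gform g {3,5})) {1,2,3} p = g p * (1 / (2 * complex_of_real a))" for p
      proof -
        have "lw (Nc a b c i) (\<lambda>T. if T = {3,5} then Eder i g p else 0) {1,2,3} = 0" for i
          by (simp add: lw_triple doubleton_eq_iff)
        then show ?thesis
          using ext_dc_theta2[of 3 5 "{1,2,3}"] th2_values(2) by (simp add: tc_dext_gform[OF g] sl_values)
      qed
      have "ty 3 0 {1,2,3}" "\<not> ty 1 2 {1,2,3}" by (simp_all add: ty_def)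
      then have "tc (dbar_mu a b c (gform g {3,5})) {1,2,3} p = g p * (1 / (2 * complex_of_real a))" for p
        using tc_dbar_mu_pure[OF gform_V[OF g] pure_gform[OF g t], of "{1,2,3}" p] d[of p]
        by simp
      moreover have "(\<Sum>S\<in>{{1,2,3}}. 2 ^ card S * IF (\<lambda>p. tc (dbar_mu a b c (gform g {3,5})) S p * cnj (tc \<psi> S p))) = 0"
        by (rule adj_test[OF \<psi>(1,3) gform_V[OF g]]) (use z in auto)
      ultimately have "IF (\<lambda>p. g p * (1 / (2 * complex_of_real a)) * cnj (tc \<psi> {1,2,3} p)) = 0" by simp
      moreover have "(\<lambda>p. g p * (1 / (2 * complex_of_real a)) * cnj (tc \<psi> {1,2,3} p))
          = (\<lambda>p. (1 / (2 * complex_of_real a)) * (g p * cnj (tc \<psi> {1,2,3} p)))" by (simp add: mult_ac)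
      ultimately have "(1 / (2 * complex_of_real a)) * IF (\<lambda>p. g p * cnj (tc \<psi> {1,2,3} p)) = 0" by (simp only: IF_scale)
      then show "IF (\<lambda>p. g p * cnj (tc \<psi> {1,2,3} p)) = 0" using an0 by simp
    qed
    then show ?thesis using form_zero_iff[OF \<psi>(1)] z by metis
  qed
  then show ?thesis using zero_Harm by blast
qed

lemma Harm_2: "Harm a b c a0 P 2 = {0}"
proof -
  have "\<psi> = 0" if "\<psi> \<in> Harm a b c a0 P 2" for \<psi>
  proof -
    have \<psi>: "\<psi> \<in> V" "proj a b c 2 0 \<psi> = \<psi>" "adj \<psi> = 0" "dbar_mu a b c \<psi> = 0" using that by (simp_all add: Harm_iff)
    have z: "tc \<psi> S p = 0" if "S \<noteq> {1,2}" "S \<noteq> {1,3}" "S \<noteq> {2,3}" for S p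
      using pure_iff[OF \<psi>(1)] \<psi>(2) that ty_cases(2) by blast
    let ?x = "\<lambda>S p. tc \<psi> S p"
    have SIx: "SI a0 P (?x S)" for S by (rule SI_tc[OF \<psi>(1)])
    \<comment> \<open>Test forms g theta^5 and g theta^6. Their (2,0)-parts contain no derivative of
      \<open>g\<close>, since removing an index from a pair in {1,2,3} never leaves {5} or
      {6}.\<close>
    have test: "cnj (th1 k {1,2}) * ?x {1,2} p + cnj (th1 k {1,3}) * ?x {1,3} p = 0" if k: "k = 5 \<or> k = 6" for k p
    proof (rule SI_test_zero[of "\<lambda>p. cnj (th1 k {1,2}) * ?x {1,2} p + cnj (th1 k {1,3}) * ?x {1,3} p"])
      show "SI a0 P (\<lambda>p. cnj (th1 k {1,2}) * ?x {1,2} p + cnj (th1 k {1,3}) * ?x {1,3} p)"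
        by (intro SI_add SI_scale SIx)
      fix g assume g: "SI a0 P g"
      have k6: "{k} \<subseteq> {1..6}" "k \<in> {1..6}" "k > 3" using k by auto
      have t: "ty 0 1 {k}" using k by (auto simp: ty_def)
      have d: "tc (dext (gform g {k})) S p = g p * th1 k S" if S: "S = {1,2} \<or> S = {1,3} \<or> S = {2,3}" for S p
      proof -
        have "lw (Nc a b c i) (\<lambda>T. if T = {k} then Eder i g p else 0) S = 0" for i
          using S k6(3) by (elim disjE) (simp_all add: lw_pair)
        then show ?thesis by (simp add: tc_dext_gform[OF g k6(1)] sl_values ext_dc_theta1[OF k6(2)] del: wl.simps)
      qed
      have e: "tc (dbar_mu a b c (gform g {k})) S p = g p * th1 k S" if S: "S = {1,2} \<or> S = {1,3} \<or> S = {2,3}" for S p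
      proof -
        have "ty 2 0 S" using S ty_cases(2) by blast
        moreover from this have "\<not> ty 0 2 S" by (simp add: ty_def)
        ultimately show ?thesis
          using tc_dbar_mu_pure[OF gform_V[OF g] pure_gform[OF g t], of S p] d[OF S, of p] by (simp add: numeral_2_eq_2)
      qed
      \<comment> \<open>Testing against these forms does not detect the coefficient of theta^{23};
        this is why that coefficient is left to the equation for d psi.\<close>
      have th23: "th1 k {2,3} = 0" using k th1_values by auto
      have ne: "{1,2} \<noteq> {1,3::nat}" "{1,2} \<noteq> {2,3::nat}" "{1,3} \<noteq> {2,3::nat}" by (auto simp: doubleton_eq_iff)
      have cd: "card {1,2::nat} = 2" "card {1,3::nat} = 2" "card {2,3::nat} = 2" by simp_all
      have "(\<Sum>S\<in>{{1,2},{1,3},{2,3}}. 2 ^ card S * IF (\<lambda>p. tc (dbar_mu a b c (gform g {k})) S p * cnj (tc \<psi> S p))) = 0"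
        by (rule adj_test[OF \<psi>(1,3) gform_V[OF g]]) (use z in auto)
      then have "4 * IF (\<lambda>p. g p * th1 k {1,2} * cnj (?x {1,2} p)) + 4 * IF (\<lambda>p. g p * th1 k {1,3} * cnj (?x {1,3} p)) = 0"
        using ne by (simp add: e cd th23 IF_zero)
      then have "IF (\<lambda>p. g p * th1 k {1,2} * cnj (?x {1,2} p)) + IF (\<lambda>p. g p * th1 k {1,3} * cnj (?x {1,3} p)) = 0"
        unfolding distrib_left[symmetric] by (simp only: mult_eq_0_iff) simp
      moreover have "CI (\<lambda>p. g p * th1 k S * cnj (?x S p))" for S
        by (intro CI_intros SI_CI g SIx)
      ultimately have "IF (\<lambda>p. g p * th1 k {1,2} * cnj (?x {1,2} p) + g p * th1 k {1,3} * cnj (?x {1,3} p)) = 0"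
        by (simp add: IF_add)
      then show "IF (\<lambda>p. g p * cnj (cnj (th1 k {1,2}) * ?x {1,2} p + cnj (th1 k {1,3}) * ?x {1,3} p)) = 0"
        by (simp add: algebra_simps)
    qed
    have x0: "?x {1,2} p = 0 \<and> ?x {1,3} p = 0" for p
    proof -
      have "complex_of_real (c / 4) * ?x {1,2} p + complex_of_real (1 / (2 * a)) * ?x {1,3} p
          = cnj (th1 6 {1,2}) * ?x {1,2} p + cnj (th1 6 {1,3}) * ?x {1,3} p"
        "complex_of_real (1 / (2 * a)) * ?x {1,2} p - complex_of_real (c / 4) * ?x {1,3} p
          = - (cnj (th1 5 {1,2}) * ?x {1,2} p + cnj (th1 5 {1,3}) * ?x {1,3} p)"
        by (simp_all add: th1_values)
      then have "complex_of_real (c / 4) * ?x {1,2} p + complex_of_real (1 / (2 * a)) * ?x {1,3} p = 0"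
        "complex_of_real (1 / (2 * a)) * ?x {1,2} p = complex_of_real (c / 4) * ?x {1,3} p"
        using test[of 5 p] test[of 6 p] by simp_all
      moreover have "1 / (2 * a) \<noteq> 0" using an0 by simp
      ultimately show ?thesis using linear_system_trivial by blast
    qed
    have "ty 2 1 {1,3,5}" by (simp add: ty_def)
    have "tc (dbar_mu a b c \<psi>) {1,3,5} p = 0" for p using \<psi>(4) form_zero_iff[OF dbar_mu_V[OF \<psi>(1)]] by blast
    then have d0: "tc (dext \<psi>) {1,3,5} p = 0" for p
      using tc_dbar_mu_pure[OF \<psi>(1,2), of "{1,3,5}" p] \<open>ty 2 1 {1,3,5}\<close> by simp
    have only: "?x S p = 0" if "S \<noteq> {2,3}" for S p using z[of S p] x0[of p] that by auto
    have "?x {2,3} p = 0" for p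
    proof -
      \<comment> \<open>Removing an index from {1,3,5} never leaves {2,3}, so no derivative of the
        surviving coefficient appears.\<close>
      have l0: "lw (Nc a b c i) (\<lambda>T. Eder i (?x T) p) {1,3,5} = 0" for i
        by (simp add: lw_triple Eder_zero_fun only doubleton_eq_iff)
      have "(\<Sum>R\<in>U6. ?x R p * ext (Nc a b c) (dc (wl (thc a b c) (sl R))) {1,3,5})
         = (\<Sum>R\<in>{{2,3}}. ?x R p * ext (Nc a b c) (dc (wl (thc a b c) (sl R))) {1,3,5})"
        by (rule sum.mono_neutral_right) (use only in auto)
      also have "\<dots> = ?x {2,3} p * (1 / (2 * complex_of_real a))"
        using ext_dc_theta2[of 2 3 "{1,3,5}"] th2_values(1) by (simp add: sl_values)
      finally show ?thesis using d0[of p] an0 unfolding tc_dext[OF \<psi>(1)] by (simp add: l0)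
    qed
    then show ?thesis using form_zero_iff[OF \<psi>(1)] only by metis
  qed
  then show ?thesis using zero_Harm by blast
qed

end

section \<open>Dimensions of the spaces of harmonic forms\<close>

lemma vector_space_fscale: "vector_space fscale"
  by unfold_locales (auto simp: fscale_def fun_eq_iff algebra_simps)

text \<open>A finite spanning set is exhibited along with the dimension, because \<open>dim\<close>
  would also return 0 for an infinite-dimensional space.\<close>

lemma hfin_hdim_zero:
  assumes "Harm a b c a0 P r = {0}"
  shows "hfin a b c a0 P r \<and> hdim a b c a0 P r = 0"
proof -
  interpret vector_space fscale by (rule vector_space_fscale)
  have "dim {0 :: form} = 0" using dim_span[of "{}"] dim_eq_card_independent[of "{}"] independent_empty by simp
  then show ?thesis unfolding hfin_def hdim_def assms by (auto intro!: exI[of _ "{}"])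
qed

lemma hfin_hdim_line:
  assumes "Harm a b c a0 P r = range (\<lambda>z. fscale z \<phi>)" "\<phi> \<noteq> 0"
  shows "hfin a b c a0 P r \<and> hdim a b c a0 P r = 1"
proof -
  interpret vector_space fscale by (rule vector_space_fscale)
  have s: "span {\<phi>} = range (\<lambda>z. fscale z \<phi>)" by (rule span_singleton)
  have "independent {\<phi>}" using assms(2) by simp
  then have "dim (span {\<phi>}) = 1" using dim_eq_card_independent[of "{\<phi>}"] by (simp add: dim_span)
  moreover have "\<phi> \<in> span {\<phi>}" by (rule span_base) simp
  ultimately show ?thesis unfolding hfin_def hdim_def assms(1) s[symmetric] by (auto intro!: exI[of _ "{\<phi>}"])
qed

theorem mainTheorem3:
  fixes a b c a0 :: real and B :: "int^2^2" and P :: "real^2^2"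
  assumes "a \<noteq> 0" and "c \<noteq> 0"
    and "a0 > 0" and "det B = 1"
    and "invertible P"
    and "P ** (\<chi> i j. real_of_int (B$i$j)) ** matrix_inv P
           = (\<chi> i j. if i = j then (if i = 1 then exp a0 else exp (- a0)) else 0)"
  shows "hfin a b c a0 P 1 \<and> hdim a b c a0 P 1 = 1
       \<and> hfin a b c a0 P 2 \<and> hdim a b c a0 P 2 = 0
       \<and> hfin a b c a0 P 3 \<and> hdim a b c a0 P 3 = 0"
proof -
  interpret almost_kaehler a0 P B a b c
    by unfold_locales (use assms in auto)
  have e: "(\<lambda>z. gform (\<lambda>p. z) {1}) = (\<lambda>z. fscale z (gform (\<lambda>p. 1) {1}))"
    by (simp add: fun_eq_iff gform_def fscale_def)
  have "Harm a b c a0 P 1 = range (\<lambda>z. fscale z (gform (\<lambda>p. 1) {1}))"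
    unfolding Harm_1 e ..
  moreover have "gform (\<lambda>p. 1) {1} \<noteq> 0"
  proof
    assume "gform (\<lambda>p. 1) {1} = 0"
    then have "tc (gform (\<lambda>p. 1) {1}) {1} p = 0" for p
      using form_zero_iff[OF gform_V[OF SI_const]] by blast
    then show False by (simp add: tc_gform)
  qed
  ultimately show ?thesis
    using hfin_hdim_line hfin_hdim_zero[OF Harm_2] hfin_hdim_zero[OF Harm_3] by blast
qed

end
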